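(* Let $\mathbb{F}=\mathbb{R}$ or $\mathbb{F}=\mathbb{C}$, let $m,n$ be positive integers, and let $\underline{d}=(d_1,\ldots,d_m)$ be a list of nonnegative integers with $\max_{1\le i\le m} d_i>0$. Let $M(\lambda)\in\mathbb{F}[\lambda]^{m\times(m+n)}_{\underline{d}}$ be a minimal basis and let $M_{\underline{d}}$ be its leading row-wise coefficient matrix. Then the following statements hold. (a) If $\operatorname{rank}(M_{\underline{d}})<m$, then for all $\epsilon>0$ there exists a polynomial matrix $\widetilde M(\lambda)\in\mathbb{F}[\lambda]^{m\times(m+n)}_{\underline{d}}$ that is not a minimal basis and satisfies $\|T_1(M)-T_1(\widetilde M)\|_2<\epsilon$. (b) If $\operatorname{rank}(M_{\underline{d}})=m$, then there exists an index $k$ such that $T_k(M)$ has full row rank and every polynomial matrix $\widetilde M(\lambda)\in\mathbb{F}[\lambda]^{m\times(m+n)}_{\underline{d}}$ that satisfies $$\|T_1(M)-T_1(\widetilde M)\|_2<\frac{\sigma_{km+\sum_{i=1}^m d_i}(T_k(M))}{\sqrt{k}}$$ is a minimal basis with $\operatorname{rank}(\widetilde M_{\underline{d}})=m$.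
   Context: Space: $\mathbb{F}[\lambda]^{m\times(m+n)}_{\underline{d}}$ is the $\mathbb{F}$-linear space of $m\times(m+n)$ polynomial matrices $M(\lambda)$ whose $i$th row has the form $R_i(\lambda)=R_{i,0}+R_{i,1}\lambda+\cdots+R_{i,d_i}\lambda^{d_i}$ with $R_{i,j}\in\mathbb{F}^{1\times(m+n)}$, $i=1,\ldots,m$. The leading row-wise coefficient matrix of $M(\lambda)$ is the $m\times(m+n)$ constant matrix $M_{\underline{d}}$ whose $i$th row is $R_{i,d_i}$ (similarly $\widetilde M_{\underline{d}}$ for $\widetilde M(\lambda)$). Trimmed Sylvester matrices: put $d=\max_i d_i$ and write $M(\lambda)=M_0+M_1\lambda+\cdots+M_d\lambda^d$. For $k\ge1$, the $k$th Sylvester matrix $S_k(M)\in\mathbb{F}^{(k+d)m\times k(m+n)}$ is the block matrix with $k+d$ block rows (indexed $0,\ldots,k+d-1$) and $k$ block columns (indexed $0,\ldots,k-1$) whose $(p,q)$ block is $M_{p-q}$ if $0\le p-q\le d$ and $0$ otherwise. The $k$th trimmed Sylvester matrix $T_k(M)\in\mathbb{F}^{(km+\sum_{i=1}^m d_i)\times k(m+n)}$ is obtained from $S_k(M)$ by deleting, for every $i=1,\ldots,m$, the $i$th row of each of the last $d-d_i$ block rows (these rows are always zero), keeping the order of the remaining rows. Minimal basis: a minimal basis of a subspace $\mathcal V\subseteq\mathbb{F}(\lambda)^{q}$ is a basis of $\mathcal V$ consisting of polynomial vectors with minimal sum of degrees among all polynomial bases of $\mathcal V$. A polynomial matrix with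 more columns than rows is called a minimal basis if its rows form a minimal basis of the rational subspace they span. Notation: $\|\cdot\|_2$ is the spectral norm; $\sigma_1(A)\ge\cdots\ge\sigma_{\min\{p,q\}}(A)$ are the singular values of $A\in\mathbb{F}^{p\times q}$. *)

theory Defs
  imports
    "HOL-Analysis.L2_Norm"
    "HOL-Computational_Algebra.Computational_Algebra"
    "Jordan_Normal_Form.Schur_Decomposition"
    "Jordan_Normal_Form.DL_Rank"
    "Jordan_Normal_Form.DL_Submatrix"
begin

text \<open>
  All indices are counted from 0, except those of Sylvester matrices (the \<open>k\<close> in \<open>S\<^sub>k\<close>, \<open>T\<^sub>k\<close>) and of
  singular values, which start at 1. The degrees \<open>d\<^sub>1, \<dots>, d\<^sub>m\<close> form a list \<open>ds\<close> of length \<open>m\<close>.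
\<close>

section \<open>Polynomial matrices with prescribed row degree bounds\<close>

definition poly_mat_space :: "nat list \<Rightarrow> nat \<Rightarrow> 'a::zero poly mat set" where
  "poly_mat_space ds n =
     {M \<in> carrier_mat (length ds) (length ds + n).
        \<forall>i < length ds. \<forall>j < length ds + n. degree (M $$ (i, j)) \<le> ds ! i}"

definition leading_row_coeff_mat :: "nat list \<Rightarrow> 'a::zero poly mat \<Rightarrow> 'a mat" where
  "leading_row_coeff_mat ds M =
     mat (dim_row M) (dim_col M) (\<lambda>(i, j). coeff (M $$ (i, j)) (ds ! i))"

abbreviation mat_rank :: "'a::field mat \<Rightarrow> nat" where
  "mat_rank A \<equiv> vec_space.rank (dim_row A) A"

section \<open>Minimal bases\<close>

abbreviation rat_vec :: "'a::field poly vec \<Rightarrow> 'a poly fract vec" where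
  "rat_vec \<equiv> map_vec to_fract"

abbreviation rat_span :: "nat \<Rightarrow> 'a::field poly fract vec set \<Rightarrow> 'a poly fract vec set" where
  "rat_span q \<equiv> LinearCombinations.module.span class_ring (module_vec TYPE('a poly fract) q)"

abbreviation rat_lin_dep :: "nat \<Rightarrow> 'a::field poly fract vec set \<Rightarrow> bool" where
  "rat_lin_dep q \<equiv> LinearCombinations.module.lin_dep class_ring (module_vec TYPE('a poly fract) q)"

definition vec_degree :: "'a::zero poly vec \<Rightarrow> nat" where
  "vec_degree v = Max ((\<lambda>i. degree (v $ i)) ` {..<dim_vec v})"

text \<open>
  Bases are lists of vectors; distinctness of the list is needed because linear independence
  is a property of the set of its elements.
\<close>

definition polynomial_basis ::
    "nat \<Rightarrow> 'a::field poly fract vec set \<Rightarrow> 'a poly vec list \<Rightarrow> bool" where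
  "polynomial_basis q V bs \<longleftrightarrow>
     set bs \<subseteq> carrier_vec q \<and> distinct bs \<and>
     \<not> rat_lin_dep q (rat_vec ` set bs) \<and> rat_span q (rat_vec ` set bs) = V"

definition minimal_basis_of ::
    "nat \<Rightarrow> 'a::field poly fract vec set \<Rightarrow> 'a poly vec list \<Rightarrow> bool" where
  "minimal_basis_of q V bs \<longleftrightarrow>
     polynomial_basis q V bs \<and>
     (\<forall>cs. polynomial_basis q V cs \<longrightarrow>
        sum_list (map vec_degree bs) \<le> sum_list (map vec_degree cs))"

definition minimal_basis :: "'a::field poly mat \<Rightarrow> bool" where
  "minimal_basis M \<longleftrightarrow>
     dim_row M < dim_col M \<and>
     minimal_basis_of (dim_col M) (rat_span (dim_col M) (rat_vec ` set (rows M))) (rows M)"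

section \<open>Sylvester matrices\<close>

text \<open>
  Row \<open>r\<close> of \<open>S\<^sub>k\<close> is row \<open>r mod m\<close> of block row \<open>r div m\<close>; similarly for columns, with blocks of
  width \<open>m + n\<close>. The parameter \<open>d\<close> is the (formal) degree of \<open>M\<close>.
\<close>

definition sylvester :: "nat \<Rightarrow> nat \<Rightarrow> 'a::zero poly mat \<Rightarrow> 'a mat" where
  "sylvester d k M =
     mat ((k + d) * dim_row M) (k * dim_col M)
       (\<lambda>(r, c).
          let p = r div dim_row M; i = r mod dim_row M;
              q = c div dim_col M; j = c mod dim_col M
          in if q \<le> p \<and> p - q \<le> d then coeff (M $$ (i, j)) (p - q) else 0)"

text \<open>
  The rows kept in \<open>T\<^sub>k\<close>: row \<open>i\<close> is deleted from the last \<open>d - d\<^sub>i\<close> of the \<open>k + d\<close> block rows,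
  that is, from the block rows \<open>p \<ge> k + d\<^sub>i\<close>.
\<close>

definition trimmed_sylvester :: "nat list \<Rightarrow> nat \<Rightarrow> 'a::zero poly mat \<Rightarrow> 'a mat" where
  "trimmed_sylvester ds k M =
     submatrix (sylvester (Max (set ds)) k M)
       {r. r div dim_row M < k + ds ! (r mod dim_row M)} UNIV"

section \<open>Spectral norm and singular values\<close>

definition spectral_norm :: "'a::real_normed_field mat \<Rightarrow> real" where
  "spectral_norm A =
     (SUP v \<in> {v \<in> carrier_vec (dim_col A). L2_set (\<lambda>j. norm (v $ j)) {..<dim_col A} \<le> 1}.
        L2_set (\<lambda>i. norm ((A *\<^sub>v v) $ i)) {..<dim_row A})"

text \<open>
  The square roots of the \<open>min p q\<close> eigenvalues, counted with multiplicity, of the smaller of the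
  Gram matrices \<open>A A\<^sup>*\<close> and \<open>A\<^sup>* A\<close>, in decreasing order. These eigenvalues are nonnegative reals, so
  \<open>norm\<close> only transfers them from the field \<open>'a\<close> to type \<^typ>\<open>real\<close>.
\<close>

definition singular_values :: "'a::{real_normed_field, conjugatable_field} mat \<Rightarrow> real list" where
  "singular_values A =
     (let G = if dim_row A \<le> dim_col A then A * mat_adjoint A else mat_adjoint A * A
      in rev (sorted_list_of_multiset (image_mset (\<lambda>x. sqrt (norm x)) (proots (char_poly G)))))"

definition singular_value :: "nat \<Rightarrow> 'a::{real_normed_field, conjugatable_field} mat \<Rightarrow> real" where
  "singular_value i A = singular_values A ! (i - 1)"

end

theory Submission
  imports Defs "HOL-Analysis.Inner_Product"
begin

text \<open>
  Left multiplication of \<open>T\<^sub>k(M)\<close> by \<open>x\<^sup>T\<close> lets the entries of \<open>M\<close> act on \<open>m\<close> finite sequences through the shift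
  operator, while right multiplication computes the coefficients of \<open>M v\<close> for polynomial vectors \<open>v\<close> of degree
  less than \<open>k\<close>. Hence, if \<open>T\<^sub>k(M)\<close> has full row rank for some \<open>k\<close>, then \<open>M\<close> has a polynomial right inverse and
  its leading row-wise coefficient matrix \<open>M\<^sub>d\<close> has full row rank; these two properties imply minimality by the predictable degree property.
  Conversely, the rows of a minimal basis are saturated: \<open>p\<close> divides \<open>w\<close> whenever it divides \<open>w M\<close>. If also
  \<open>M\<^sub>d\<close> has full row rank, then \<open>M N = p I\<close> for some \<open>N\<close> and \<open>p \<noteq> 0\<close>, so that every sequence in the left kernel of
  \<open>T\<^sub>k(M)\<close> with large \<open>k\<close> is annihilated by \<open>p\<close> and has a generating function \<open>w / p\<close>. Then \<open>p\<close> divides \<open>w M\<close>, and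
  saturation forces the sequence to vanish. Part (b) follows because full row rank of \<open>T\<^sub>k(M)\<close> survives any
  perturbation of norm less than its smallest singular value.

  For part (a), a change of variable moves the rank deficiency of \<open>M\<close> at infinity to a finite point close to
  infinity, where it contradicts saturation.
\<close>


text \<open>Finiteness of \<open>T_k\<close> is the main obstacle in part (b). A left kernel vector
  satisfies only \<open>k\<close> shift equations, so \<open>p\<close> annihilates its sequences
  only on an initial stretch, and \<open>k\<close> must be large compared with the degrees of
  \<open>p\<close> and \<open>N\<close>. This makes the first \<open>degree p\<close> terms vanish;
  the remaining ones are removed by the full row rank of the leading row-wise coefficient matrix.
  The pair \<open>p\<close>, \<open>N\<close> comes from that matrix too: if \<open>B\<close> is a
  constant right inverse of it, then \<open>M B\<close> is square with leading row-wise coefficient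
  matrix \<open>I\<close>, hence nonsingular, and its adjugate inverts it up to the factor
  \<open>det (M B)\<close>. The singular values are read off from the roots of a characteristic
  polynomial in the base field, so over the reals one must also show that this polynomial splits.
  The smallest one is controlled by the infimum of a Rayleigh quotient. A determinant argument, in
  place of compactness or the spectral theorem, shows this infimum to be an eigenvalue.\<close>

no_notation fps_nth (infixl "$" 75)

section \<open>Full row rank\<close>

lemma det_eq_0_if_row_eq_0:
  fixes A :: "'a::idom mat"
  assumes A: "A \<in> carrier_mat n n" and k: "k < n" and row: "\<And>j. j < n \<Longrightarrow> A $$ (k, j) = 0"
  shows "det A = 0"
proof -
  have "(\<Prod>i = 0..<n. A $$ (i, p i)) = 0" if "p permutes {0..<n}" for p
    using k row[of "p k"] permutes_in_image[OF that, of k] by (intro prod_zero) auto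
  then show ?thesis unfolding det_def'[OF A] by (intro sum.neutral) auto
qed

text \<open>The columns of a matrix of full row rank span the whole space, so each unit vector has a
  preimage; these preimages are the columns of the right inverse.\<close>

lemma mat_rank_eq_dim_row_imp_right_inverse:
  fixes A :: "'a::field mat"
  assumes A: "A \<in> carrier_mat n nc" and rank: "vec_space.rank n A = n"
  shows "\<exists>B \<in> carrier_mat nc n. A * B = 1\<^sub>m n"
proof -
  interpret vec_space "TYPE('a)" n .
  have cols: "set (cols A) \<subseteq> carrier_vec n" using A cols_dim by blast
  obtain S where S: "maximal S (\<lambda>T. T \<subseteq> set (cols A) \<and> lin_indpt T)" "finite S"
    using maximal_exists_superset[of "set (cols A)" "\<lambda>T. T \<subseteq> set (cols A) \<and> lin_indpt T" "{}"]
    by (auto simp: lin_dep_def)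
  then have Ssub: "S \<subseteq> set (cols A)" and Sli: "lin_indpt S" by (auto simp: maximal_def)
  have "card S = n" using rank_card_indpt[OF A S(1)] rank by simp
  then have "basis S"
    using dim_li_is_basis[OF fin_dim S(2)] Ssub cols Sli dim_is_n by auto
  then have "span S = carrier_vec n" by (simp add: basis_def)
  then have "span (set (cols A)) = carrier_vec n"
    using span_is_monotone[OF Ssub] span_closed[OF cols] cols by auto
  then have ex: "\<exists>x \<in> carrier_vec nc. A *\<^sub>v x = y" if "y \<in> carrier_vec n" for y
    using col_space_eq[OF A] that A unfolding col_space_def by auto
  define b where "b i = (SOME x. x \<in> carrier_vec nc \<and> A *\<^sub>v x = unit_vec n i)" for i
  have b: "b i \<in> carrier_vec nc \<and> A *\<^sub>v b i = unit_vec n i" for i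
    unfolding b_def by (rule someI_ex) (use ex[of "unit_vec n i"] in auto)
  define B where "B = mat_of_cols nc (map b [0..<n])"
  have B: "B \<in> carrier_mat nc n" by (simp add: B_def mat_of_cols_def)
  have "A * B = 1\<^sub>m n"
  proof (rule mat_col_eqI)
    fix i assume i: "i < dim_col (1\<^sub>m n :: 'a mat)"
    have "col (A * B) i = A *\<^sub>v col B i" using A B i by (auto simp: col_mult2)
    also have "col B i = b i" unfolding B_def using i b by (subst col_mat_of_cols) auto
    finally show "col (A * B) i = col (1\<^sub>m n) i" using b i by auto
  qed (use A B in auto)
  with B show ?thesis by blast
qed

text \<open>Rank is defined through columns, while later arguments produce or exclude left kernel
  vectors. The harder direction constructs such a vector from a deficient column space.\<close>

lemma mat_rank_eq_dim_row_iff: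
  fixes A :: "'a::field mat"
  assumes A: "A \<in> carrier_mat n nc"
  shows "vec_space.rank n A = n \<longleftrightarrow>
    (\<forall>x \<in> carrier_vec n. A\<^sup>T *\<^sub>v x = 0\<^sub>v nc \<longrightarrow> x = 0\<^sub>v n)"
proof (intro iffI ballI impI)
  fix x assume "vec_space.rank n A = n" and x: "x \<in> carrier_vec n" "A\<^sup>T *\<^sub>v x = 0\<^sub>v nc"
  then obtain B where B: "B \<in> carrier_mat nc n" "A * B = 1\<^sub>m n"
    using mat_rank_eq_dim_row_imp_right_inverse[OF A] by blast
  have "x = (A * B)\<^sup>T *\<^sub>v x" using x B by simp
  also have "(A * B)\<^sup>T = B\<^sup>T * A\<^sup>T" by (rule transpose_mult[of _ n nc _ n]) (use A B in auto)
  also have "B\<^sup>T * A\<^sup>T *\<^sub>v x = B\<^sup>T *\<^sub>v (A\<^sup>T *\<^sub>v x)"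
    by (rule assoc_mult_mat_vec[of _ n nc _ n]) (use A B x in auto)
  also have "\<dots> = 0\<^sub>v n" using x B by auto
  finally show "x = 0\<^sub>v n" .
next
  assume inj: "\<forall>x \<in> carrier_vec n. A\<^sup>T *\<^sub>v x = 0\<^sub>v nc \<longrightarrow> x = 0\<^sub>v n"
  interpret vec_space "TYPE('a)" n .
  have cols: "set (cols A) \<subseteq> carrier_vec n" using A cols_dim by blast
  obtain S where S: "maximal S (\<lambda>T. T \<subseteq> set (cols A) \<and> lin_indpt T)" "finite S"
    using maximal_exists_superset[of "set (cols A)" "\<lambda>T. T \<subseteq> set (cols A) \<and> lin_indpt T" "{}"]
    by (auto simp: lin_dep_def)
  then have Ssub: "S \<subseteq> set (cols A)" and Sli: "lin_indpt S" by (auto simp: maximal_def)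
  have rank: "rank A = card S" using rank_card_indpt[OF A S(1)] by simp
  have le: "card S \<le> n" using li_le_dim(2)[OF fin_dim _ Sli] Ssub cols dim_is_n by auto
  have cols_span: "set (cols A) \<subseteq> span S"
  proof
    fix c assume c: "c \<in> set (cols A)"
    show "c \<in> span S"
    proof (rule ccontr)
      assume "c \<notin> span S"
      then have "lin_indpt (insert c S)" "c \<notin> S"
        using lin_dep_iff_in_span[of S c] Ssub cols c Sli in_own_span[of S] by auto
      then show False using S(1) c Ssub unfolding maximal_def by blast
    qed
  qed
  show "rank A = n"
  proof (rule ccontr)
    assume "rank A \<noteq> n"
    then have less: "card S < n" using rank le by simp
    obtain vs where vs: "set vs = S" "length vs = card S"
      using finite_distinct_list[OF S(2)] distinct_card by metis
    \<comment> \<open>Fewer than \<open>n\<close> spanning columns, written as rows and filled up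
      with zero rows, form a singular square matrix. Its kernel vector is orthogonal, without
      conjugation, to every column of \<open>A\<close>.\<close>
    define R where "R = mat_of_rows n (vs @ replicate (n - card S) (0\<^sub>v n))"
    have R: "R \<in> carrier_mat n n" using less vs by (simp add: R_def mat_of_rows_def)
    have row_last: "row R (n - 1) = 0\<^sub>v n"
      using less vs Ssub cols unfolding R_def
      by (subst mat_of_rows_row) (auto simp: nth_append)
    have "det R = 0"
    proof (rule det_eq_0_if_row_eq_0[OF R])
      fix j assume "j < n"
      then show "R $$ (n - 1, j) = 0" using arg_cong[OF row_last, of "\<lambda>v. v $ j"] R less by simp
    qed (use less in simp)
    then obtain v where v: "v \<in> carrier_vec n" "v \<noteq> 0\<^sub>v n" "R *\<^sub>v v = 0\<^sub>v n"
      using det_0_iff_vec_prod_zero[OF R] by blast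
    have perp: "s \<bullet> v = 0" if s: "s \<in> S" for s
    proof -
      obtain i where i: "i < card S" "vs ! i = s" using s vs by (metis in_set_conv_nth)
      then have "row R i = s"
        using s less vs subsetD[OF subset_trans[OF Ssub cols] s]
        unfolding R_def by (subst mat_of_rows_row) (auto simp: nth_append)
      moreover have "(R *\<^sub>v v) $ i = 0" using v(3) i less by simp
      ultimately show ?thesis using R i less by simp
    qed
    have "v \<in> orthogonal_complement S"
      unfolding orthogonal_complement_def
    proof (intro CollectI conjI ballI)
      fix s assume s: "s \<in> S"
      have "v \<bullet> s = s \<bullet> v" by (rule comm_scalar_prod[OF v(1)]) (use s Ssub cols in auto)
      with perp[OF s] show "v \<bullet> s = 0" by simp
    qed (rule v(1))
    then have "v \<in> orthogonal_complement (span S)"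
      using in_orthogonal_complement_span[of S] Ssub cols by auto
    then have orth: "v \<bullet> c = 0" if "c \<in> set (cols A)" for c
      using cols_span that by (auto simp: orthogonal_complement_def)
    have "A\<^sup>T *\<^sub>v v = 0\<^sub>v nc"
    proof (rule eq_vecI)
      fix j assume j: "j < dim_vec (0\<^sub>v nc :: 'a vec)"
      have "col A j \<in> set (cols A)" using A j by (auto simp: cols_def)
      then have "v \<bullet> col A j = 0" by (rule orth)
      then show "(A\<^sup>T *\<^sub>v v) $ j = 0\<^sub>v nc $ j"
        using A j v by (simp add: comm_scalar_prod[of v n])
    qed (use A in auto)
    then show False using inj v by blast
  qed
qed

section \<open>Polynomial bases\<close>

lemma common_denominator:
  fixes r :: "nat \<Rightarrow> 'a::idom fract"
  shows "\<exists>p w. p \<noteq> 0 \<and> (\<forall>i<l. to_fract p * r i = to_fract (w i))"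
proof (induction l)
  case 0
  show ?case by (intro exI[of _ 1]) auto
next
  case (Suc l)
  then obtain p w where pw: "p \<noteq> 0" "\<And>i. i < l \<Longrightarrow> to_fract p * r i = to_fract (w i)" by blast
  obtain a b where ab: "r l = Fract a b" "b \<noteq> 0" by (cases "r l") auto
  then have rl: "to_fract b * r l = to_fract a"
    by (simp add: to_fract_def mult_fract eq_fract)
  define w' where "w' i = (if i < l then b * w i else p * a)" for i
  have "to_fract (p * b) * r i = to_fract (w' i)" if "i < Suc l" for i
  proof (cases "i < l")
    case True
    then show ?thesis using pw(2)[of i] by (simp add: w'_def mult_ac to_fract_mult)
  next
    case False
    with that have "i = l" by simp
    then show ?thesis using rl by (simp add: w'_def mult_ac to_fract_mult)
  qed
  then show ?case using pw(1) ab(2) by (intro exI[of _ "p * b"] exI[of _ w']) auto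
qed

lemma to_fract_sum: "to_fract (sum f A) = (\<Sum>x\<in>A. to_fract (f x))"
  by (induction A rule: infinite_finite_induct) (auto simp: to_fract_add)

text \<open>In contrast to \<open>lin_indpt\<close>, which concerns sets, a family with a repeated row is dependent.\<close>

definition lin_indep_family :: "nat \<Rightarrow> nat \<Rightarrow> (nat \<Rightarrow> nat \<Rightarrow> 'a::comm_ring_1) \<Rightarrow> bool" where
  "lin_indep_family l q f \<longleftrightarrow>
     (\<forall>w. (\<forall>j<q. (\<Sum>i<l. w i * f i j) = 0) \<longrightarrow> (\<forall>i<l. w i = 0))"

lemma lin_indep_familyD:
  "lin_indep_family l q f \<Longrightarrow> (\<And>j. j < q \<Longrightarrow> (\<Sum>i<l. w i * f i j) = 0) \<Longrightarrow> i < l \<Longrightarrow> w i = 0"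
  unfolding lin_indep_family_def by blast

text \<open>A common denominator turns a dependency over the fraction field into one over the ring
  itself.\<close>

lemma lin_indep_family_to_fract:
  "lin_indep_family l q (\<lambda>i j. to_fract (f i j)) \<longleftrightarrow> lin_indep_family l q f"
proof
  assume L: "lin_indep_family l q (\<lambda>i j. to_fract (f i j))"
  show "lin_indep_family l q f"
    unfolding lin_indep_family_def
  proof (intro allI impI)
    fix w i assume w: "\<forall>j<q. (\<Sum>i<l. w i * f i j) = 0" and i: "i < l"
    have "(\<Sum>i<l. to_fract (w i) * to_fract (f i j)) = 0" if "j < q" for j
      using arg_cong[OF w[rule_format, OF that], of to_fract] by (simp add: to_fract_sum to_fract_mult)
    from lin_indep_familyD[OF L this i] show "w i = 0" by simp
  qed
next
  assume L: "lin_indep_family l q f"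
  show "lin_indep_family l q (\<lambda>i j. to_fract (f i j))"
    unfolding lin_indep_family_def
  proof (intro allI impI)
    fix r :: "nat \<Rightarrow> 'a fract" and i
    assume r: "\<forall>j<q. (\<Sum>i<l. r i * to_fract (f i j)) = 0" and i: "i < l"
    obtain p w where pw: "p \<noteq> 0" "\<And>i. i < l \<Longrightarrow> to_fract p * r i = to_fract (w i)"
      using common_denominator[of l r] by blast
    have "(\<Sum>i<l. w i * f i j) = 0" if j: "j < q" for j
    proof -
      have "to_fract (\<Sum>i<l. w i * f i j) = (\<Sum>i<l. to_fract p * (r i * to_fract (f i j)))"
        using pw(2) by (simp add: to_fract_sum to_fract_mult mult.assoc[symmetric])
      also have "\<dots> = 0" using r j by (simp add: sum_distrib_left[symmetric])
      finally show ?thesis by (simp only: to_fract_eq_0_iff)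
    qed
    from lin_indep_familyD[OF L this i] pw(2)[OF i] pw(1) show "r i = 0" by auto
  qed
qed

lemma rat_vec_inj: "rat_vec u = rat_vec v \<Longrightarrow> u = v"
  by (metis (no_types, lifting) eq_vecI index_map_vec(1) index_map_vec(2) to_fract_eq_iff)

lemma rat_mat_carrier: "mat_of_cols q (map rat_vec bs) \<in> carrier_mat q (length bs)"
  by (simp add: mat_of_cols_def)

lemma rat_mat_mult_index:
  assumes "v \<in> carrier_vec (length bs)" "j < q"
  shows "(mat_of_cols q (map rat_vec bs) *\<^sub>v v) $ j = (\<Sum>i<length bs. v $ i * (map rat_vec bs ! i) $ j)"
  using assms by (simp add: mat_of_cols_def scalar_prod_def atLeast0LessThan mult.commute)

lemma rat_span_iff:
  assumes bs: "set bs \<subseteq> carrier_vec q" and v: "v \<in> carrier_vec q"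
  shows "v \<in> rat_span q (rat_vec ` set bs) \<longleftrightarrow>
    (\<exists>r. \<forall>j<q. v $ j = (\<Sum>i<length bs. r i * to_fract (bs ! i $ j)))"
proof -
  interpret vec_space "TYPE('a poly fract)" q .
  let ?A = "mat_of_cols q (map rat_vec bs)"
  have cols: "cols ?A = map rat_vec bs" using bs by (subst cols_mat_of_cols) auto
  have bsq: "j < q \<Longrightarrow> i < length bs \<Longrightarrow> (map rat_vec bs ! i) $ j = to_fract (bs ! i $ j)" for i j
    using bs by (metis carrier_vecD index_map_vec(1) nth_map nth_mem subsetD)
  have "v \<in> rat_span q (rat_vec ` set bs) \<longleftrightarrow> (\<exists>x \<in> carrier_vec (length bs). ?A *\<^sub>v x = v)"
    using col_space_eq[OF rat_mat_carrier[of q bs]] v rat_mat_carrier[of q bs]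
    unfolding col_space_def cols by auto
  also have "\<dots> \<longleftrightarrow> (\<exists>r. \<forall>j<q. v $ j = (\<Sum>i<length bs. r i * to_fract (bs ! i $ j)))"
  proof
    assume "\<exists>x \<in> carrier_vec (length bs). ?A *\<^sub>v x = v"
    then obtain x where x: "x \<in> carrier_vec (length bs)" "?A *\<^sub>v x = v" by blast
    show "\<exists>r. \<forall>j<q. v $ j = (\<Sum>i<length bs. r i * to_fract (bs ! i $ j))"
      using rat_mat_mult_index[OF x(1)] x(2) bsq by (intro exI[of _ "\<lambda>i. x $ i"]) auto
  next
    assume "\<exists>r. \<forall>j<q. v $ j = (\<Sum>i<length bs. r i * to_fract (bs ! i $ j))"
    then obtain r where r: "\<And>j. j < q \<Longrightarrow> v $ j = (\<Sum>i<length bs. r i * to_fract (bs ! i $ j))" by blast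
    have "?A *\<^sub>v vec (length bs) r = v"
    proof (rule eq_vecI)
      fix j assume "j < dim_vec v"
      with v have j: "j < q" by simp
      show "(?A *\<^sub>v vec (length bs) r) $ j = v $ j"
        using rat_mat_mult_index[of "vec (length bs) r", OF _ j] r[OF j] bsq[OF j] by simp
    qed (use v in simp)
    then show "\<exists>x \<in> carrier_vec (length bs). ?A *\<^sub>v x = v" by (intro bexI[of _ "vec (length bs) r"]) auto
  qed
  finally show ?thesis .
qed

text \<open>The common denominator \<open>p\<close> of the coordinates moves to the left-hand side,
  which leaves a relation between polynomials. Bases can then be handled without fractions.\<close>

lemma rat_vec_in_rat_span_iff:
  assumes bs: "set bs \<subseteq> carrier_vec q" and z: "z \<in> carrier_vec q"
  shows "rat_vec z \<in> rat_span q (rat_vec ` set bs) \<longleftrightarrow>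
    (\<exists>p w. p \<noteq> 0 \<and> (\<forall>j<q. p * z $ j = (\<Sum>i<length bs. w i * bs ! i $ j)))"
proof -
  have "rat_vec z \<in> rat_span q (rat_vec ` set bs) \<longleftrightarrow>
    (\<exists>r. \<forall>j<q. to_fract (z $ j) = (\<Sum>i<length bs. r i * to_fract (bs ! i $ j)))"
    using z by (subst rat_span_iff[OF bs]) auto
  also have "\<dots> \<longleftrightarrow> (\<exists>p w. p \<noteq> 0 \<and> (\<forall>j<q. p * z $ j = (\<Sum>i<length bs. w i * bs ! i $ j)))"
  proof
    assume "\<exists>r. \<forall>j<q. to_fract (z $ j) = (\<Sum>i<length bs. r i * to_fract (bs ! i $ j))"
    then obtain r where r: "\<And>j. j < q \<Longrightarrow> to_fract (z $ j) = (\<Sum>i<length bs. r i * to_fract (bs ! i $ j))"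
      by blast
    obtain p w where pw: "p \<noteq> 0" "\<And>i. i < length bs \<Longrightarrow> to_fract p * r i = to_fract (w i)"
      using common_denominator[of "length bs" r] by blast
    have "p * z $ j = (\<Sum>i<length bs. w i * bs ! i $ j)" if j: "j < q" for j
    proof -
      have "to_fract (p * z $ j) = (\<Sum>i<length bs. to_fract p * r i * to_fract (bs ! i $ j))"
        using r[OF j] by (simp add: to_fract_mult sum_distrib_left mult.assoc)
      also have "\<dots> = to_fract (\<Sum>i<length bs. w i * bs ! i $ j)"
        using pw(2) by (simp add: to_fract_sum to_fract_mult)
      finally show ?thesis by (simp only: to_fract_eq_iff)
    qed
    with pw(1) show "\<exists>p w. p \<noteq> 0 \<and> (\<forall>j<q. p * z $ j = (\<Sum>i<length bs. w i * bs ! i $ j))" by blast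
  next
    assume "\<exists>p w. p \<noteq> 0 \<and> (\<forall>j<q. p * z $ j = (\<Sum>i<length bs. w i * bs ! i $ j))"
    then obtain p w where pw: "p \<noteq> 0" "\<And>j. j < q \<Longrightarrow> p * z $ j = (\<Sum>i<length bs. w i * bs ! i $ j)" by blast
    have "to_fract (z $ j) = (\<Sum>i<length bs. to_fract (w i) / to_fract p * to_fract (bs ! i $ j))"
      if j: "j < q" for j
    proof -
      have "to_fract p * to_fract (z $ j) = (\<Sum>i<length bs. to_fract (w i) * to_fract (bs ! i $ j))"
        using arg_cong[OF pw(2)[OF j], of to_fract] by (simp add: to_fract_sum to_fract_mult)
      then have "to_fract (z $ j) = (\<Sum>i<length bs. to_fract (w i) * to_fract (bs ! i $ j)) / to_fract p"
        using pw(1) by (simp add: field_simps)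
      then show ?thesis by (simp add: sum_divide_distrib)
    qed
    then show "\<exists>r. \<forall>j<q. to_fract (z $ j) = (\<Sum>i<length bs. r i * to_fract (bs ! i $ j))"
      by (intro exI[of _ "\<lambda>i. to_fract (w i) / to_fract p"]) simp
  qed
  finally show ?thesis .
qed

lemma rat_lin_indep_iff:
  assumes bs: "set bs \<subseteq> carrier_vec q"
  shows "distinct bs \<and> \<not> rat_lin_dep q (rat_vec ` set bs) \<longleftrightarrow>
    lin_indep_family (length bs) q (\<lambda>i j. bs ! i $ j)"
proof -
  interpret vec_space "TYPE('a poly fract)" q .
  let ?A = "mat_of_cols q (map rat_vec bs)"
  have cols: "cols ?A = map rat_vec bs" using bs by (subst cols_mat_of_cols) auto
  have bsq: "j < q \<Longrightarrow> i < length bs \<Longrightarrow> (map rat_vec bs ! i) $ j = to_fract (bs ! i $ j)" for i j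
    using bs by (metis carrier_vecD index_map_vec(1) nth_map nth_mem subsetD)
  have dist: "distinct (cols ?A) \<longleftrightarrow> distinct bs"
    unfolding cols distinct_map by (auto simp: inj_on_def dest: rat_vec_inj)
  have mult: "?A *\<^sub>v v = 0\<^sub>v q \<longleftrightarrow> (\<forall>j<q. (\<Sum>i<length bs. v $ i * to_fract (bs ! i $ j)) = 0)"
    if v: "v \<in> carrier_vec (length bs)" for v
    using rat_mat_mult_index[OF v] bsq by (auto simp: vec_eq_iff)
  show ?thesis
  proof
    assume *: "distinct bs \<and> \<not> rat_lin_dep q (rat_vec ` set bs)"
    have "lin_indep_family (length bs) q (\<lambda>i j. to_fract (bs ! i $ j))"
      unfolding lin_indep_family_def
    proof (intro allI impI)
      fix r :: "nat \<Rightarrow> 'a poly fract" and i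
      assume r: "\<forall>j<q. (\<Sum>i<length bs. r i * to_fract (bs ! i $ j)) = 0" and i: "i < length bs"
      then have "?A *\<^sub>v vec (length bs) r = 0\<^sub>v q" by (subst mult) auto
      then have "vec (length bs) r = 0\<^sub>v (length bs)"
        using lin_depI[OF rat_mat_carrier, of "vec (length bs) r" bs] * dist cols by auto
      then show "r i = 0" using i by (metis index_vec index_zero_vec(1))
    qed
    then show "lin_indep_family (length bs) q (\<lambda>i j. bs ! i $ j)"
      by (simp add: lin_indep_family_to_fract)
  next
    assume L: "lin_indep_family (length bs) q (\<lambda>i j. bs ! i $ j)"
    have d: "distinct bs"
    proof (rule ccontr)
      assume "\<not> distinct bs"
      then obtain a b where ab: "a < length bs" "b < length bs" "a \<noteq> b" "bs ! a = bs ! b"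
        by (auto simp: distinct_conv_nth)
      \<comment> \<open>Two equal entries are cancelled by the coefficients 1 and -1, so
        independence as a family already forces distinctness.\<close>
      define w :: "nat \<Rightarrow> 'a poly" where "w i = (if i = a then 1 else if i = b then -1 else 0)" for i
      have "(\<Sum>i<length bs. w i * bs ! i $ j) = 0" for j
      proof -
        have "(\<Sum>i<length bs. w i * bs ! i $ j) = (\<Sum>i\<in>{a, b}. w i * bs ! i $ j)"
          using ab by (intro sum.mono_neutral_right) (auto simp: w_def)
        then show ?thesis using ab by (simp add: w_def)
      qed
      from lin_indep_familyD[OF L this ab(1)] show False by (simp add: w_def)
    qed
    have "\<not> rat_lin_dep q (rat_vec ` set bs)"
    proof
      assume "rat_lin_dep q (rat_vec ` set bs)"
      then obtain v where v: "v \<in> carrier_vec (length bs)" "v \<noteq> 0\<^sub>v (length bs)" "?A *\<^sub>v v = 0\<^sub>v q"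
        using lin_depE[OF rat_mat_carrier, of bs] d dist cols by auto
      have L': "lin_indep_family (length bs) q (\<lambda>i j. to_fract (bs ! i $ j))"
        using L by (simp add: lin_indep_family_to_fract)
      have "v $ i = 0" if "i < length bs" for i
        using lin_indep_familyD[OF L' _ that, of "\<lambda>i. v $ i"] v(3) unfolding mult[OF v(1)] by blast
      then show False using v(1,2) by auto
    qed
    with d show "distinct bs \<and> \<not> rat_lin_dep q (rat_vec ` set bs)" by simp
  qed
qed

lemma polynomial_basis_iff:
  "polynomial_basis q V bs \<longleftrightarrow> set bs \<subseteq> carrier_vec q \<and>
     lin_indep_family (length bs) q (\<lambda>i j. bs ! i $ j) \<and> rat_span q (rat_vec ` set bs) = V"
  unfolding polynomial_basis_def using rat_lin_indep_iff by blast

lemma rat_span_subset: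
  assumes "set bs \<subseteq> carrier_vec q"
    and "\<And>b. b \<in> set bs \<Longrightarrow> rat_vec b \<in> rat_span q (rat_vec ` set cs)"
    and "set cs \<subseteq> carrier_vec q"
  shows "rat_span q (rat_vec ` set bs) \<subseteq> rat_span q (rat_vec ` set cs)"
proof -
  interpret vec_space "TYPE('a poly fract)" q .
  show ?thesis by (rule span_subsetI) (use assms in auto)
qed

lemma rat_vec_in_rat_span:
  assumes "set bs \<subseteq> carrier_vec q" "b \<in> set bs"
  shows "rat_vec b \<in> rat_span q (rat_vec ` set bs)"
proof -
  interpret vec_space "TYPE('a poly fract)" q .
  show ?thesis by (rule subsetD[OF in_own_span]) (use assms in auto)
qed

text \<open>Steinitz exchange with denominators cleared: as \<open>w i0\<close> is nonzero, the
  relation can be solved for \<open>bs ! i0\<close> up to a polynomial factor, so \<open>z\<close>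
  may take its place.\<close>

lemma polynomial_basis_exchange:
  assumes bs: "polynomial_basis q V bs" and i0: "i0 < length bs" and w0: "w i0 \<noteq> 0"
    and z: "z \<in> carrier_vec q" and p: "p \<noteq> 0"
    and zw: "\<And>j. j < q \<Longrightarrow> p * z $ j = (\<Sum>i<length bs. w i * bs ! i $ j)"
  shows "polynomial_basis q V (bs[i0 := z])"
proof -
  have sub: "set bs \<subseteq> carrier_vec q"
    and ind: "lin_indep_family (length bs) q (\<lambda>i j. bs ! i $ j)"
    and span: "rat_span q (rat_vec ` set bs) = V"
    using bs by (auto simp: polynomial_basis_iff)
  let ?cs = "bs[i0 := z]"
  have sub': "set ?cs \<subseteq> carrier_vec q" using sub z set_update_subset_insert[of bs i0 z] by auto
  have split: "(\<Sum>i<length bs. g i) = g i0 + (\<Sum>i\<in>{..<length bs} - {i0}. g i)" for g :: "nat \<Rightarrow> 'a poly"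
    using i0 by (subst sum.remove[of _ i0]) auto
  have "lin_indep_family (length bs) q (\<lambda>i j. ?cs ! i $ j)"
    unfolding lin_indep_family_def
  proof (intro allI impI)
    fix u i assume u: "\<forall>j<q. (\<Sum>i<length bs. u i * ?cs ! i $ j) = 0" and i: "i < length bs"
    \<comment> \<open>A relation for the new list, multiplied by \<open>p\<close> and with
      \<open>p z\<close> expanded, has the coefficients \<open>u'\<close> with respect to the old
      list.\<close>
    define u' where "u' i = (if i = i0 then u i0 * w i0 else u i0 * w i + p * u i)" for i
    have "(\<Sum>i<length bs. u' i * bs ! i $ j) = 0" if j: "j < q" for j
    proof -
      have "(\<Sum>i<length bs. u' i * bs ! i $ j) =
          u i0 * (\<Sum>i<length bs. w i * bs ! i $ j) + p * (\<Sum>i\<in>{..<length bs} - {i0}. u i * bs ! i $ j)"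
        unfolding split by (simp add: u'_def algebra_simps sum.distrib sum_distrib_left)
      also have "\<dots> = p * (u i0 * z $ j + (\<Sum>i\<in>{..<length bs} - {i0}. u i * bs ! i $ j))"
        using zw[OF j] by (simp add: algebra_simps)
      also have "u i0 * z $ j + (\<Sum>i\<in>{..<length bs} - {i0}. u i * bs ! i $ j) = (\<Sum>i<length bs. u i * ?cs ! i $ j)"
        unfolding split using i0 by simp
      finally show ?thesis using u j by simp
    qed
    then have u'0: "u' k = 0" if "k < length bs" for k
      using lin_indep_familyD[OF ind _ that, of u'] by blast
    have "u i0 = 0" using u'0[OF i0] w0 by (simp add: u'_def)
    then show "u i = 0" using u'0[OF i] p by (cases "i = i0") (auto simp: u'_def)
  qed
  moreover have "rat_span q (rat_vec ` set ?cs) = rat_span q (rat_vec ` set bs)"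
  proof
    show "rat_span q (rat_vec ` set ?cs) \<subseteq> rat_span q (rat_vec ` set bs)"
    proof (rule rat_span_subset[OF sub' _ sub])
      fix b assume "b \<in> set ?cs"
      then consider "b = z" | "b \<in> set bs" using set_update_subset_insert[of bs i0 z] by auto
      then show "rat_vec b \<in> rat_span q (rat_vec ` set bs)"
      proof cases
        case 1
        show ?thesis
          unfolding 1 rat_vec_in_rat_span_iff[OF sub z] using p zw by blast
      qed (rule rat_vec_in_rat_span[OF sub])
    qed
    show "rat_span q (rat_vec ` set bs) \<subseteq> rat_span q (rat_vec ` set ?cs)"
    proof (rule rat_span_subset[OF sub _ sub'])
      fix b assume "b \<in> set bs"
      then obtain i where i: "i < length bs" "b = bs ! i" by (auto simp: in_set_conv_nth)
      show "rat_vec b \<in> rat_span q (rat_vec ` set ?cs)"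
      proof (cases "i = i0")
        case False
        then have "b \<in> set ?cs" using i by (metis length_list_update nth_list_update_neq nth_mem)
        then show ?thesis by (rule rat_vec_in_rat_span[OF sub'])
      next
        case True
        \<comment> \<open>The expansion of \<open>p z\<close>, solved for \<open>w i0\<close> times
          the replaced vector.\<close>
        define u where "u i = (if i = i0 then p else - w i)" for i
        have "w i0 * b $ j = (\<Sum>i<length ?cs. u i * ?cs ! i $ j)" if j: "j < q" for j
        proof -
          have "(\<Sum>i<length ?cs. u i * ?cs ! i $ j) = p * z $ j - (\<Sum>i\<in>{..<length bs} - {i0}. w i * bs ! i $ j)"
            unfolding length_list_update split using i0 by (simp add: u_def sum_negf)
          also have "p * z $ j = w i0 * bs ! i0 $ j + (\<Sum>i\<in>{..<length bs} - {i0}. w i * bs ! i $ j)"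
            unfolding zw[OF j] split ..
          finally show ?thesis using i True by simp
        qed
        moreover have b: "b \<in> carrier_vec q" using i sub nth_mem by blast
        ultimately show ?thesis
          unfolding rat_vec_in_rat_span_iff[OF sub' b] using w0 by blast
      qed
    qed
  qed
  ultimately show ?thesis using sub' span by (simp add: polynomial_basis_iff)
qed

section \<open>Minimal bases\<close>

text \<open>If \<open>q < l\<close>, the matrix with the \<open>l\<close> vectors as columns, padded
  by zero rows to a square, is singular and yields a dependency.\<close>

lemma lin_indep_family_le:
  fixes f :: "nat \<Rightarrow> nat \<Rightarrow> 'a::idom"
  assumes L: "lin_indep_family l q f"
  shows "l \<le> q"
proof (rule ccontr)
  assume "\<not> l \<le> q"
  then have less: "q < l" by simp
  define A where "A = mat l l (\<lambda>(j, i). if j < q then f i j else 0)"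
  have A: "A \<in> carrier_mat l l" by (simp add: A_def)
  have "det A = 0" by (rule det_eq_0_if_row_eq_0[OF A less]) (use less in \<open>simp add: A_def\<close>)
  then obtain v where v: "v \<in> carrier_vec l" "v \<noteq> 0\<^sub>v l" "A *\<^sub>v v = 0\<^sub>v l"
    using det_0_iff_vec_prod_zero[OF A] by blast
  have "v $ i = 0" if i: "i < l" for i
  proof (rule lin_indep_familyD[OF L _ i])
    fix j assume j: "j < q"
    have "(A *\<^sub>v v) $ j = (\<Sum>i<l. v $ i * f i j)"
      using j less v(1) by (simp add: A_def scalar_prod_def atLeast0LessThan mult.commute)
    then show "(\<Sum>i<l. v $ i * f i j) = 0" using v(3) j less by simp
  qed
  then show False using v(1,2) by auto
qed

lemma lin_indep_family_det_neq_0: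
  fixes f :: "nat \<Rightarrow> nat \<Rightarrow> 'a::idom"
  assumes L: "lin_indep_family m m f"
  shows "det (mat m m (\<lambda>(j, i). f i j)) \<noteq> 0"
proof
  define A where "A = mat m m (\<lambda>(j, i). f i j)"
  have A: "A \<in> carrier_mat m m" by (simp add: A_def)
  assume "det (mat m m (\<lambda>(j, i). f i j)) = 0"
  then obtain v where v: "v \<in> carrier_vec m" "v \<noteq> 0\<^sub>v m" "A *\<^sub>v v = 0\<^sub>v m"
    using det_0_iff_vec_prod_zero[OF A] by (auto simp: A_def)
  have "v $ i = 0" if i: "i < m" for i
  proof (rule lin_indep_familyD[OF L _ i])
    fix j assume j: "j < m"
    have "(A *\<^sub>v v) $ j = (\<Sum>i<m. v $ i * f i j)"
      using j v(1) by (simp add: A_def scalar_prod_def atLeast0LessThan mult.commute)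
    then show "(\<Sum>i<m. v $ i * f i j) = 0" using v(3) j by simp
  qed
  then show False using v(1,2) by auto
qed

text \<open>A nonzero determinant has a nonzero term in its Leibniz expansion. Its permutation later
  matches the vectors of a competing basis with the rows of \<open>M\<close>.\<close>

lemma lin_indep_family_permutation:
  fixes f :: "nat \<Rightarrow> nat \<Rightarrow> 'a::idom"
  assumes L: "lin_indep_family m m f"
  obtains \<pi> where "\<pi> permutes {0..<m}" "\<And>i. i < m \<Longrightarrow> f (\<pi> i) i \<noteq> 0"
proof -
  define A where "A = mat m m (\<lambda>(j, i). f i j)"
  have A: "A \<in> carrier_mat m m" by (simp add: A_def)
  have "det A \<noteq> 0" using lin_indep_family_det_neq_0[OF L] by (simp add: A_def)
  then obtain \<pi> where \<pi>: "\<pi> permutes {0..<m}" "(\<Prod>i = 0..<m. A $$ (i, \<pi> i)) \<noteq> 0"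
    unfolding det_def'[OF A] by (metis (no_types, lifting) mem_Collect_eq mult_zero_right sum.neutral)
  have "f (\<pi> i) i \<noteq> 0" if i: "i < m" for i
  proof -
    have "A $$ (i, \<pi> i) \<noteq> 0" using \<pi>(2) i by (auto simp: prod_zero_iff)
    then show ?thesis using i permutes_in_image[OF \<pi>(1), of i] by (simp add: A_def)
  qed
  with \<pi>(1) show thesis by (rule that)
qed

section \<open>Predictable degree property\<close>

lemma coeff_mult_degree_le:
  fixes p g :: "'a::comm_semiring_0 poly"
  assumes "degree p \<le> a" "degree g \<le> b"
  shows "coeff (p * g) (a + b) = coeff p a * coeff g b"
proof -
  have "coeff p i * coeff g (a + b - i) = 0" if "i \<noteq> a" for i
    using that assms by (cases "i < a") (auto simp: coeff_eq_0)
  then have "(\<Sum>i\<le>a + b. coeff p i * coeff g (a + b - i)) = (\<Sum>i\<in>{a}. coeff p i * coeff g (a + b - i))"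
    by (intro sum.mono_neutral_right) auto
  then show ?thesis by (simp add: coeff_mult)
qed

text \<open>The coefficient at the largest degree \<open>D\<close> that can occur in the combination
  is itself a nontrivial combination of the leading coefficient rows. Independence prevents these
  from cancelling, so degree \<open>D\<close> is attained.\<close>

lemma predictable_degree:
  fixes f :: "nat \<Rightarrow> nat \<Rightarrow> 'a::idom poly"
  assumes deg: "\<And>i j. i < m \<Longrightarrow> j < q \<Longrightarrow> degree (f i j) \<le> d i"
    and lead: "lin_indep_family m q (\<lambda>i j. coeff (f i j) (d i))"
    and i0: "i0 < m" "P i0 \<noteq> 0"
  shows "\<exists>j<q. (\<Sum>i<m. P i * f i j) \<noteq> 0 \<and> d i0 \<le> degree (\<Sum>i<m. P i * f i j)"
proof -
  define S where "S = {i. i < m \<and> P i \<noteq> 0}"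
  define D where "D = Max ((\<lambda>i. degree (P i) + d i) ` S)"
  have fin: "finite S" and ne: "i0 \<in> S" using i0 by (auto simp: S_def)
  have DS: "degree (P i) + d i \<le> D" if "i \<in> S" for i
    unfolding D_def using fin that by (intro Max_ge) auto
  have "D \<in> (\<lambda>i. degree (P i) + d i) ` S" unfolding D_def using fin ne by (intro Max_in) auto
  then obtain i1 where i1: "i1 \<in> S" "D = degree (P i1) + d i1" by blast
  \<comment> \<open>For \<open>i\<close> in \<open>S\<close> the difference \<open>D - d i\<close>
    is not truncated, and the coefficient is zero for those rows whose degree sum stays below
    \<open>D\<close>.\<close>
  define w where "w i = (if i \<in> S then coeff (P i) (D - d i) else 0)" for i
  have c: "coeff (\<Sum>i<m. P i * f i j) D = (\<Sum>i<m. w i * coeff (f i j) (d i))" if j: "j < q" for j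
  proof -
    have "coeff (P i * f i j) D = w i * coeff (f i j) (d i)" if i: "i < m" for i
    proof (cases "i \<in> S")
      case True
      then have "coeff (P i * f i j) ((D - d i) + d i) = coeff (P i) (D - d i) * coeff (f i j) (d i)"
        using DS[OF True] deg[OF i j] by (intro coeff_mult_degree_le) auto
      then show ?thesis using True DS[OF True] by (simp add: w_def)
    next
      case False
      then show ?thesis using i by (simp add: S_def w_def)
    qed
    then show ?thesis by (simp add: coeff_sum)
  qed
  have "w i1 \<noteq> 0" using i1 by (simp add: w_def S_def)
  then obtain j where j: "j < q" "(\<Sum>i<m. w i * coeff (f i j) (d i)) \<noteq> 0"
    using lin_indep_familyD[OF lead, of w i1] i1 by (auto simp: S_def)
  then have nz: "coeff (\<Sum>i<m. P i * f i j) D \<noteq> 0" using c by simp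
  then have "D \<le> degree (\<Sum>i<m. P i * f i j)" by (rule le_degree)
  then have "d i0 \<le> degree (\<Sum>i<m. P i * f i j)" using DS[OF ne] by simp
  with j(1) nz show ?thesis by (intro exI[of _ j]) auto
qed

lemma lin_indep_family_leading_coeffs:
  fixes f :: "nat \<Rightarrow> nat \<Rightarrow> 'a::idom poly"
  assumes deg: "\<And>i j. i < m \<Longrightarrow> j < q \<Longrightarrow> degree (f i j) \<le> d i"
    and lead: "lin_indep_family m q (\<lambda>i j. coeff (f i j) (d i))"
  shows "lin_indep_family m q f"
  unfolding lin_indep_family_def
proof (intro allI impI)
  fix w i assume w: "\<forall>j<q. (\<Sum>i<m. w i * f i j) = 0" and i: "i < m"
  show "w i = 0"
  proof (rule ccontr)
    assume "w i \<noteq> 0"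
    then obtain j where "j < q" "(\<Sum>i<m. w i * f i j) \<noteq> 0"
      using predictable_degree[OF deg lead i, of w] by blast
    with w show False by blast
  qed
qed

section \<open>Saturation of minimal bases\<close>

lemma degree_le_vec_degree: "j < dim_vec v \<Longrightarrow> degree (v $ j) \<le> vec_degree v"
  unfolding vec_degree_def by (intro Max_ge) auto

lemma vec_degree_le:
  "0 < dim_vec v \<Longrightarrow> (\<And>j. j < dim_vec v \<Longrightarrow> degree (v $ j) \<le> D) \<Longrightarrow> vec_degree v \<le> D"
  unfolding vec_degree_def by (subst Max_le_iff) auto

text \<open>
  If \<open>p\<close> did not divide \<open>w\<close>, one could reduce \<open>w\<close> modulo \<open>p\<close> and divide the resulting combination by \<open>p\<close>, which
  gives a vector that can replace a basis vector of larger degree.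
\<close>

lemma minimal_basis_of_saturated:
  fixes bs :: "'a::field poly vec list"
  assumes mb: "minimal_basis_of q V bs" and q: "0 < q" and p: "p \<noteq> 0"
    and dvd: "\<And>j. j < q \<Longrightarrow> p dvd (\<Sum>i<length bs. w i * bs ! i $ j)"
    and i: "i < length bs"
  shows "p dvd w i"
proof (rule ccontr)
  assume ndvd: "\<not> p dvd w i"
  let ?m = "length bs"
  have basis: "polynomial_basis q V bs"
    and minimal: "\<And>cs. polynomial_basis q V cs \<Longrightarrow>
        sum_list (map vec_degree bs) \<le> sum_list (map vec_degree cs)"
    using mb by (auto simp: minimal_basis_of_def)
  have sub: "set bs \<subseteq> carrier_vec q" and ind: "lin_indep_family ?m q (\<lambda>i j. bs ! i $ j)"
    using basis by (auto simp: polynomial_basis_iff)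
  have bsq: "bs ! i \<in> carrier_vec q" if "i < ?m" for i using sub that nth_mem by blast
  define u where "u i = w i mod p" for i
  have "p dvd (\<Sum>i<?m. u i * bs ! i $ j)" if j: "j < q" for j
  proof -
    have "(\<Sum>i<?m. u i * bs ! i $ j) = (\<Sum>i<?m. w i * bs ! i $ j) - (\<Sum>i<?m. p * (w i div p * bs ! i $ j))"
      unfolding sum_subtractf[symmetric]
      by (intro sum.cong refl) (simp add: u_def minus_mult_div_eq_mod[symmetric] algebra_simps)
    then show ?thesis using dvd[OF j] by (simp add: sum_distrib_left[symmetric])
  qed
  then have "\<forall>j. \<exists>g. j < q \<longrightarrow> (\<Sum>i<?m. u i * bs ! i $ j) = p * g" by (auto elim!: dvdE)
  then obtain g where g: "\<And>j. j < q \<Longrightarrow> p * g j = (\<Sum>i<?m. u i * bs ! i $ j)" by metis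
  define z where "z = vec q g"
  have z: "z \<in> carrier_vec q" by (simp add: z_def)
  define S where "S = {i. i < ?m \<and> u i \<noteq> 0}"
  have iS: "i \<in> S" using i ndvd by (simp add: S_def u_def mod_eq_0_iff_dvd)
  have fin: "finite S" by (simp add: S_def)
  \<comment> \<open>The vector to be replaced has the largest degree \<open>R\<close> among those
    with nonzero remainder. The remainders have smaller degree than \<open>p\<close>, so division by
    \<open>p\<close> leaves entries of degree below \<open>R\<close>.\<close>
  define R where "R = Max ((\<lambda>i. vec_degree (bs ! i)) ` S)"
  have "R \<in> (\<lambda>i. vec_degree (bs ! i)) ` S" unfolding R_def using fin iS by (intro Max_in) auto
  then obtain i0 where i0: "i0 \<in> S" "R = vec_degree (bs ! i0)" by blast
  have RS: "vec_degree (bs ! i) \<le> R" if "i \<in> S" for i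
    unfolding R_def using fin that by (intro Max_ge) auto
  have degz: "degree (g j) < R" if j: "j < q" and gj: "g j \<noteq> 0" for j
  proof -
    have "degree (u i * bs ! i $ j) < degree p + R" if "i < ?m" "u i \<noteq> 0" for i
    proof -
      have "degree (u i * bs ! i $ j) \<le> degree (u i) + degree (bs ! i $ j)" by (rule degree_mult_le)
      moreover have "degree (u i) < degree p"
        using that degree_mod_less[OF p, of "w i"] unfolding u_def by auto
      moreover have "degree (bs ! i $ j) \<le> vec_degree (bs ! i)"
        using bsq[OF that(1)] j by (intro degree_le_vec_degree) auto
      moreover have "vec_degree (bs ! i) \<le> R" using RS that by (simp add: S_def)
      ultimately show ?thesis by linarith
    qed
    then have le: "degree (u i * bs ! i $ j) \<le> degree p + R - 1" if "i < ?m" for i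
      using that by (cases "u i = 0") fastforce+
    have "degree (u i) < degree p" using iS degree_mod_less[OF p, of "w i"] unfolding u_def S_def by auto
    moreover have "degree (p * g j) \<le> degree p + R - 1"
      unfolding g[OF j] by (rule degree_sum_le) (use le in auto)
    moreover have "degree (p * g j) = degree p + degree (g j)" using p gj by (rule degree_mult_eq)
    ultimately show ?thesis by linarith
  qed
  \<comment> \<open>Independence yields a nonzero entry, whose degree below \<open>R\<close> forces
    \<open>R > 0\<close>; this makes \<open>R - 1\<close> a usable bound.\<close>
  have "\<exists>j<q. g j \<noteq> 0"
  proof (rule ccontr)
    assume "\<not> (\<exists>j<q. g j \<noteq> 0)"
    then have "(\<Sum>i<?m. u i * bs ! i $ j) = 0" if "j < q" for j using g[OF that] that by auto
    from lin_indep_familyD[OF ind this i] show False using iS by (simp add: S_def)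
  qed
  then have R: "0 < R" using degz by force
  have vz: "vec_degree z < R"
  proof -
    have "vec_degree z \<le> R - 1"
      using degz R q by (intro vec_degree_le) (fastforce simp: z_def)+
    then show ?thesis using R by simp
  qed
  have i0m: "i0 < ?m" "u i0 \<noteq> 0" using i0 by (auto simp: S_def)
  have "polynomial_basis q V (bs[i0 := z])"
    using polynomial_basis_exchange[where w = u, OF basis i0m z p] g by (simp add: z_def)
  then have "sum_list (map vec_degree bs) \<le> sum_list (map vec_degree (bs[i0 := z]))" by (rule minimal)
  also have "\<dots> = sum_list (map vec_degree bs) + vec_degree z - R"
    using i0m i0(2) by (simp add: map_update sum_list_update)
  moreover have "R \<le> sum_list (map vec_degree bs)"
    using i0m i0(2) by (simp add: member_le_sum_list)
  ultimately show False using vz R by linarith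
qed

lemma rows_nth_index: "i < dim_row M \<Longrightarrow> j < dim_col M \<Longrightarrow> rows M ! i $ j = M $$ (i, j)"
  by simp

lemma minimal_basis_saturated:
  fixes M :: "'a::field poly mat"
  assumes mb: "minimal_basis M" and p: "p \<noteq> 0"
    and dvd: "\<And>j. j < dim_col M \<Longrightarrow> p dvd (\<Sum>i<dim_row M. w i * M $$ (i, j))"
    and i: "i < dim_row M"
  shows "p dvd w i"
  by (rule minimal_basis_of_saturated[of "dim_col M" _ "rows M"])
    (use mb p dvd i in \<open>auto simp: minimal_basis_def\<close>)

text \<open>
  A right inverse forces every polynomial vector of the row space to be a polynomial combination of the
  rows, so that any other polynomial basis is \<open>P M\<close> with a nonsingular polynomial matrix \<open>P\<close>.
  A nonzero term of \<open>det P\<close> and the predictable degree property then compare the degree sums.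
\<close>

lemma minimal_basisI:
  fixes M :: "'a::field poly mat"
  assumes M: "M \<in> poly_mat_space ds n" and n: "0 < n"
    and lead: "lin_indep_family (length ds) (length ds + n) (\<lambda>i j. coeff (M $$ (i, j)) (ds ! i))"
    and inv: "\<And>i k. i < length ds \<Longrightarrow> k < length ds \<Longrightarrow>
      (\<Sum>j<length ds + n. M $$ (i, j) * N j k) = (if i = k then 1 else 0)"
  shows "minimal_basis M"
proof -
  define m where "m = length ds"
  define q where "q = m + n"
  have dim: "dim_row M = m" "dim_col M = q"
    and deg: "\<And>i j. i < m \<Longrightarrow> j < q \<Longrightarrow> degree (M $$ (i, j)) \<le> ds ! i"
    using M by (auto simp: poly_mat_space_def m_def q_def)
  note lead = lead[folded m_def, folded q_def]
  note inv = inv[folded m_def, folded q_def]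
  have ind: "lin_indep_family m q (\<lambda>i j. M $$ (i, j))"
    by (rule lin_indep_family_leading_coeffs[OF deg lead])
  define V where "V = rat_span q (rat_vec ` set (rows M))"
  have subM: "set (rows M) \<subseteq> carrier_vec q" using rows_carrier[of M] dim by simp
  have ind': "lin_indep_family (length (rows M)) q (\<lambda>i j. rows M ! i $ j)"
    using ind dim unfolding lin_indep_family_def by (auto simp: rows_nth_index)
  have basis: "polynomial_basis q V (rows M)"
    unfolding polynomial_basis_iff using subM ind' by (simp add: V_def)
  have "sum_list (map vec_degree (rows M)) \<le> sum_list (map vec_degree cs)"
    if cs: "polynomial_basis q V cs" for cs
  proof -
    define l where "l = length cs"
    have sub: "set cs \<subseteq> carrier_vec q" and indc: "lin_indep_family l q (\<lambda>i j. cs ! i $ j)"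
      and span: "rat_span q (rat_vec ` set cs) = V"
      using cs by (auto simp: polynomial_basis_iff l_def)
    have csq: "cs ! c \<in> carrier_vec q" if "c < l" for c using sub that nth_mem unfolding l_def by blast
    \<comment> \<open>From \<open>p c = w M\<close> and \<open>M N = I\<close> follows
      \<open>w = p (c N)\<close>. Cancelling \<open>p\<close> leaves polynomial coordinates
      \<open>c N\<close> for every \<open>c\<close> in the list \<open>cs\<close>.\<close>
    define P where "P c k = (\<Sum>j<q. cs ! c $ j * N j k)" for c k
    have P: "cs ! c $ j = (\<Sum>i<m. P c i * M $$ (i, j))" if c: "c < l" and j: "j < q" for c j
    proof -
      have "rat_vec (cs ! c) \<in> rat_span q (rat_vec ` set (rows M))"
        using rat_vec_in_rat_span[OF sub, of "cs ! c"] c span by (simp add: V_def l_def)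
      then obtain p w where pw: "p \<noteq> 0"
        "\<And>j. j < q \<Longrightarrow> p * cs ! c $ j = (\<Sum>i<m. w i * M $$ (i, j))"
        unfolding rat_vec_in_rat_span_iff[OF subM csq[OF c]] using dim by (auto simp: rows_nth_index)
      have w: "w k = p * P c k" if k: "k < m" for k
      proof -
        have "p * P c k = (\<Sum>j<q. \<Sum>i<m. w i * M $$ (i, j) * N j k)"
          unfolding P_def sum_distrib_left
          by (intro sum.cong refl) (simp add: mult.assoc[symmetric] pw(2) sum_distrib_right)
        also have "\<dots> = (\<Sum>i<m. w i * (\<Sum>j<q. M $$ (i, j) * N j k))"
          by (subst sum.swap) (simp add: sum_distrib_left mult.assoc)
        also have "\<dots> = (\<Sum>i<m. if i = k then w i else 0)"
          using k by (intro sum.cong refl) (simp add: inv)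
        finally show ?thesis using k by simp
      qed
      have "p * cs ! c $ j = p * (\<Sum>i<m. P c i * M $$ (i, j))"
        unfolding pw(2)[OF j] by (simp add: w sum_distrib_left mult.assoc)
      then show ?thesis using pw(1) by simp
    qed
    have "lin_indep_family l m P"
      unfolding lin_indep_family_def
    proof (intro allI impI)
      fix u c assume u: "\<forall>j<m. (\<Sum>i<l. u i * P i j) = 0" and c: "c < l"
      show "u c = 0"
      proof (rule lin_indep_familyD[OF indc _ c])
        fix j assume j: "j < q"
        have "(\<Sum>c<l. u c * cs ! c $ j) = (\<Sum>c<l. \<Sum>i<m. u c * P c i * M $$ (i, j))"
          using P j by (simp add: sum_distrib_left mult.assoc)
        also have "\<dots> = (\<Sum>i<m. (\<Sum>c<l. u c * P c i) * M $$ (i, j))"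
          by (subst sum.swap) (simp add: sum_distrib_right)
        finally show "(\<Sum>c<l. u c * cs ! c $ j) = 0" using u by simp
      qed
    qed
    then have lm: "l \<le> m" by (rule lin_indep_family_le)
    \<comment> \<open>Conversely, row \<open>i\<close> of \<open>M\<close> is a rational combination
      of \<open>cs\<close>. Multiplication by \<open>N\<close> gives \<open>r P = p e_i\<close> with
      \<open>p\<close> nonzero, so \<open>P v = 0\<close> implies \<open>v i = 0\<close>. This
      yields \<open>m \<le> l\<close>.\<close>
    have indP: "lin_indep_family m l (\<lambda>i c. P c i)"
      unfolding lin_indep_family_def
    proof (intro allI impI)
      fix v i assume v: "\<forall>c<l. (\<Sum>i<m. v i * P c i) = 0" and i: "i < m"
      have "rat_vec (row M i) \<in> rat_span q (rat_vec ` set cs)"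
        using rat_vec_in_rat_span[OF subM, of "row M i"] i span dim by (auto simp: V_def rows_def)
      then obtain p r where pr: "p \<noteq> 0" "\<And>j. j < q \<Longrightarrow> p * M $$ (i, j) = (\<Sum>c<l. r c * cs ! c $ j)"
        using i dim by (subst (asm) rat_vec_in_rat_span_iff[OF sub]) (auto simp: l_def)
      have e: "(\<Sum>c<l. r c * P c k) = (if i = k then p else 0)" if k: "k < m" for k
      proof -
        have "(\<Sum>c<l. r c * P c k) = (\<Sum>c<l. \<Sum>j<q. r c * cs ! c $ j * N j k)"
          by (simp add: P_def sum_distrib_left mult.assoc)
        also have "\<dots> = (\<Sum>j<q. (\<Sum>c<l. r c * cs ! c $ j) * N j k)"
          by (subst sum.swap) (simp add: sum_distrib_right)
        also have "\<dots> = (\<Sum>j<q. p * (M $$ (i, j) * N j k))"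
          by (intro sum.cong refl) (simp add: pr(2)[symmetric] mult.assoc)
        also have "\<dots> = p * (if i = k then 1 else 0)" by (simp add: sum_distrib_left[symmetric] inv[OF i k])
        finally show ?thesis by simp
      qed
      have "p * v i = (\<Sum>k<m. if i = k then p * v k else 0)" using i by simp
      also have "\<dots> = (\<Sum>k<m. (\<Sum>c<l. r c * P c k) * v k)" using e by (intro sum.cong refl) simp
      also have "\<dots> = (\<Sum>k<m. \<Sum>c<l. r c * (v k * P c k))"
        by (simp add: sum_distrib_left mult_ac)
      also have "\<dots> = (\<Sum>c<l. r c * (\<Sum>k<m. v k * P c k))"
        by (subst sum.swap) (simp add: sum_distrib_left)
      also have "\<dots> = 0" using v by simp
      finally show "v i = 0" using pr(1) by simp
    qed
    then have "m \<le> l" by (rule lin_indep_family_le)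
    with lm have l: "l = m" by simp
    obtain \<pi> where \<pi>: "\<pi> permutes {0..<m}" "\<And>c. c < m \<Longrightarrow> P c (\<pi> c) \<noteq> 0"
      using lin_indep_family_permutation[OF indP[unfolded l]] by blast
    have q: "0 < q" using n by (simp add: q_def)
    have row_le: "vec_degree (row M i) \<le> ds ! i" if "i < m" for i
      using deg[OF that] dim that q by (intro vec_degree_le) auto
    have cs_ge: "ds ! \<pi> c \<le> vec_degree (cs ! c)" if c: "c < m" for c
    proof -
      have "\<pi> c < m" using permutes_in_image[OF \<pi>(1), of c] c by simp
      from predictable_degree[of m q "\<lambda>i j. M $$ (i, j)" "\<lambda>i. ds ! i" "\<pi> c" "P c", OF deg lead this \<pi>(2)[OF c]]
      obtain j where "j < q" "ds ! \<pi> c \<le> degree (\<Sum>i<m. P c i * M $$ (i, j))" by blast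
      then have "j < q" "ds ! \<pi> c \<le> degree (cs ! c $ j)" using P c l by auto
      moreover have "degree (cs ! c $ j) \<le> vec_degree (cs ! c)"
        using csq[of c] c l \<open>j < q\<close> by (intro degree_le_vec_degree) auto
      ultimately show ?thesis by linarith
    qed
    have "sum_list (map vec_degree (rows M)) = (\<Sum>i<m. vec_degree (row M i))"
      using dim by (simp add: sum_list_sum_nth atLeast0LessThan)
    also have "\<dots> \<le> (\<Sum>i<m. ds ! i)" by (intro sum_mono) (simp add: row_le)
    also have "\<dots> = (\<Sum>c<m. ds ! \<pi> c)"
      using sum.permute[OF \<pi>(1), of "\<lambda>i. ds ! i"] by (simp add: atLeast0LessThan o_def)
    also have "\<dots> \<le> (\<Sum>c<m. vec_degree (cs ! c))" by (intro sum_mono) (simp add: cs_ge)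
    also have "\<dots> = sum_list (map vec_degree cs)"
      using l by (simp add: sum_list_sum_nth atLeast0LessThan l_def)
    finally show ?thesis .
  qed
  with basis have "minimal_basis_of q V (rows M)" by (simp add: minimal_basis_of_def)
  then show ?thesis using dim n by (simp add: minimal_basis_def V_def q_def)
qed

section \<open>Shift action of polynomials on sequences\<close>

text \<open>
  A polynomial acts on a sequence through the shift operator. If \<open>p\<close> annihilates \<open>x\<close>, then
  \<open>shift_residue p x\<close> is \<open>p(\<lambda>) \<Sum>\<^sub>t x\<^sub>t \<lambda>\<^sup>-\<^sup>t\<^sup>-\<^sup>1\<close>; in general it is the polynomial part of that series.
\<close>

definition shift_act :: "'a::comm_ring_1 poly \<Rightarrow> (nat \<Rightarrow> 'a) \<Rightarrow> nat \<Rightarrow> 'a" where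
  "shift_act f x t = (\<Sum>s\<le>degree f. coeff f s * x (t + s))"

definition shift_residue :: "'a::comm_ring_1 poly \<Rightarrow> (nat \<Rightarrow> 'a) \<Rightarrow> 'a poly" where
  "shift_residue p x =
     (\<Sum>a<degree p. monom (\<Sum>t\<le>degree p. coeff p (a + 1 + t) * x t) a)"

lemma shift_act_altdef:
  assumes "degree f \<le> n"
  shows "shift_act f x t = (\<Sum>s\<le>n. coeff f s * x (t + s))"
  unfolding shift_act_def using assms
  by (intro sum.mono_neutral_left) (auto simp: coeff_eq_0)

lemma shift_act_0 [simp]: "shift_act 0 x t = 0"
  by (simp add: shift_act_def)

lemma shift_act_add: "shift_act (f + g) x t = shift_act f x t + shift_act g x t"
proof -
  let ?n = "max (degree f) (degree g)"
  have "shift_act (f + g) x t = (\<Sum>s\<le>?n. coeff (f + g) s * x (t + s))"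
    by (rule shift_act_altdef) (simp add: degree_add_le_max)
  also have "\<dots> = (\<Sum>s\<le>?n. coeff f s * x (t + s)) + (\<Sum>s\<le>?n. coeff g s * x (t + s))"
    by (simp add: algebra_simps sum.distrib)
  finally show ?thesis by (simp add: shift_act_altdef[of _ ?n])
qed

lemma shift_act_sum: "shift_act (\<Sum>i\<in>A. f i) x t = (\<Sum>i\<in>A. shift_act (f i) x t)"
  by (induction A rule: infinite_finite_induct) (simp_all add: shift_act_add)

lemma shift_act_pCons: "shift_act (pCons a f) x t = a * x t + shift_act f x (Suc t)"
proof -
  have "shift_act (pCons a f) x t = (\<Sum>s\<le>Suc (degree f). coeff (pCons a f) s * x (t + s))"
    by (rule shift_act_altdef) (simp add: degree_pCons_le)
  also have "\<dots> = a * x t + (\<Sum>s\<le>degree f. coeff f s * x (t + Suc s))"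
    by (subst sum.atMost_Suc_shift) simp
  finally show ?thesis by (simp add: shift_act_def)
qed

lemma shift_act_smult: "shift_act (Polynomial.smult a f) x t = a * shift_act f x t"
  by (subst shift_act_altdef[of _ "degree f"])
    (simp_all add: degree_smult_le shift_act_def sum_distrib_left mult.assoc)

lemma shift_act_Suc: "shift_act f (\<lambda>t. x (Suc t)) t = shift_act f x (Suc t)"
  by (simp add: shift_act_def)

text \<open>Sequences thus form a module over the polynomials, which is what turns
  \<open>M N = p I\<close> into annihilation by \<open>p\<close>.\<close>

lemma shift_act_mult: "shift_act (f * g) x t = shift_act f (shift_act g x) t"
proof (induction f arbitrary: t)
  case (pCons a f)
  then show ?case
    by (simp add: mult_pCons_left shift_act_add shift_act_smult shift_act_pCons)
qed simp

lemma shift_act_sum_right: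
  "shift_act f (\<lambda>t. \<Sum>i\<in>A. x i t) t = (\<Sum>i\<in>A. shift_act f (x i) t)"
  unfolding shift_act_def sum_distrib_left by (rule sum.swap)

section \<open>Residues of sequences\<close>

lemma coeff_shift_residue:
  "coeff (shift_residue p x) a = (\<Sum>t\<le>degree p. coeff p (a + 1 + t) * x t)"
proof (cases "a < degree p")
  case True
  then have "coeff (shift_residue p x) a =
      (\<Sum>b<degree p. if b = a then (\<Sum>t\<le>degree p. coeff p (a + 1 + t) * x t) else 0)"
    unfolding shift_residue_def coeff_sum coeff_monom by (intro sum.cong) auto
  then show ?thesis using True by simp
next
  case False
  then show ?thesis by (auto simp: shift_residue_def coeff_sum coeff_eq_0 intro!: sum.neutral)
qed

lemma degree_shift_residue_less: "shift_residue p x \<noteq> 0 \<Longrightarrow> degree (shift_residue p x) < degree p"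
proof -
  assume "shift_residue p x \<noteq> 0"
  then have "coeff (shift_residue p x) (degree (shift_residue p x)) \<noteq> 0" by simp
  then show ?thesis unfolding coeff_shift_residue
    by (rule contrapos_np) (auto simp: coeff_eq_0 intro!: sum.neutral)
qed

lemma shift_residue_cong:
  assumes "\<And>t. t < degree p \<Longrightarrow> x t = y t"
  shows "shift_residue p x = shift_residue p y"
proof (rule poly_eqI)
  fix a
  have "coeff p (a + 1 + t) * x t = coeff p (a + 1 + t) * y t" for t
    using assms[of t] by (cases "t < degree p") (auto simp: coeff_eq_0)
  then show "coeff (shift_residue p x) a = coeff (shift_residue p y) a"
    by (simp add: coeff_shift_residue)
qed

text \<open>Read from the top, the coefficients of the residue are triangular in
  \<open>x 0, x 1, ...\<close> with the leading coefficient of \<open>p\<close> on the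
  diagonal.\<close>

lemma shift_residue_eq_0D:
  fixes p :: "'a::idom poly"
  assumes 0: "shift_residue p x = 0" and t: "t < degree p"
  shows "x t = 0"
  using t
proof (induction t rule: less_induct)
  case (less t)
  let ?D = "degree p"
  have "0 = coeff (shift_residue p x) (?D - 1 - t)" by (simp add: 0)
  also have "\<dots> = (\<Sum>s\<le>?D. coeff p (?D - t + s) * x s)"
    using less.prems by (simp add: coeff_shift_residue Suc_diff_Suc)
  also have "\<dots> = (\<Sum>s\<in>{t}. coeff p (?D - t + s) * x s)"
    using less by (intro sum.mono_neutral_right) (auto simp: neq_iff coeff_eq_0)
  also have "\<dots> = lead_coeff p * x t" using less.prems by simp
  finally show ?case using less.prems by auto
qed

lemma shift_residue_add:
  "shift_residue p (\<lambda>t. x t + y t) = shift_residue p x + shift_residue p y"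
  by (rule poly_eqI) (simp add: coeff_shift_residue algebra_simps sum.distrib)

lemma shift_residue_mult:
  "shift_residue p (\<lambda>t. a * x t) = Polynomial.smult a (shift_residue p x)"
  by (rule poly_eqI) (simp add: coeff_shift_residue sum_distrib_left mult_ac)

lemma shift_residue_0 [simp]: "shift_residue p (\<lambda>t. 0) = 0"
  by (rule poly_eqI) (simp add: coeff_shift_residue)

lemma shift_residue_sum:
  "shift_residue p (\<lambda>t. \<Sum>i\<in>A. x i t) = (\<Sum>i\<in>A. shift_residue p (x i))"
  by (induction A rule: infinite_finite_induct) (simp_all add: shift_residue_add)

text \<open>Shifting the sequence multiplies its series in 1/\<lambda> by \<lambda> and removes the
  constant term \<open>x 0\<close>. After multiplication by \<open>p\<close>, the coefficient at
  1/\<lambda>, which is \<open>shift_act p x 0\<close>, moves into the polynomial part.\<close>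

lemma shift_residue_Suc:
  "shift_residue p (\<lambda>t. x (Suc t)) =
     pCons 0 (shift_residue p x) - Polynomial.smult (x 0) p + [:shift_act p x 0:]"
proof (rule poly_eqI)
  fix a
  have split: "(\<Sum>t\<le>degree p. coeff p (a + t) * x t) =
      coeff p a * x 0 + (\<Sum>t\<le>degree p. coeff p (a + 1 + t) * x (Suc t))"
  proof -
    have "(\<Sum>t\<le>degree p. coeff p (a + t) * x t) = (\<Sum>t\<le>Suc (degree p). coeff p (a + t) * x t)"
      by (simp add: coeff_eq_0)
    then show ?thesis by (subst (asm) sum.atMost_Suc_shift) simp
  qed
  show "coeff (shift_residue p (\<lambda>t. x (Suc t))) a =
      coeff (pCons 0 (shift_residue p x) - Polynomial.smult (x 0) p + [:shift_act p x 0:]) a"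
  proof (cases a)
    case 0
    then show ?thesis using split by (simp add: coeff_shift_residue shift_act_def)
  next
    case (Suc b)
    then show ?thesis using split by (simp add: coeff_shift_residue)
  qed
qed

text \<open>Modulo \<open>p\<close>, taking residues commutes with the action of \<open>f\<close>.
  Building \<open>f\<close> up in Horner form costs one shift per degree, and each shift changes the
  residue by a multiple of \<open>p\<close> as long as the corresponding value of
  \<open>shift_act p x\<close> vanishes.\<close>

lemma dvd_shift_residue_act:
  assumes "\<And>t. t < degree f \<Longrightarrow> shift_act p x t = 0"
  shows "p dvd shift_residue p (shift_act f x) - f * shift_residue p x"
  using assms
proof (induction f arbitrary: x)
  case 0
  have "shift_act 0 x = (\<lambda>t. 0)" by auto
  then show ?case by simp
next
  case (pCons a f)
  show ?case
  proof (cases "f = 0")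
    case True
    have "shift_act (pCons a f) x = (\<lambda>t. a * x t)" by (auto simp: True shift_act_pCons)
    then show ?thesis by (simp add: True shift_residue_mult mult_pCons_left)
  next
    case False
    then have 0: "shift_act p x 0 = 0" and S: "\<And>t. t < degree f \<Longrightarrow> shift_act p x (Suc t) = 0"
      using pCons.prems by auto
    have "shift_act (pCons a f) x = (\<lambda>t. a * x t + shift_act f (\<lambda>t. x (Suc t)) t)"
      by (simp add: fun_eq_iff shift_act_pCons shift_act_Suc)
    moreover have "pCons a f * shift_residue p x = Polynomial.smult a (shift_residue p x) +
        f * (Polynomial.smult (x 0) p + shift_residue p (\<lambda>t. x (Suc t)))"
      using shift_residue_Suc[of p x] by (simp add: 0 mult_pCons_left)
    ultimately have "shift_residue p (shift_act (pCons a f) x) - pCons a f * shift_residue p x =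
        (shift_residue p (shift_act f (\<lambda>t. x (Suc t))) - f * shift_residue p (\<lambda>t. x (Suc t))) -
        f * Polynomial.smult (x 0) p"
      by (simp add: shift_residue_add shift_residue_mult algebra_simps)
    moreover have "p dvd shift_residue p (shift_act f (\<lambda>t. x (Suc t))) - f * shift_residue p (\<lambda>t. x (Suc t))"
      by (rule pCons.IH) (simp add: shift_act_Suc S)
    moreover have "p dvd f * Polynomial.smult (x 0) p" by (intro dvd_mult dvd_smult) simp
    ultimately show ?thesis by (simp add: dvd_diff)
  qed
qed

text \<open>Only the equations with \<open>c < k\<close> are available. Acting by \<open>N\<close>
  looks at most \<open>L\<close> positions ahead, so \<open>p\<close> annihilates the sequences at
  all \<open>t\<close> with \<open>t + L < k\<close>. The bound on \<open>k\<close> makes this cover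
  every position below \<open>degree p\<close>, as needed for residues under entries of degree at
  most \<open>degree p\<close>.\<close>

lemma sylvester_left_kernel_trivial:
  fixes f :: "nat \<Rightarrow> nat \<Rightarrow> 'a::field poly"
  assumes deg: "\<And>i j. i < m \<Longrightarrow> j < q \<Longrightarrow> degree (f i j) \<le> d i"
    and lead: "lin_indep_family m q (\<lambda>i j. coeff (f i j) (d i))"
    and sat: "\<And>p w i. p \<noteq> 0 \<Longrightarrow> (\<And>j. j < q \<Longrightarrow> p dvd (\<Sum>i<m. w i * f i j)) \<Longrightarrow> i < m \<Longrightarrow> p dvd w i"
    and inv: "\<And>i k. i < m \<Longrightarrow> k < m \<Longrightarrow> (\<Sum>j<q. f i j * N j k) = (if i = k then p else 0)"
    and p: "p \<noteq> 0" and dD: "\<And>i. i < m \<Longrightarrow> d i \<le> degree p"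
    and degN: "\<And>j k. j < q \<Longrightarrow> k < m \<Longrightarrow> degree (N j k) \<le> L"
    and k: "2 * degree p + L \<le> k"
    and x: "\<And>c j. c < k \<Longrightarrow> j < q \<Longrightarrow> (\<Sum>i<m. shift_act (f i j) (x i) c) = 0"
  shows "i < m \<Longrightarrow> t < k + d i \<Longrightarrow> x i t = 0"
proof -
  let ?D = "degree p"
  have ann: "shift_act p (x i) t = 0" if i: "i < m" and t: "t + L < k" for i t
  proof -
    have "shift_act p (x i) t = (\<Sum>h<m. if h = i then shift_act p (x h) t else 0)" using i by simp
    also have "\<dots> = (\<Sum>h<m. shift_act (\<Sum>j<q. f h j * N j i) (x h) t)"
      using i by (intro sum.cong refl) (simp add: inv)
    also have "\<dots> = (\<Sum>j<q. \<Sum>h<m. shift_act (N j i) (shift_act (f h j) (x h)) t)"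
      by (subst sum.swap) (simp add: shift_act_sum shift_act_mult mult.commute[of "f _ _"])
    also have "\<dots> = (\<Sum>j<q. shift_act (N j i) (\<lambda>t. \<Sum>h<m. shift_act (f h j) (x h) t) t)"
      by (simp add: shift_act_sum_right)
    also have "\<dots> = 0"
    proof (intro sum.neutral ballI)
      fix j assume "j \<in> {..<q}"
      then have j: "j < q" by simp
      have "(\<Sum>h<m. shift_act (f h j) (x h) (t + s)) = 0" if "s \<le> degree (N j i)" for s
        using degN[OF j i] that t by (intro x j) simp
      then show "shift_act (N j i) (\<lambda>t. \<Sum>h<m. shift_act (f h j) (x h) t) t = 0"
        by (simp add: shift_act_def[of "N j i"])
    qed
    finally show ?thesis .
  qed
  define w where "w i = shift_residue p (x i)" for i
  have "p dvd (\<Sum>i<m. w i * f i j)" if j: "j < q" for j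
  proof -
    have "p dvd shift_residue p (shift_act (f i j) (x i)) - f i j * w i" if i: "i < m" for i
      unfolding w_def
      by (rule dvd_shift_residue_act, rule ann[OF i]) (use deg[OF i j] dD[OF i] k in linarith)
    then have "p dvd (\<Sum>i<m. shift_residue p (shift_act (f i j) (x i)) - f i j * w i)"
      by (intro dvd_sum) auto
    also have "\<dots> = shift_residue p (\<lambda>t. \<Sum>i<m. shift_act (f i j) (x i) t) - (\<Sum>i<m. w i * f i j)"
      by (simp add: sum_subtractf shift_residue_sum mult.commute)
    also have "shift_residue p (\<lambda>t. \<Sum>i<m. shift_act (f i j) (x i) t) = shift_residue p (\<lambda>t. 0)"
      by (rule shift_residue_cong) (use x j k in auto)
    finally show ?thesis by simp
  qed
  then have "p dvd w i" if "i < m" for i using sat[OF p _ that] by blast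
  \<comment> \<open>A nonzero residue would have degree below that of \<open>p\<close> and could not
    be a multiple of it.\<close>
  then have "w i = 0" if "i < m" for i
    using that degree_shift_residue_less[of p "x i"] dvd_imp_degree_le[of p "w i"]
    unfolding w_def by fastforce
  then have small: "x i t = 0" if "i < m" "t < ?D" for i t
    using shift_residue_eq_0D[of p "x i" t] that unfolding w_def by blast
  \<comment> \<open>Annihilation by \<open>p\<close> does not reach the end of the window. Once all
    terms below \<open>c + d i\<close> vanish, equation \<open>c\<close> involves only the terms at
    \<open>c + d i\<close>, weighted by the independent leading rows. The base case uses
    \<open>d i \<le> degree p\<close>.\<close>
  have "\<forall>i<m. \<forall>t<c + d i. x i t = 0" if "c \<le> k" for c
    using that
  proof (induction c)
    case 0
    then show ?case using small dD by fastforce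
  next
    case (Suc c)
    then have IH: "\<And>i t. i < m \<Longrightarrow> t < c + d i \<Longrightarrow> x i t = 0" and c: "c < k" by auto
    have "(\<Sum>i<m. x i (c + d i) * coeff (f i j) (d i)) = 0" if j: "j < q" for j
    proof -
      have "shift_act (f i j) (x i) c = x i (c + d i) * coeff (f i j) (d i)" if i: "i < m" for i
      proof -
        have "shift_act (f i j) (x i) c = (\<Sum>s\<le>d i. coeff (f i j) s * x i (c + s))"
          by (rule shift_act_altdef[OF deg[OF i j]])
        also have "\<dots> = (\<Sum>s\<in>{d i}. coeff (f i j) s * x i (c + s))"
          using IH[OF i] by (intro sum.mono_neutral_right) auto
        finally show ?thesis by simp
      qed
      then show ?thesis using x[OF c j] by simp
    qed
    then have top: "x i (c + d i) = 0" if "i < m" for i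
      using lin_indep_familyD[OF lead _ that, of "\<lambda>i. x i (c + d i)"] by blast
    show ?case
    proof (intro allI impI)
      fix i t assume i: "i < m" and "t < Suc c + d i"
      then have "t < c + d i \<or> t = c + d i" by auto
      then show "x i t = 0" using IH[OF i] top[OF i] by blast
    qed
  qed
  then show "i < m \<Longrightarrow> t < k + d i \<Longrightarrow> x i t = 0" by blast
qed

section \<open>Trimmed Sylvester matrices\<close>

definition trim_rows :: "nat list \<Rightarrow> nat \<Rightarrow> nat set" where
  "trim_rows ds k = {r. r div length ds < k + ds ! (r mod length ds)}"

text \<open>The number of the row of \<open>T\<^sub>k\<close> that stems from row \<open>i\<close> of block row \<open>t\<close> of \<open>S\<^sub>k\<close>.\<close>

definition trim_index :: "nat list \<Rightarrow> nat \<Rightarrow> nat \<Rightarrow> nat \<Rightarrow> nat" where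
  "trim_index ds k i t = card {a \<in> trim_rows ds k. a < t * length ds + i}"

lemma div_block: "i < m \<Longrightarrow> (t * m + i) div m = (t :: nat)"
  by (cases "m = 0") simp_all

lemma mod_block: "i < m \<Longrightarrow> (t * m + i) mod m = (i :: nat)"
  by simp

lemma trimmed_rows_set:
  assumes "ds \<noteq> []"
  shows "{r. r < (k + Max (set ds)) * length ds \<and> r \<in> trim_rows ds k} =
    (\<lambda>(i, t). t * length ds + i) ` (SIGMA i:{..<length ds}. {..<k + ds ! i})"
    (is "?L = ?f ` ?S")
proof (intro equalityI subsetI)
  let ?m = "length ds"
  have m: "0 < ?m" using assms by simp
  fix r assume "r \<in> ?L"
  then have "r div ?m < k + ds ! (r mod ?m)" by (simp add: trim_rows_def)
  then have "(r mod ?m, r div ?m) \<in> ?S" using m by simp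
  moreover have "?f (r mod ?m, r div ?m) = r" by simp
  ultimately show "r \<in> ?f ` ?S" by (metis imageI)
next
  let ?m = "length ds"
  fix r assume "r \<in> ?f ` ?S"
  then obtain i t where it: "i < ?m" "t < k + ds ! i" "r = t * ?m + i" by auto
  have "ds ! i \<le> Max (set ds)" using it(1) by simp
  then have "t + 1 \<le> k + Max (set ds)" using it(2) by simp
  then have "(t + 1) * ?m \<le> (k + Max (set ds)) * ?m" by (rule mult_le_mono1)
  then have "r < (k + Max (set ds)) * ?m" using it(1,3) by simp
  moreover have "r div ?m = t" "r mod ?m = i" using it(1,3) by (simp_all add: div_block)
  ultimately show "r \<in> ?L" using it(2) by (simp add: trim_rows_def)
qed

lemma inj_trim: "inj_on (\<lambda>(i, t). t * m + i) (SIGMA i:{..<m::nat}. B i)"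
proof (rule inj_onI)
  fix a b assume "a \<in> (SIGMA i:{..<m}. B i)" "b \<in> (SIGMA i:{..<m}. B i)"
    and "(\<lambda>(i, t). t * m + i) a = (\<lambda>(i, t). t * m + i) b"
  then have "fst a < m" "fst b < m" "snd a * m + fst a = snd b * m + fst b"
    by (auto simp: case_prod_beta)
  then have "snd a = snd b" "fst a = fst b" by (metis div_block, metis mod_block)
  then show "a = b" by (rule prod_eqI[rotated])
qed

lemma card_trimmed_rows:
  assumes "ds \<noteq> []"
  shows "card {r. r < (k + Max (set ds)) * length ds \<and> r \<in> trim_rows ds k} =
    k * length ds + sum_list ds"
proof -
  have "card {r. r < (k + Max (set ds)) * length ds \<and> r \<in> trim_rows ds k} =
      card (SIGMA i:{..<length ds}. {..<k + ds ! i})"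
    unfolding trimmed_rows_set[OF assms] by (rule card_image[OF inj_trim])
  also have "\<dots> = k * length ds + sum_list ds"
    by (simp add: sum.distrib sum_list_sum_nth atLeast0LessThan)
  finally show ?thesis .
qed

lemma trimmed_sylvester_carrier:
  assumes M: "M \<in> poly_mat_space ds n" and ds: "ds \<noteq> []"
  shows "trimmed_sylvester ds k M \<in>
    carrier_mat (k * length ds + sum_list ds) (k * (length ds + n))"
proof -
  have dims: "dim_row M = length ds" "dim_col M = length ds + n" using M by (auto simp: poly_mat_space_def)
  then show ?thesis
    using card_trimmed_rows[OF ds, of k]
    by (intro carrier_matI)
      (simp_all add: trimmed_sylvester_def dim_submatrix sylvester_def trim_rows_def)
qed

lemma pick_trim_index:
  assumes "i < length ds" "t < k + ds ! i"
  shows "pick (trim_rows ds k) (trim_index ds k i t) = t * length ds + i"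
proof -
  have "t * length ds + i \<in> trim_rows ds k"
    using assms by (simp add: trim_rows_def div_block)
  then show ?thesis unfolding trim_index_def by (rule pick_card_in_set)
qed

text \<open>\<open>pick\<close> recovers the original row from its number, which gives injectivity;
  surjectivity follows by counting.\<close>

lemma bij_betw_trim_index:
  assumes ds: "ds \<noteq> []"
  shows "bij_betw (\<lambda>(i, t). trim_index ds k i t) (SIGMA i:{..<length ds}. {..<k + ds ! i})
    {..<k * length ds + sum_list ds}"
proof -
  let ?m = "length ds" and ?I = "trim_rows ds k" and ?S = "SIGMA i:{..<length ds}. {..<k + ds ! i}"
  have inj: "inj_on (\<lambda>(i, t). trim_index ds k i t) ?S"
  proof (rule inj_onI)
    fix a b assume a: "a \<in> ?S" and b: "b \<in> ?S"
      and "(\<lambda>(i, t). trim_index ds k i t) a = (\<lambda>(i, t). trim_index ds k i t) b"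
    then have "(\<lambda>(i, t). t * ?m + i) a = (\<lambda>(i, t). t * ?m + i) b"
      using pick_trim_index[of "fst a" ds "snd a" k] pick_trim_index[of "fst b" ds "snd b" k]
      by (auto simp: case_prod_beta)
    then show "a = b" using inj_onD[OF inj_trim _ a b] by simp
  qed
  have "(\<lambda>(i, t). trim_index ds k i t) ` ?S \<subseteq> {..<k * ?m + sum_list ds}"
  proof clarsimp
    fix i t assume it: "i < ?m" "t < k + ds ! i"
    let ?R = "{r. r < (k + Max (set ds)) * ?m \<and> r \<in> ?I}"
    have r: "t * ?m + i \<in> ?R" unfolding trimmed_rows_set[OF ds] using it by force
    have "{a \<in> ?I. a < t * ?m + i} \<subset> ?R" using r by (auto simp del: One_nat_def)
    then have "trim_index ds k i t < card ?R" unfolding trim_index_def by (intro psubset_card_mono) auto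
    then show "trim_index ds k i t < k * ?m + sum_list ds" by (simp only: card_trimmed_rows[OF ds])
  qed
  moreover have "card ((\<lambda>(i, t). trim_index ds k i t) ` ?S) = card {..<k * ?m + sum_list ds}"
    unfolding card_image[OF inj] by (simp add: sum.distrib sum_list_sum_nth atLeast0LessThan)
  ultimately have "(\<lambda>(i, t). trim_index ds k i t) ` ?S = {..<k * ?m + sum_list ds}"
    by (intro card_subset_eq) auto
  with inj show "bij_betw (\<lambda>(i, t). trim_index ds k i t) ?S {..<k * ?m + sum_list ds}"
    by (simp add: bij_betw_def)
qed

lemma sum_trim_index:
  assumes "ds \<noteq> []"
  shows "(\<Sum>r<k * length ds + sum_list ds. g r) = (\<Sum>i<length ds. \<Sum>t<k + ds ! i. g (trim_index ds k i t))"
proof -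
  have "(\<Sum>i<length ds. \<Sum>t<k + ds ! i. g (trim_index ds k i t)) =
      (\<Sum>(i, t)\<in>(SIGMA i:{..<length ds}. {..<k + ds ! i}). g (trim_index ds k i t))"
    by (rule sum.Sigma) auto
  also have "\<dots> = (\<Sum>p\<in>(SIGMA i:{..<length ds}. {..<k + ds ! i}). g ((\<lambda>(i, t). trim_index ds k i t) p))"
    by (simp add: case_prod_beta)
  also have "\<dots> = (\<Sum>r<k * length ds + sum_list ds. g r)"
    by (rule sum.reindex_bij_betw[OF bij_betw_trim_index[OF assms]])
  finally show ?thesis ..
qed

lemma trim_index_less:
  assumes "ds \<noteq> []" "i < length ds" "t < k + ds ! i"
  shows "trim_index ds k i t < k * length ds + sum_list ds"
  using bij_betw_apply[OF bij_betw_trim_index[OF assms(1), of k], of "(i, t)"] assms by simp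

lemma trim_index_surj:
  assumes "ds \<noteq> []" "r < k * length ds + sum_list ds"
  obtains i t where "i < length ds" "t < k + ds ! i" "r = trim_index ds k i t"
proof -
  have "r \<in> (\<lambda>(i, t). trim_index ds k i t) ` (SIGMA i:{..<length ds}. {..<k + ds ! i})"
    using bij_betw_imp_surj_on[OF bij_betw_trim_index[OF assms(1), of k]] assms(2) by simp
  then show thesis using that by auto
qed

lemma trim_index_inject:
  assumes "ds \<noteq> []" "i < length ds" "t < k + ds ! i" "i' < length ds" "t' < k + ds ! i'"
    and "trim_index ds k i t = trim_index ds k i' t'"
  shows "i = i' \<and> t = t'"
  using inj_onD[OF bij_betw_imp_inj_on[OF bij_betw_trim_index[OF assms(1), of k]],
      of "(i, t)" "(i', t')"] assms by simp

section \<open>Entries and products of trimmed Sylvester matrices\<close>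

lemma trimmed_sylvester_index:
  assumes M: "M \<in> poly_mat_space ds n" and ds: "ds \<noteq> []"
    and it: "i < length ds" "t < k + ds ! i" and cj: "c < k" "j < length ds + n"
  shows "trimmed_sylvester ds k M $$ (trim_index ds k i t, c * (length ds + n) + j) =
    (if c \<le> t then coeff (M $$ (i, j)) (t - c) else 0)"
proof -
  let ?m = "length ds" and ?q = "length ds + n"
  have dims: "dim_row M = ?m" "dim_col M = ?q" and deg: "degree (M $$ (i, j)) \<le> ds ! i"
    using M it cj by (auto simp: poly_mat_space_def)
  have "(c + 1) * ?q \<le> k * ?q" using cj(1) by (intro mult_le_mono1) simp
  then have col: "c * ?q + j < k * ?q" using cj(2) by simp
  have le: "ds ! i \<le> Max (set ds)" using it(1) by simp
  then have "(t + 1) * ?m \<le> (k + Max (set ds)) * ?m" using it(2) by (intro mult_le_mono1) simp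
  then have row: "t * ?m + i < (k + Max (set ds)) * ?m" using it(1) by simp
  have dm: "(t * ?m + i) div ?m = t" "(t * ?m + i) mod ?m = i"
    "(c * ?q + j) div ?q = c" "(c * ?q + j) mod ?q = j"
    using it(1) cj(2) by (simp_all only: div_block mod_block)
  have "trimmed_sylvester ds k M $$ (trim_index ds k i t, c * ?q + j) =
      sylvester (Max (set ds)) k M $$ (t * ?m + i, c * ?q + j)"
    unfolding trimmed_sylvester_def dims trim_rows_def[symmetric]
    using trim_index_less[OF ds it] card_trimmed_rows[OF ds, of k] col
    by (subst submatrix_index)
      (simp_all add: sylvester_def dims pick_UNIV pick_trim_index[OF it])
  also have "\<dots> = (if c \<le> t \<and> t - c \<le> Max (set ds) then coeff (M $$ (i, j)) (t - c) else 0)"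
    using row col unfolding sylvester_def dims by (simp only: index_mat dm prod.case Let_def)
  \<comment> \<open>The upper limit of the band is absorbed by the degree bound on the
    entries.\<close>
  also have "\<dots> = (if c \<le> t then coeff (M $$ (i, j)) (t - c) else 0)"
    using deg le by (auto simp: coeff_eq_0)
  finally show ?thesis .
qed

lemma sum_blocks:
  fixes g :: "nat \<Rightarrow> 'a::comm_monoid_add"
  shows "(\<Sum>h<k * q. g h) = (\<Sum>c<k. \<Sum>j<q. g (c * q + j))"
proof -
  have "(\<Sum>h<k * q. g h) = (\<Sum>c<k. \<Sum>h\<in>{c * q..<c * q + q}. g h)"
    by (rule sum.nat_group[symmetric])
  also have "\<dots> = (\<Sum>c<k. \<Sum>j<q. g (c * q + j))"
    using sum.shift_bounds_nat_ivl[of g 0 "_ * q" q]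
    by (simp add: atLeast0LessThan add.commute)
  finally show ?thesis .
qed

lemma trimmed_sylvester_mult_vec_index:
  fixes M :: "'a::comm_ring_1 poly mat"
  assumes M: "M \<in> poly_mat_space ds n" and ds: "ds \<noteq> []"
    and it: "i < length ds" "t < k + ds ! i"
    and v: "v \<in> carrier_vec (k * (length ds + n))"
  shows "(trimmed_sylvester ds k M *\<^sub>v v) $ trim_index ds k i t =
    (\<Sum>c<k. \<Sum>j<length ds + n.
      (if c \<le> t then coeff (M $$ (i, j)) (t - c) else 0) * v $ (c * (length ds + n) + j))"
proof -
  let ?T = "trimmed_sylvester ds k M" and ?q = "length ds + n"
  have "(?T *\<^sub>v v) $ trim_index ds k i t = (\<Sum>h<k * ?q. ?T $$ (trim_index ds k i t, h) * v $ h)"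
    using trimmed_sylvester_carrier[OF M ds, of k] trim_index_less[OF ds it] v
    by (simp add: scalar_prod_def atLeast0LessThan)
  also have "\<dots> = (\<Sum>c<k. \<Sum>j<?q. ?T $$ (trim_index ds k i t, c * ?q + j) * v $ (c * ?q + j))"
    by (rule sum_blocks)
  also have "\<dots> = (\<Sum>c<k. \<Sum>j<?q.
      (if c \<le> t then coeff (M $$ (i, j)) (t - c) else 0) * v $ (c * ?q + j))"
    by (intro sum.cong refl) (simp add: trimmed_sylvester_index[OF M ds it])
  finally show ?thesis .
qed

lemma trimmed_sylvester_transpose_mult_vec_index:
  fixes M :: "'a::comm_ring_1 poly mat"
  assumes M: "M \<in> poly_mat_space ds n" and ds: "ds \<noteq> []"
    and x: "x \<in> carrier_vec (k * length ds + sum_list ds)"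
    and cj: "c < k" "j < length ds + n"
  shows "((trimmed_sylvester ds k M)\<^sup>T *\<^sub>v x) $ (c * (length ds + n) + j) =
    (\<Sum>i<length ds. shift_act (M $$ (i, j)) (\<lambda>t. x $ trim_index ds k i t) c)"
proof -
  let ?T = "trimmed_sylvester ds k M" and ?q = "length ds + n"
  have "(c + 1) * ?q \<le> k * ?q" using cj(1) by (intro mult_le_mono1) simp
  then have col: "c * ?q + j < k * ?q" using cj(2) by simp
  have "(?T\<^sup>T *\<^sub>v x) $ (c * ?q + j) = (\<Sum>r<k * length ds + sum_list ds. ?T $$ (r, c * ?q + j) * x $ r)"
    using trimmed_sylvester_carrier[OF M ds, of k] col x
    by (simp add: scalar_prod_def atLeast0LessThan)
  also have "\<dots> = (\<Sum>i<length ds. \<Sum>t<k + ds ! i.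
      ?T $$ (trim_index ds k i t, c * ?q + j) * x $ trim_index ds k i t)"
    by (rule sum_trim_index[OF ds])
  also have "\<dots> = (\<Sum>i<length ds. shift_act (M $$ (i, j)) (\<lambda>t. x $ trim_index ds k i t) c)"
  proof (intro sum.cong refl)
    fix i assume "i \<in> {..<length ds}"
    then have i: "i < length ds" by simp
    then have deg: "degree (M $$ (i, j)) \<le> ds ! i" using M cj(2) by (auto simp: poly_mat_space_def)
    have "(\<Sum>t<k + ds ! i. ?T $$ (trim_index ds k i t, c * ?q + j) * x $ trim_index ds k i t) =
        (\<Sum>t<k + ds ! i. (if c \<le> t then coeff (M $$ (i, j)) (t - c) else 0) * x $ trim_index ds k i t)"
      by (intro sum.cong refl) (simp add: trimmed_sylvester_index[OF M ds i _ cj])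
    also have "\<dots> = (\<Sum>t\<in>{c..<c + (ds ! i + 1)}. coeff (M $$ (i, j)) (t - c) * x $ trim_index ds k i t)"
      using deg cj(1) by (intro sum.mono_neutral_cong_right) (auto simp: coeff_eq_0)
    also have "\<dots> = (\<Sum>s<ds ! i + 1. coeff (M $$ (i, j)) s * x $ trim_index ds k i (c + s))"
      using sum.shift_bounds_nat_ivl[of "\<lambda>t. coeff (M $$ (i, j)) (t - c) * x $ trim_index ds k i t" 0 c "ds ! i + 1"]
      by (simp add: atLeast0LessThan add.commute)
    also have "\<dots> = shift_act (M $$ (i, j)) (\<lambda>t. x $ trim_index ds k i t) c"
      using shift_act_altdef[OF deg] by (simp add: lessThan_Suc_atMost)
    finally show "(\<Sum>t<k + ds ! i. ?T $$ (trim_index ds k i t, c * ?q + j) * x $ trim_index ds k i t) =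
        shift_act (M $$ (i, j)) (\<lambda>t. x $ trim_index ds k i t) c" .
  qed
  finally show ?thesis .
qed

text \<open>Row vectors are traded for infinite sequences, so that the shift calculus applies.
  Values beyond the window \<open>t < k + ds ! i\<close> are harmless: equation \<open>c < k\<close>
  reaches at most position \<open>c + ds ! i\<close>.\<close>

lemma trimmed_sylvester_full_rank_iff:
  fixes M :: "'a::field poly mat"
  assumes M: "M \<in> poly_mat_space ds n" and ds: "ds \<noteq> []"
  shows "mat_rank (trimmed_sylvester ds k M) = k * length ds + sum_list ds \<longleftrightarrow>
    (\<forall>X. (\<forall>c<k. \<forall>j<length ds + n. (\<Sum>i<length ds. shift_act (M $$ (i, j)) (X i) c) = 0) \<longrightarrow>
      (\<forall>i<length ds. \<forall>t<k + ds ! i. X i t = 0))"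
    (is "_ \<longleftrightarrow> ?R")
proof -
  let ?T = "trimmed_sylvester ds k M" and ?q = "length ds + n" and ?r = "k * length ds + sum_list ds"
  have T: "?T \<in> carrier_mat ?r (k * ?q)" by (rule trimmed_sylvester_carrier[OF M ds])
  have q: "0 < ?q" using ds by simp
  have ker: "?T\<^sup>T *\<^sub>v x = 0\<^sub>v (k * ?q) \<longleftrightarrow>
      (\<forall>c<k. \<forall>j<?q. (\<Sum>i<length ds. shift_act (M $$ (i, j)) (\<lambda>t. x $ trim_index ds k i t) c) = 0)"
    if x: "x \<in> carrier_vec ?r" for x
  proof
    assume 0: "?T\<^sup>T *\<^sub>v x = 0\<^sub>v (k * ?q)"
    show "\<forall>c<k. \<forall>j<?q. (\<Sum>i<length ds. shift_act (M $$ (i, j)) (\<lambda>t. x $ trim_index ds k i t) c) = 0"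
    proof (intro allI impI)
      fix c j assume cj: "c < k" "j < ?q"
      then have "(c + 1) * ?q \<le> k * ?q" by (intro mult_le_mono1) simp
      then have "c * ?q + j < k * ?q" using cj(2) by simp
      then show "(\<Sum>i<length ds. shift_act (M $$ (i, j)) (\<lambda>t. x $ trim_index ds k i t) c) = 0"
        unfolding trimmed_sylvester_transpose_mult_vec_index[OF M ds x cj, symmetric] 0 by simp
    qed
  next
    assume R: "\<forall>c<k. \<forall>j<?q. (\<Sum>i<length ds. shift_act (M $$ (i, j)) (\<lambda>t. x $ trim_index ds k i t) c) = 0"
    show "?T\<^sup>T *\<^sub>v x = 0\<^sub>v (k * ?q)"
    proof (rule eq_vecI)
      fix h assume "h < dim_vec (0\<^sub>v (k * ?q) :: 'a vec)"
      then have h: "h < k * ?q" by simp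
      then have cj: "h div ?q < k" "h mod ?q < ?q"
        using q by (auto simp: less_mult_imp_div_less)
      have "(?T\<^sup>T *\<^sub>v x) $ (h div ?q * ?q + h mod ?q) = 0"
        unfolding trimmed_sylvester_transpose_mult_vec_index[OF M ds x cj] using R cj by blast
      then show "(?T\<^sup>T *\<^sub>v x) $ h = 0\<^sub>v (k * ?q) $ h"
        using h by (simp only: div_mult_mod_eq index_zero_vec)
    qed (use T in auto)
  qed
  have "mat_rank ?T = ?r \<longleftrightarrow> (\<forall>x\<in>carrier_vec ?r. ?T\<^sup>T *\<^sub>v x = 0\<^sub>v (k * ?q) \<longrightarrow> x = 0\<^sub>v ?r)"
    using mat_rank_eq_dim_row_iff[OF T] T by simp
  also have "\<dots> \<longleftrightarrow> ?R"
  proof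
    assume inj: "\<forall>x\<in>carrier_vec ?r. ?T\<^sup>T *\<^sub>v x = 0\<^sub>v (k * ?q) \<longrightarrow> x = 0\<^sub>v ?r"
    show ?R
    proof (intro allI impI)
      fix X i t
      assume X: "\<forall>c<k. \<forall>j<?q. (\<Sum>i<length ds. shift_act (M $$ (i, j)) (X i) c) = 0"
        and it: "i < length ds" "t < k + ds ! i"
      \<comment> \<open>Inverting the row numbering packs the windows of all sequences into one
        vector.\<close>
      define f where "f = the_inv_into (SIGMA i:{..<length ds}. {..<k + ds ! i}) (\<lambda>(i, t). trim_index ds k i t)"
      define x where "x = vec ?r (\<lambda>r. case f r of (i, t) \<Rightarrow> X i t)"
      have x: "x \<in> carrier_vec ?r" by (simp add: x_def)
      have xX: "x $ trim_index ds k i t = X i t" if it: "i < length ds" "t < k + ds ! i" for i t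
      proof -
        have "f (trim_index ds k i t) = (i, t)"
          using the_inv_into_f_f[OF bij_betw_imp_inj_on[OF bij_betw_trim_index[OF ds, of k]], of "(i, t)"] it
          by (simp add: f_def)
        then show ?thesis using trim_index_less[OF ds it] by (simp add: x_def)
      qed
      have "shift_act (M $$ (i, j)) (\<lambda>t. x $ trim_index ds k i t) c = shift_act (M $$ (i, j)) (X i) c"
        if "i < length ds" "c < k" "j < ?q" for i c j
      proof -
        have "degree (M $$ (i, j)) \<le> ds ! i" using M that by (auto simp: poly_mat_space_def)
        then show ?thesis unfolding shift_act_def using that by (intro sum.cong refl) (simp add: xX)
      qed
      then have "?T\<^sup>T *\<^sub>v x = 0\<^sub>v (k * ?q)" unfolding ker[OF x] using X by simp
      then have "x = 0\<^sub>v ?r" using inj x by blast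
      then show "X i t = 0" using xX[OF it] trim_index_less[OF ds it] by simp
    qed
  next
    assume R: ?R
    show "\<forall>x\<in>carrier_vec ?r. ?T\<^sup>T *\<^sub>v x = 0\<^sub>v (k * ?q) \<longrightarrow> x = 0\<^sub>v ?r"
    proof (intro ballI impI)
      fix x assume x: "x \<in> carrier_vec ?r" and 0: "?T\<^sup>T *\<^sub>v x = 0\<^sub>v (k * ?q)"
      have "\<forall>i<length ds. \<forall>t<k + ds ! i. x $ trim_index ds k i t = 0"
        by (rule mp[OF spec[OF R, of "\<lambda>i t. x $ trim_index ds k i t"]]) (rule 0[unfolded ker[OF x]])
      then show "x = 0\<^sub>v ?r" using x by (intro eq_vecI) (auto elim!: trim_index_surj[OF ds])
    qed
  qed
  finally show ?thesis .
qed

section \<open>Full row rank of \<open>T_k\<close> versus minimality\<close>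

lemma leading_row_coeff_mat_full_rank_iff:
  fixes M :: "'a::field poly mat"
  assumes M: "M \<in> poly_mat_space ds n"
  shows "mat_rank (leading_row_coeff_mat ds M) = length ds \<longleftrightarrow>
    lin_indep_family (length ds) (length ds + n) (\<lambda>i j. coeff (M $$ (i, j)) (ds ! i))"
    (is "_ \<longleftrightarrow> ?R")
proof -
  let ?L = "leading_row_coeff_mat ds M" and ?m = "length ds" and ?q = "length ds + n"
  have dims: "dim_row M = ?m" "dim_col M = ?q" using M by (auto simp: poly_mat_space_def)
  have L: "?L \<in> carrier_mat ?m ?q" by (simp add: leading_row_coeff_mat_def dims)
  have ker: "?L\<^sup>T *\<^sub>v x = 0\<^sub>v ?q \<longleftrightarrow> (\<forall>j<?q. (\<Sum>i<?m. x $ i * coeff (M $$ (i, j)) (ds ! i)) = 0)"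
    if "x \<in> carrier_vec ?m" for x
    using that by (auto simp: vec_eq_iff scalar_prod_def leading_row_coeff_mat_def dims
        atLeast0LessThan mult.commute)
  have "mat_rank ?L = ?m \<longleftrightarrow> (\<forall>x\<in>carrier_vec ?m. ?L\<^sup>T *\<^sub>v x = 0\<^sub>v ?q \<longrightarrow> x = 0\<^sub>v ?m)"
    using mat_rank_eq_dim_row_iff[OF L] L by simp
  also have "\<dots> \<longleftrightarrow> ?R"
  proof
    assume inj: "\<forall>x\<in>carrier_vec ?m. ?L\<^sup>T *\<^sub>v x = 0\<^sub>v ?q \<longrightarrow> x = 0\<^sub>v ?m"
    show ?R
      unfolding lin_indep_family_def
    proof (intro allI impI)
      fix w i assume "\<forall>j<?q. (\<Sum>i<?m. w i * coeff (M $$ (i, j)) (ds ! i)) = 0" and i: "i < ?m"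
      then have "vec ?m w = 0\<^sub>v ?m" using inj ker[of "vec ?m w"] by simp
      then show "w i = 0" using i by (metis index_vec index_zero_vec(1))
    qed
  next
    assume R: ?R
    show "\<forall>x\<in>carrier_vec ?m. ?L\<^sup>T *\<^sub>v x = 0\<^sub>v ?q \<longrightarrow> x = 0\<^sub>v ?m"
    proof (intro ballI impI)
      fix x assume x: "x \<in> carrier_vec ?m" and 0: "?L\<^sup>T *\<^sub>v x = 0\<^sub>v ?q"
      have "x $ i = 0" if "i < ?m" for i
        using lin_indep_familyD[OF R _ that, of "\<lambda>i. x $ i"] 0 unfolding ker[OF x] by blast
      then show "x = 0\<^sub>v ?m" using x by auto
    qed
  qed
  finally show ?thesis .
qed

text \<open>A dependency \<open>w\<close> of the leading rows, placed at the last position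
  \<open>k - 1 + ds ! i\<close> of each sequence, is seen only by equation \<open>k - 1\<close>,
  where it cancels. It is therefore a left kernel vector.\<close>

lemma trimmed_full_rank_imp_leading:
  fixes M :: "'a::field poly mat"
  assumes M: "M \<in> poly_mat_space ds n" and ds: "ds \<noteq> []" and k: "1 \<le> k"
    and rank: "mat_rank (trimmed_sylvester ds k M) = k * length ds + sum_list ds"
  shows "lin_indep_family (length ds) (length ds + n) (\<lambda>i j. coeff (M $$ (i, j)) (ds ! i))"
  unfolding lin_indep_family_def
proof (intro allI impI)
  let ?m = "length ds" and ?q = "length ds + n"
  fix w i assume w: "\<forall>j<?q. (\<Sum>i<?m. w i * coeff (M $$ (i, j)) (ds ! i)) = 0" and i: "i < ?m"
  define X where "X i t = (if t = k - 1 + ds ! i then w i else 0)" for i t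
  have "(\<Sum>i<?m. shift_act (M $$ (i, j)) (X i) c) = 0" if c: "c < k" and j: "j < ?q" for c j
  proof -
    have "shift_act (M $$ (i, j)) (X i) c = (if c = k - 1 then w i * coeff (M $$ (i, j)) (ds ! i) else 0)"
      if i: "i < ?m" for i
    proof -
      have deg: "degree (M $$ (i, j)) \<le> ds ! i" using M i j by (auto simp: poly_mat_space_def)
      have "shift_act (M $$ (i, j)) (X i) c = (\<Sum>s\<le>ds ! i. coeff (M $$ (i, j)) s * X i (c + s))"
        by (rule shift_act_altdef[OF deg])
      also have "\<dots> = (\<Sum>s\<in>{ds ! i}. coeff (M $$ (i, j)) s * X i (c + s))"
        using c by (intro sum.mono_neutral_right) (auto simp: X_def)
      finally show ?thesis by (auto simp: X_def)
    qed
    then show ?thesis using w j by (cases "c = k - 1") simp_all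
  qed
  then have "X i (k - 1 + ds ! i) = 0"
    using rank k i unfolding trimmed_sylvester_full_rank_iff[OF M ds] by fastforce
  then show "w i = 0" by (simp add: X_def)
qed

text \<open>A right inverse of \<open>T_k\<close> has a column for the constant coefficient of row
  \<open>h\<close>. Its \<open>k\<close> blocks, read as coefficients, form a polynomial vector
  \<open>v\<close> with \<open>M v = e_h\<close>.\<close>

lemma trimmed_full_rank_imp_right_inverse:
  fixes M :: "'a::field poly mat"
  assumes M: "M \<in> poly_mat_space ds n" and ds: "ds \<noteq> []" and k: "1 \<le> k"
    and rank: "mat_rank (trimmed_sylvester ds k M) = k * length ds + sum_list ds"
  obtains N where "\<And>i h. i < length ds \<Longrightarrow> h < length ds \<Longrightarrow>
    (\<Sum>j<length ds + n. M $$ (i, j) * N j h) = (if i = h then 1 else 0)"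
proof -
  let ?T = "trimmed_sylvester ds k M" and ?m = "length ds" and ?q = "length ds + n"
  let ?r = "k * length ds + sum_list ds"
  have T: "?T \<in> carrier_mat ?r (k * ?q)" by (rule trimmed_sylvester_carrier[OF M ds])
  then obtain B where B: "B \<in> carrier_mat (k * ?q) ?r" "?T * B = 1\<^sub>m ?r"
    using mat_rank_eq_dim_row_imp_right_inverse[OF T] rank by auto
  define b where "b h = col B (trim_index ds k h 0)" for h
  define N where "N j h = (\<Sum>c<k. monom (b h $ (c * ?q + j)) c)" for j h
  have "(\<Sum>j<?q. M $$ (i, j) * N j h) = (if i = h then 1 else 0)" if i: "i < ?m" and h: "h < ?m" for i h
  proof (rule poly_eqI)
    fix t
    have bc: "b h \<in> carrier_vec (k * ?q)" using B(1) by (metis b_def carrier_matD(1) col_dim)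
    have co: "coeff (\<Sum>j<?q. M $$ (i, j) * N j h) t =
        (\<Sum>c<k. \<Sum>j<?q. (if c \<le> t then coeff (M $$ (i, j)) (t - c) else 0) * b h $ (c * ?q + j))"
      unfolding N_def coeff_sum sum_distrib_left
      by (subst sum.swap) (intro sum.cong refl; simp add: coeff_monom_mult mult.commute[of "M $$ _"])
    show "coeff (\<Sum>j<?q. M $$ (i, j) * N j h) t = coeff (if i = h then 1 else 0) t"
    proof (cases "t < k + ds ! i")
      case True
      have h0: "0 < k + ds ! h" using k by simp
      have "coeff (\<Sum>j<?q. M $$ (i, j) * N j h) t = (?T *\<^sub>v b h) $ trim_index ds k i t"
        unfolding co trimmed_sylvester_mult_vec_index[OF M ds i True bc] ..
      also have "?T *\<^sub>v b h = unit_vec ?r (trim_index ds k h 0)"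
        using col_mult2[OF T B(1) trim_index_less[OF ds h h0]] B(2) trim_index_less[OF ds h h0]
        by (simp add: b_def)
      also have "unit_vec ?r (trim_index ds k h 0) $ trim_index ds k i t =
          (if trim_index ds k i t = trim_index ds k h 0 then 1 else 0)"
        using trim_index_less[OF ds i True] trim_index_less[OF ds h h0] by (simp add: unit_vec_def)
      also have "trim_index ds k i t = trim_index ds k h 0 \<longleftrightarrow> i = h \<and> t = 0"
        using trim_index_inject[OF ds i True h h0] by auto
      finally show ?thesis by auto
    next
      \<comment> \<open>Such \<open>t\<close> exceeds the degree of every product, since the columns
        of \<open>N\<close> have degree below \<open>k\<close>.\<close>
      case False
      have "coeff (\<Sum>j<?q. M $$ (i, j) * N j h) t = 0"
        unfolding co
      proof (intro sum.neutral ballI)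
        fix c j assume "c \<in> {..<k}" "j \<in> {..<?q}"
        then have "degree (M $$ (i, j)) \<le> ds ! i" "c < k" using M i by (auto simp: poly_mat_space_def)
        then show "(if c \<le> t then coeff (M $$ (i, j)) (t - c) else 0) * b h $ (c * ?q + j) = 0"
          using False by (auto simp: coeff_eq_0)
      qed
      then show ?thesis using False k by auto
    qed
  qed
  then show thesis by (rule that)
qed

lemma trimmed_full_rank_imp_minimal_basis:
  fixes M :: "'a::field poly mat"
  assumes M: "M \<in> poly_mat_space ds n" and ds: "ds \<noteq> []" and n: "0 < n" and k: "1 \<le> k"
    and rank: "mat_rank (trimmed_sylvester ds k M) = k * length ds + sum_list ds"
  shows "minimal_basis M \<and> mat_rank (leading_row_coeff_mat ds M) = length ds"
proof -
  note lead = trimmed_full_rank_imp_leading[OF M ds k rank]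
  obtain N where "\<And>i h. i < length ds \<Longrightarrow> h < length ds \<Longrightarrow>
      (\<Sum>j<length ds + n. M $$ (i, j) * N j h) = (if i = h then 1 else 0)"
    using trimmed_full_rank_imp_right_inverse[OF M ds k rank] by blast
  then have "minimal_basis M" by (rule minimal_basisI[OF M n lead])
  then show ?thesis using lead leading_row_coeff_mat_full_rank_iff[OF M] by simp
qed

text \<open>It remains to invert \<open>M\<close> up to a nonzero polynomial. With \<open>B\<close>
  a constant right inverse of the leading matrix, \<open>C = M B\<close> has leading row-wise
  coefficient matrix \<open>I\<close> and hence nonzero determinant. So \<open>B\<close> times the
  adjugate of \<open>C\<close> is a right inverse up to \<open>det C\<close>.\<close>

lemma minimal_basis_imp_trimmed_full_rank:
  fixes M :: "'a::field poly mat"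
  assumes M: "M \<in> poly_mat_space ds n" and ds: "ds \<noteq> []" and mb: "minimal_basis M"
    and rank: "mat_rank (leading_row_coeff_mat ds M) = length ds"
  shows "\<exists>k\<ge>1. mat_rank (trimmed_sylvester ds k M) = k * length ds + sum_list ds"
proof -
  define m where "m = length ds"
  define q where "q = m + n"
  have dims: "dim_row M = m" "dim_col M = q"
    and deg: "\<And>i j. i < m \<Longrightarrow> j < q \<Longrightarrow> degree (M $$ (i, j)) \<le> ds ! i"
    using M by (auto simp: poly_mat_space_def m_def q_def)
  have lead: "lin_indep_family m q (\<lambda>i j. coeff (M $$ (i, j)) (ds ! i))"
    using rank leading_row_coeff_mat_full_rank_iff[OF M] by (simp add: m_def q_def)
  let ?L = "leading_row_coeff_mat ds M"
  have L: "?L \<in> carrier_mat m q" by (simp add: leading_row_coeff_mat_def dims)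
  obtain B where B: "B \<in> carrier_mat q m" "?L * B = 1\<^sub>m m"
    using mat_rank_eq_dim_row_imp_right_inverse[OF L] rank L by (auto simp: m_def)
  have LB: "(\<Sum>j<q. coeff (M $$ (i, j)) (ds ! i) * B $$ (j, b)) = (if i = b then 1 else 0)"
    if "i < m" "b < m" for i b
  proof -
    have "(?L * B) $$ (i, b) = (\<Sum>j<q. coeff (M $$ (i, j)) (ds ! i) * B $$ (j, b))"
      using that B(1) L by (simp add: leading_row_coeff_mat_def dims scalar_prod_def atLeast0LessThan)
    then show ?thesis using B(2) that by simp
  qed
  define C where "C i b = (\<Sum>j<q. M $$ (i, j) * [:B $$ (j, b):])" for i b
  have "lin_indep_family m m (\<lambda>i b. coeff (C i b) (ds ! i))"
  proof -
    have "coeff (C i b) (ds ! i) = (if i = b then 1 else 0)" if "i < m" "b < m" for i b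
      using LB[OF that] by (simp add: C_def coeff_sum mult.commute)
    then have "(\<Sum>i<m. w i * coeff (C i b) (ds ! i)) = w b" if "b < m" for w b
      using that by (simp add: if_distrib[of "(*) _"] cong: if_cong)
    then show ?thesis unfolding lin_indep_family_def by simp
  qed
  moreover have "degree (C i b) \<le> ds ! i" if "i < m" "b < m" for i b
    unfolding C_def using deg[OF that(1)]
    by (intro degree_sum_le) (auto intro: order_trans[OF degree_smult_le])
  ultimately have indC: "lin_indep_family m m C"
    by (intro lin_indep_family_leading_coeffs[where d = "\<lambda>i. ds ! i"]) auto
  define CM where "CM = mat m m (\<lambda>(i, b). C i b)"
  have CM: "CM \<in> carrier_mat m m" by (simp add: CM_def)
  have "mat m m (\<lambda>(j, i). C i j) = CM\<^sup>T" by (rule eq_matI) (auto simp: CM_def)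
  then have det: "det CM \<noteq> 0" using lin_indep_family_det_neq_0[OF indC] det_transpose[OF CM] by simp
  have adj: "(\<Sum>b<m. C i b * adj_mat CM $$ (b, h)) = (if i = h then det CM else 0)"
    if "i < m" "h < m" for i h
  proof -
    have *: "(CM * adj_mat CM) $$ (i, h) = (\<Sum>b<m. C i b * adj_mat CM $$ (b, h))"
      using that adj_mat(1)[OF CM] CM by (simp add: CM_def scalar_prod_def atLeast0LessThan)
    show ?thesis unfolding *[symmetric] adj_mat(2)[OF CM] using that by simp
  qed
  \<comment> \<open>The monomial factor only raises the degree of \<open>p\<close>, so that it
    dominates all row degrees.\<close>
  define e where "e = monom (1::'a) (Max (set ds))"
  define p where "p = det CM * e"
  define N where "N j h = (\<Sum>b<m. [:B $$ (j, b):] * adj_mat CM $$ (b, h)) * e" for j h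
  have inv: "(\<Sum>j<q. M $$ (i, j) * N j h) = (if i = h then p else 0)" if "i < m" "h < m" for i h
  proof -
    have "(\<Sum>j<q. M $$ (i, j) * N j h) =
        (\<Sum>j<q. \<Sum>b<m. M $$ (i, j) * [:B $$ (j, b):] * adj_mat CM $$ (b, h) * e)"
      by (simp only: N_def sum_distrib_left sum_distrib_right mult.assoc)
    also have "\<dots> = (\<Sum>b<m. C i b * adj_mat CM $$ (b, h)) * e"
      by (subst sum.swap) (simp only: C_def sum_distrib_right)
    finally show ?thesis using adj[OF that] by (simp add: p_def)
  qed
  have e: "e \<noteq> 0" by (simp add: e_def)
  have p: "p \<noteq> 0" using det e by (simp add: p_def)
  have dD: "ds ! i \<le> degree p" if "i < m" for i
  proof -
    have "ds ! i \<le> Max (set ds)" using that by (simp add: m_def)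
    also have "\<dots> \<le> degree p" using det by (simp add: p_def degree_mult_eq e_def degree_monom_eq)
    finally show ?thesis .
  qed
  define L where "L = (\<Sum>j<q. \<Sum>h<m. degree (N j h))"
  have degN: "degree (N j h) \<le> L" if "j < q" "h < m" for j h
  proof -
    have "degree (N j h) \<le> (\<Sum>h<m. degree (N j h))" using that by (intro member_le_sum) auto
    also have "\<dots> \<le> L" unfolding L_def using that by (intro member_le_sum) auto
    finally show ?thesis .
  qed
  \<comment> \<open>The summand 1 guarantees \<open>k \<ge> 1\<close>.\<close>
  define k where "k = 2 * degree p + L + 1"
  have "mat_rank (trimmed_sylvester ds k M) = k * length ds + sum_list ds"
    unfolding trimmed_sylvester_full_rank_iff[OF M ds]
  proof (intro allI impI)
    fix X i t
    assume X: "\<forall>c<k. \<forall>j<length ds + n. (\<Sum>i<length ds. shift_act (M $$ (i, j)) (X i) c) = 0"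
      and it: "i < length ds" "t < k + ds ! i"
    show "X i t = 0"
    proof (rule sylvester_left_kernel_trivial[where f = "\<lambda>i j. M $$ (i, j)" and d = "\<lambda>i. ds ! i" and x = X and k = k,
          OF deg lead _ inv p dD degN])
      show "p dvd w i" if "p \<noteq> 0" "\<And>j. j < q \<Longrightarrow> p dvd (\<Sum>i<m. w i * M $$ (i, j))" "i < m" for p w i
        using minimal_basis_saturated[OF mb that(1), of w i] that dims by simp
    qed (use X it in \<open>auto simp: k_def m_def q_def\<close>)
  qed
  then show ?thesis by (intro exI[of _ k]) (simp add: k_def)
qed

section \<open>Adjoints over the real and complex numbers\<close>

lemma mat_adjoint_carrier: "A \<in> carrier_mat n nc \<Longrightarrow> mat_adjoint A \<in> carrier_mat nc n"
  by (auto simp: mat_adjoint_def mat_of_rows_def)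

lemma mat_adjoint_index:
  assumes "A \<in> carrier_mat n nc" "i < nc" "j < n"
  shows "mat_adjoint A $$ (i, j) = conjugate (A $$ (j, i))"
  using assms by (simp add: mat_adjoint_def mat_of_rows_def)

text \<open>
  \<open>inner_mult_conjugate\<close> is what makes the conjugate transpose the adjoint with respect to the
  real inner product; it lets \<open>\<real>\<close> and \<open>\<complex>\<close> be treated uniformly.
\<close>

class inner_conjugatable_field = real_normed_field + real_inner + conjugatable_field +
  assumes inner_mult_conjugate: "inner (x * z) y = inner x (conjugate z * y)"

instance real :: inner_conjugatable_field
  by standard simp

instance complex :: inner_conjugatable_field
  by standard (simp add: inner_complex_def conjugate_complex_def algebra_simps)

lemma conjugate_real_of_real [simp]: "conjugate (of_real r :: 'a::inner_conjugatable_field) = of_real r"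
proof -
  have "inner x (conjugate (of_real r) - of_real r) = 0" for x :: 'a
  proof -
    have "inner x (conjugate (of_real r)) = inner (x * of_real r) 1"
      using inner_mult_conjugate[of x "of_real r" 1] by simp
    also have "x * of_real r = r *\<^sub>R x" by (simp add: scaleR_conv_of_real)
    also have "inner (r *\<^sub>R x) 1 = inner x (of_real r)" by (simp add: of_real_def)
    finally show ?thesis by (simp add: inner_diff_right)
  qed
  from this[of "conjugate (of_real r) - of_real r"] show ?thesis by simp
qed

text \<open>Over the complex numbers this is the real part of the Hermitian inner product, which
  suffices for norms and adjoints.\<close>

definition vinner :: "'a::real_inner vec \<Rightarrow> 'a vec \<Rightarrow> real" where
  "vinner x y = (\<Sum>i<dim_vec x. inner (x $ i) (y $ i))"

definition vnorm :: "'a::real_normed_vector vec \<Rightarrow> real" where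
  "vnorm x = L2_set (\<lambda>i. norm (x $ i)) {..<dim_vec x}"

lemma vnorm_nonneg [simp]: "0 \<le> vnorm x"
  by (simp add: vnorm_def)

lemma vnorm_power2: "(vnorm x)\<^sup>2 = vinner x x"
  by (simp add: vnorm_def L2_set_def vinner_def power2_norm_eq_inner sum_nonneg)

lemma vinner_add_left: "x \<in> carrier_vec n \<Longrightarrow> y \<in> carrier_vec n \<Longrightarrow> vinner (x + y) z = vinner x z + vinner y z"
  by (simp add: vinner_def inner_add_left sum.distrib)

lemma vinner_add_right: "y \<in> carrier_vec n \<Longrightarrow> x \<in> carrier_vec n \<Longrightarrow> z \<in> carrier_vec n \<Longrightarrow>
    vinner z (x + y) = vinner z x + vinner z y"
  by (simp add: vinner_def inner_add_right sum.distrib)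

lemma vinner_commute: "x \<in> carrier_vec n \<Longrightarrow> y \<in> carrier_vec n \<Longrightarrow> vinner x y = vinner y x"
  by (simp add: vinner_def inner_commute)

lemma vinner_smult_left:
  "vinner (of_real r \<cdot>\<^sub>v x) y = r * vinner x (y :: 'a::inner_conjugatable_field vec)"
  by (simp add: vinner_def sum_distrib_left scaleR_conv_of_real[symmetric])

lemma vinner_smult_right:
  "x \<in> carrier_vec n \<Longrightarrow> y \<in> carrier_vec n \<Longrightarrow>
    vinner x (of_real r \<cdot>\<^sub>v y) = r * vinner x (y :: 'a::inner_conjugatable_field vec)"
  by (simp add: vinner_def sum_distrib_left scaleR_conv_of_real[symmetric])

lemma vinner_adjoint:
  fixes A :: "'a::inner_conjugatable_field mat"
  assumes A: "A \<in> carrier_mat n nc" and x: "x \<in> carrier_vec nc" and y: "y \<in> carrier_vec n"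
  shows "vinner (A *\<^sub>v x) y = vinner x (mat_adjoint A *\<^sub>v y)"
proof -
  have "vinner (A *\<^sub>v x) y = (\<Sum>i<n. \<Sum>j<nc. inner (A $$ (i, j) * x $ j) (y $ i))"
    using A x y by (simp add: vinner_def scalar_prod_def inner_sum_left atLeast0LessThan)
  also have "\<dots> = (\<Sum>j<nc. \<Sum>i<n. inner (x $ j) (conjugate (A $$ (i, j)) * y $ i))"
    by (subst sum.swap) (simp add: mult.commute[of "A $$ _"] inner_mult_conjugate)
  also have "\<dots> = vinner x (mat_adjoint A *\<^sub>v y)"
    using mat_adjoint_carrier[OF A] A x y
    by (simp add: vinner_def scalar_prod_def inner_sum_right atLeast0LessThan mat_adjoint_index[OF A])
  finally show ?thesis .
qed

lemma vinner_le: "x \<in> carrier_vec n \<Longrightarrow> y \<in> carrier_vec n \<Longrightarrow> vinner x y \<le> vnorm x * vnorm y"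
proof -
  assume "x \<in> carrier_vec n" "y \<in> carrier_vec n"
  then have d: "dim_vec x = n" "dim_vec y = n" by auto
  have "vinner x y \<le> (\<Sum>i<n. \<bar>norm (x $ i)\<bar> * \<bar>norm (y $ i)\<bar>)"
    unfolding vinner_def d by (intro sum_mono) (simp add: norm_cauchy_schwarz)
  also have "\<dots> \<le> vnorm x * vnorm y" unfolding vnorm_def d by (rule L2_set_mult_ineq)
  finally show ?thesis .
qed

lemma vnorm_eq_0: "x \<in> carrier_vec n \<Longrightarrow> vnorm x = 0 \<longleftrightarrow> x = 0\<^sub>v n"
  by (auto simp: vnorm_def L2_set_eq_0_iff vec_eq_iff)

lemma vnorm_mult_vec_le:
  fixes A :: "'a::real_normed_field mat"
  assumes A: "A \<in> carrier_mat n nc" and x: "x \<in> carrier_vec nc"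
  shows "vnorm (A *\<^sub>v x) \<le> (\<Sum>i<n. \<Sum>j<nc. norm (A $$ (i, j))) * vnorm x"
proof -
  have comp: "norm (x $ j) \<le> vnorm x" if "j < nc" for j
    unfolding vnorm_def using x that by (intro member_le_L2_set) auto
  have "vnorm (A *\<^sub>v x) \<le> (\<Sum>i<n. norm ((A *\<^sub>v x) $ i))"
    unfolding vnorm_def using A by (intro order_trans[OF L2_set_le_sum]) auto
  also have "\<dots> \<le> (\<Sum>i<n. \<Sum>j<nc. norm (A $$ (i, j)) * vnorm x)"
  proof (intro sum_mono)
    fix i assume "i \<in> {..<n}"
    then have "norm ((A *\<^sub>v x) $ i) = norm (\<Sum>j<nc. A $$ (i, j) * x $ j)"
      using A x by (simp add: scalar_prod_def atLeast0LessThan)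
    also have "\<dots> \<le> (\<Sum>j<nc. norm (A $$ (i, j)) * norm (x $ j))"
      by (rule order_trans[OF norm_sum]) (simp add: norm_mult)
    also have "\<dots> \<le> (\<Sum>j<nc. norm (A $$ (i, j)) * vnorm x)"
      by (intro sum_mono mult_left_mono) (auto simp: comp)
    finally show "norm ((A *\<^sub>v x) $ i) \<le> (\<Sum>j<nc. norm (A $$ (i, j)) * vnorm x)" .
  qed
  finally show ?thesis by (simp add: sum_distrib_right)
qed

text \<open>For \<open>y = H x\<close>, one descent step gives
  \<open>vinner y y \<le> C * vinner y x\<close>, and inverting \<open>H\<close> gives
  \<open>vnorm x \<le> D * vnorm y\<close>. Combining the two bounds the quadratic form from below
  without eigenvalues or compactness.\<close>

lemma selfadjoint_psd_coercive:
  fixes H :: "'a::inner_conjugatable_field mat"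
  assumes H: "H \<in> carrier_mat n n" 
    and sa: "\<And>x y. x \<in> carrier_vec n \<Longrightarrow> y \<in> carrier_vec n \<Longrightarrow>
      vinner (H *\<^sub>v x) y = vinner x (H *\<^sub>v y)"
    and det: "det H \<noteq> 0"
    and psd: "\<And>x. x \<in> carrier_vec n \<Longrightarrow> 0 \<le> vinner (H *\<^sub>v x) x"
  shows "\<exists>c>0. \<forall>x\<in>carrier_vec n. c * vinner x x \<le> vinner (H *\<^sub>v x) x"
proof -
  define K where "K = (1 / det H) \<cdot>\<^sub>m adj_mat H"
  have K: "K \<in> carrier_mat n n" using adj_mat(1)[OF H] by (simp add: K_def)
  have KH: "K * H = 1\<^sub>m n"
  proof -
    have "K * H = (1 / det H) \<cdot>\<^sub>m (adj_mat H * H)"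
      unfolding K_def by (rule mult_smult_assoc_mat[OF adj_mat(1)[OF H] H])
    then show ?thesis using det unfolding adj_mat(3)[OF H] by (intro eq_matI) auto
  qed
  \<comment> \<open>Entrywise sums bound the operator norms of \<open>H\<close> and its inverse
    \<open>K\<close>; adding 1 makes the constants positive.\<close>
  define C where "C = (\<Sum>i<n. \<Sum>j<n. norm (H $$ (i, j))) + 1"
  define D where "D = (\<Sum>i<n. \<Sum>j<n. norm (K $$ (i, j))) + 1"
  have C: "0 < C" and D: "0 < D" by (auto simp: C_def D_def intro!: add_nonneg_pos sum_nonneg)
  have "1 / (C * D\<^sup>2) * vinner x x \<le> vinner (H *\<^sub>v x) x" if x: "x \<in> carrier_vec n" for x
  proof -
    define y where "y = H *\<^sub>v x"
    have y: "y \<in> carrier_vec n" using H x by (simp add: y_def)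
    have Hy: "H *\<^sub>v y \<in> carrier_vec n" using H y by simp
    have "x = K *\<^sub>v y"
      unfolding y_def using KH x by (subst assoc_mult_mat_vec[OF K H x, symmetric]) simp
    then have "vnorm x \<le> (D - 1) * vnorm y" using vnorm_mult_vec_le[OF K y] by (simp add: D_def)
    also have "\<dots> \<le> D * vnorm y" by (intro mult_right_mono) auto
    finally have "(vnorm x)\<^sup>2 \<le> (D * vnorm y)\<^sup>2" by (intro power_mono) auto
    then have xy: "vinner x x \<le> D\<^sup>2 * vinner y y" by (simp add: power_mult_distrib vnorm_power2)
    have "vinner (H *\<^sub>v y) y \<le> vnorm (H *\<^sub>v y) * vnorm y" by (rule vinner_le[OF Hy y])
    also have "\<dots> \<le> (C * vnorm y) * vnorm y"
    proof (intro mult_right_mono)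
      have "vnorm (H *\<^sub>v y) \<le> (C - 1) * vnorm y" using vnorm_mult_vec_le[OF H y] by (simp add: C_def)
      also have "\<dots> \<le> C * vnorm y" by (intro mult_right_mono) auto
      finally show "vnorm (H *\<^sub>v y) \<le> C * vnorm y" .
    qed simp
    finally have Hyy: "vinner (H *\<^sub>v y) y \<le> C * vinner y y"
      by (simp add: vnorm_power2[symmetric] power2_eq_square mult.assoc)
    text \<open>Expand \<open>0 \<le> \<langle>H z, z\<rangle>\<close> for \<open>z = x - y / C\<close>, a point of steepest descent from \<open>x\<close>.\<close>
    define s where "s = of_real (- 1 / C) \<cdot>\<^sub>v y"
    have s: "s \<in> carrier_vec n" using y by (simp add: s_def)
    have Hs: "H *\<^sub>v s = of_real (- 1 / C) \<cdot>\<^sub>v (H *\<^sub>v y)"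
      unfolding s_def by (rule mult_mat_vec[OF H y])
    have "vinner (H *\<^sub>v (x + s)) (x + s) =
        vinner y x + vinner y s + (vinner (H *\<^sub>v s) x + vinner (H *\<^sub>v s) s)"
      using H x s y
      by (simp add: mult_add_distrib_mat_vec[OF H x s] y_def[symmetric]
          vinner_add_left[of _ n] vinner_add_right[of _ n])
    also have "vinner (H *\<^sub>v s) x = vinner s y"
      using sa[OF s x] by (simp add: y_def)
    also have "vinner y s = - (1 / C) * vinner y y"
      unfolding s_def by (subst vinner_smult_right[OF y y]) simp
    also have "vinner s y = - (1 / C) * vinner y y"
      unfolding s_def by (subst vinner_smult_left) simp
    also have "vinner (H *\<^sub>v s) s = (1 / C)\<^sup>2 * vinner (H *\<^sub>v y) y"
      unfolding Hs by (subst vinner_smult_left, unfold s_def, subst vinner_smult_right[OF Hy y])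
        (simp add: power2_eq_square)
    finally have "0 \<le> vinner y x - 2 / C * vinner y y + (1 / C)\<^sup>2 * vinner (H *\<^sub>v y) y"
      using psd[of "x + s"] x s by simp
    also have "(1 / C)\<^sup>2 * vinner (H *\<^sub>v y) y \<le> (1 / C)\<^sup>2 * (C * vinner y y)"
      using Hyy by (intro mult_left_mono) auto
    also have "(1 / C)\<^sup>2 * (C * vinner y y) = 1 / C * vinner y y"
      using C by (simp add: power2_eq_square field_simps)
    finally have "1 / C * vinner y y \<le> vinner y x" by (simp add: algebra_simps)
    moreover have "1 / (C * D\<^sup>2) * vinner x x \<le> 1 / (C * D\<^sup>2) * (D\<^sup>2 * vinner y y)"
      using xy C D by (intro mult_left_mono) auto
    moreover have "1 / (C * D\<^sup>2) * (D\<^sup>2 * vinner y y) = 1 / C * vinner y y"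
      using D by simp
    ultimately show ?thesis by (simp add: y_def)
  qed
  moreover have "0 < 1 / (C * D\<^sup>2)" using C D by simp
  ultimately show ?thesis by blast
qed

section \<open>Smallest singular value\<close>

text \<open>Cauchy-Schwarz applied to \<open>G x\<close> and \<open>- x\<close>. The bound
  guarantees that the Rayleigh quotients have an infimum.\<close>

lemma vinner_mult_vec_ge:
  fixes G :: "'a::inner_conjugatable_field mat"
  assumes G: "G \<in> carrier_mat n n" and x: "x \<in> carrier_vec n"
  shows "- (\<Sum>i<n. \<Sum>j<n. norm (G $$ (i, j))) * vinner x x \<le> vinner (G *\<^sub>v x) x"
proof -
  have Gx: "G *\<^sub>v x \<in> carrier_vec n" using G x by simp
  have x': "of_real (- 1) \<cdot>\<^sub>v x \<in> carrier_vec n" using x by simp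
  have nx: "vnorm (of_real (- 1) \<cdot>\<^sub>v x) = vnorm x" by (auto simp: vnorm_def intro!: L2_set_cong)
  have "- vinner (G *\<^sub>v x) x = vinner (G *\<^sub>v x) (of_real (- 1) \<cdot>\<^sub>v x)"
    by (subst vinner_smult_right[OF Gx x]) simp
  also have "\<dots> \<le> vnorm (G *\<^sub>v x) * vnorm x" using vinner_le[OF Gx x'] by (simp only: nx)
  also have "\<dots> \<le> (\<Sum>i<n. \<Sum>j<n. norm (G $$ (i, j))) * vnorm x * vnorm x"
    using vnorm_mult_vec_le[OF G x] by (intro mult_right_mono) auto
  finally show ?thesis by (simp add: vnorm_power2[symmetric] power2_eq_square mult.assoc)
qed

text \<open>Let \<mu> be the infimum of the Rayleigh quotient, so that \<open>G - \<mu> I\<close> is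
  positive semidefinite. If it were nonsingular, coercivity would raise the infimum by some
  \<open>c > 0\<close>. Hence it is singular and its kernel contains an eigenvector.\<close>

lemma selfadjoint_least_eigenvalue:
  fixes G :: "'a::inner_conjugatable_field mat"
  assumes G: "G \<in> carrier_mat n n" and n: "0 < n"
    and sa: "\<And>x y. x \<in> carrier_vec n \<Longrightarrow> y \<in> carrier_vec n \<Longrightarrow>
      vinner (G *\<^sub>v x) y = vinner x (G *\<^sub>v y)"
  shows "\<exists>\<mu> v. eigenvector G v (of_real \<mu>) \<and>
    (\<forall>x\<in>carrier_vec n. \<mu> * vinner x x \<le> vinner (G *\<^sub>v x) x)"
proof -
  define Q where "Q = (\<lambda>x. vinner (G *\<^sub>v x) x / vinner x x) ` (carrier_vec n - {0\<^sub>v n})"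
  define \<mu> where "\<mu> = Inf Q"
  have pos: "0 < vinner x x" if "x \<in> carrier_vec n" "x \<noteq> 0\<^sub>v n" for x :: "'a vec"
    using vnorm_eq_0[OF that(1)] that(2) vnorm_nonneg[of x]
    unfolding vnorm_power2[symmetric] by simp
  have ne: "Q \<noteq> {}"
  proof -
    have "unit_vec n 0 \<noteq> (0\<^sub>v n :: 'a vec)" using n by (metis index_unit_vec(1) index_zero_vec(1) one_neq_zero)
    then have "unit_vec n 0 \<in> carrier_vec n - {0\<^sub>v n :: 'a vec}" by simp
    then show ?thesis unfolding Q_def by blast
  qed
  define B where "B = (\<Sum>i<n. \<Sum>j<n. norm (G $$ (i, j)))"
  have "- B \<le> r" if "r \<in> Q" for r
  proof -
    from that obtain x where x: "x \<in> carrier_vec n" "x \<noteq> 0\<^sub>v n" "r = vinner (G *\<^sub>v x) x / vinner x x"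
      by (auto simp: Q_def)
    then show ?thesis
      using vinner_mult_vec_ge[OF G x(1)] pos[OF x(1,2)] by (simp add: B_def pos_le_divide_eq)
  qed
  then have bdd: "bdd_below Q" by (intro bdd_belowI) auto
  have low: "\<mu> * vinner x x \<le> vinner (G *\<^sub>v x) x" if x: "x \<in> carrier_vec n" for x
  proof (cases "x = 0\<^sub>v n")
    case True
    then have "vinner x x = 0" "vinner (G *\<^sub>v x) x = 0" using G by (simp_all add: vinner_def)
    then show ?thesis by simp
  next
    case False
    then have "vinner (G *\<^sub>v x) x / vinner x x \<in> Q" using x by (auto simp: Q_def)
    then have "\<mu> \<le> vinner (G *\<^sub>v x) x / vinner x x" unfolding \<mu>_def using bdd by (rule cInf_lower)
    then show ?thesis using pos[OF x False] by (simp add: pos_le_divide_eq)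
  qed
  define H where "H = G + of_real (- \<mu>) \<cdot>\<^sub>m 1\<^sub>m n"
  have H: "H \<in> carrier_mat n n" using G by (simp add: H_def)
  have Hx: "H *\<^sub>v x = G *\<^sub>v x + of_real (- \<mu>) \<cdot>\<^sub>v x" if x: "x \<in> carrier_vec n" for x
  proof (rule eq_vecI)
    fix i assume "i < dim_vec (G *\<^sub>v x + of_real (- \<mu>) \<cdot>\<^sub>v x)"
    then have i: "i < n" using x by simp
    have "(H *\<^sub>v x) $ i = (\<Sum>j<n. H $$ (i, j) * x $ j)"
      using x i H by (simp add: scalar_prod_def atLeast0LessThan)
    also have "\<dots> = (\<Sum>j<n. G $$ (i, j) * x $ j + (if i = j then of_real (- \<mu>) * x $ j else 0))"
      using G i by (intro sum.cong refl) (simp add: H_def algebra_simps)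
    also have "\<dots> = (\<Sum>j<n. G $$ (i, j) * x $ j) + of_real (- \<mu>) * x $ i"
      using i by (simp add: sum.distrib)
    finally show "(H *\<^sub>v x) $ i = (G *\<^sub>v x + of_real (- \<mu>) \<cdot>\<^sub>v x) $ i"
      using G x i by (simp add: scalar_prod_def atLeast0LessThan)
  qed (use G H x in auto)
  have Hin: "vinner (H *\<^sub>v x) y = vinner (G *\<^sub>v x) y - \<mu> * vinner x y"
    if "x \<in> carrier_vec n" "y \<in> carrier_vec n" for x y
    using that G by (simp add: Hx vinner_add_left[of _ n] vinner_smult_left del: of_real_minus)
  have "det H = 0"
  proof (rule ccontr)
    assume "det H \<noteq> 0"
    then obtain c where c: "c > 0" "\<And>x. x \<in> carrier_vec n \<Longrightarrow> c * vinner x x \<le> vinner (H *\<^sub>v x) x"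
    proof -
      have "\<exists>c>0. \<forall>x\<in>carrier_vec n. c * vinner x x \<le> vinner (H *\<^sub>v x) x"
      proof (rule selfadjoint_psd_coercive[OF H])
        fix x y :: "'a vec" assume x: "x \<in> carrier_vec n" and y: "y \<in> carrier_vec n"
        have "vinner x (H *\<^sub>v y) = vinner (H *\<^sub>v y) x" using x y H by (intro vinner_commute[of _ n]) auto
        also have "\<dots> = vinner (G *\<^sub>v y) x - \<mu> * vinner y x" by (rule Hin[OF y x])
        also have "vinner (G *\<^sub>v y) x = vinner (G *\<^sub>v x) y"
          unfolding sa[OF x y] using G x y by (intro vinner_commute[of _ n]) auto
        also have "vinner y x = vinner x y" by (rule vinner_commute[OF y x])
        also have "vinner (G *\<^sub>v x) y - \<mu> * vinner x y = vinner (H *\<^sub>v x) y" by (rule Hin[OF x y, symmetric])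
        finally show "vinner (H *\<^sub>v x) y = vinner x (H *\<^sub>v y)" ..
      next
        fix x :: "'a vec" assume "x \<in> carrier_vec n"
        then show "0 \<le> vinner (H *\<^sub>v x) x" using low[of x] by (simp add: Hin)
      qed fact
      then show thesis using that by blast
    qed
    have "\<mu> + c \<le> Inf Q"
    proof (rule cInf_greatest[OF ne])
      fix r assume "r \<in> Q"
      then obtain x where x: "x \<in> carrier_vec n" "x \<noteq> 0\<^sub>v n" "r = vinner (G *\<^sub>v x) x / vinner x x"
        by (auto simp: Q_def)
      have "(\<mu> + c) * vinner x x \<le> vinner (G *\<^sub>v x) x"
        using c(2)[OF x(1)] Hin[OF x(1) x(1)] by (simp add: algebra_simps)
      then show "\<mu> + c \<le> r" using pos[OF x(1,2)] by (simp add: x(3) pos_le_divide_eq)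
    qed
    then show False using c(1) by (simp add: \<mu>_def)
  qed
  then obtain v where v: "v \<in> carrier_vec n" "v \<noteq> 0\<^sub>v n" "H *\<^sub>v v = 0\<^sub>v n"
    using det_0_iff_vec_prod_zero[OF H] by blast
  have "(G *\<^sub>v v) $ i = (of_real \<mu> \<cdot>\<^sub>v v) $ i" if i: "i < n" for i
  proof -
    have "(G *\<^sub>v v + of_real (- \<mu>) \<cdot>\<^sub>v v) $ i = 0" using v(3) i unfolding Hx[OF v(1)] by simp
    then show ?thesis using v(1) G i by simp
  qed
  then have "G *\<^sub>v v = of_real \<mu> \<cdot>\<^sub>v v" using G v(1) by (intro eq_vecI) auto
  then have "eigenvector G v (of_real \<mu>)" using v G by (simp add: eigenvector_def)
  with low show ?thesis by blast
qed

text \<open>The infimum \<mu> of the Rayleigh quotient of the Gram matrix is one of its eigenvalues,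
  so the smallest singular value is at most \<open>sqrt \<mu>\<close>. The hypothesis
  \<open>split\<close> gives the list of singular values length \<open>n\<close>, so that its
  \<open>n\<close>th entry is the last one.\<close>

lemma singular_value_mult_vnorm_le:
  fixes A :: "'a::inner_conjugatable_field mat"
  assumes A: "A \<in> carrier_mat n nc" and n: "0 < n" "n \<le> nc"
    and split: "size (proots (char_poly (A * mat_adjoint A))) = n"
    and x: "x \<in> carrier_vec n"
  shows "singular_value n A * vnorm x \<le> vnorm (mat_adjoint A *\<^sub>v x)"
proof -
  define G where "G = A * mat_adjoint A"
  have A': "mat_adjoint A \<in> carrier_mat nc n" by (rule mat_adjoint_carrier[OF A])
  have G: "G \<in> carrier_mat n n" using A A' by (simp add: G_def)
  have in_G: "vinner (G *\<^sub>v x) y = vinner (mat_adjoint A *\<^sub>v x) (mat_adjoint A *\<^sub>v y)"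
    if "x \<in> carrier_vec n" "y \<in> carrier_vec n" for x y
    using that A' vinner_adjoint[OF A, of "mat_adjoint A *\<^sub>v x" y]
    unfolding G_def by (subst assoc_mult_mat_vec[OF A A']) auto
  have sa: "vinner (G *\<^sub>v x) y = vinner x (G *\<^sub>v y)"
    if x: "x \<in> carrier_vec n" and y: "y \<in> carrier_vec n" for x y
  proof -
    have "vinner x (G *\<^sub>v y) = vinner (G *\<^sub>v y) x" using x y G by (intro vinner_commute[of _ n]) auto
    also have "\<dots> = vinner (mat_adjoint A *\<^sub>v x) (mat_adjoint A *\<^sub>v y)"
      unfolding in_G[OF y x] using A' x y by (intro vinner_commute[of _ nc]) auto
    finally show ?thesis by (simp add: in_G[OF x y])
  qed
  obtain \<mu> v where ev: "eigenvector G v (of_real \<mu>)"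
    and low: "\<And>x. x \<in> carrier_vec n \<Longrightarrow> \<mu> * vinner x x \<le> vinner (G *\<^sub>v x) x"
    using selfadjoint_least_eigenvalue[OF G n(1) sa] by blast
  have v: "v \<in> carrier_vec n" "v \<noteq> 0\<^sub>v n" "G *\<^sub>v v = of_real \<mu> \<cdot>\<^sub>v v"
    using ev G by (auto simp: eigenvector_def)
  have "0 \<le> \<mu>"
  proof -
    have "0 \<le> (vnorm (mat_adjoint A *\<^sub>v v))\<^sup>2" by simp
    also have "\<dots> = \<mu> * (vnorm v)\<^sup>2"
      using in_G[OF v(1) v(1)] by (simp add: vnorm_power2 v(3) vinner_smult_left)
    finally show ?thesis
      using vnorm_eq_0[OF v(1)] v(2) by (simp add: zero_le_mult_iff)
  qed
  have "eigenvalue G (of_real \<mu>)" using ev by (auto simp: eigenvalue_def)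
  then have root: "poly (char_poly G) (of_real \<mu>) = 0" using eigenvalue_root_char_poly[OF G] by simp
  have "char_poly G \<noteq> 0" using degree_monic_char_poly[OF G] by auto
  with root have mem: "of_real \<mu> \<in># proots (char_poly G)" by simp
  define L where "L = sorted_list_of_multiset (image_mset (\<lambda>x. sqrt (norm x)) (proots (char_poly G)))"
  have "mset L = image_mset (\<lambda>x. sqrt (norm x)) (proots (char_poly G))" by (simp add: L_def)
  then have len: "length L = n" and "sqrt (norm (of_real \<mu> :: 'a)) \<in> set L"
    using split mem unfolding set_mset_mset[symmetric] G_def[symmetric]
    by (metis size_image_mset size_mset, force)
  then obtain i where i: "i < n" "L ! i = sqrt \<mu>" using \<open>0 \<le> \<mu>\<close> by (auto simp: in_set_conv_nth)
  have "sorted L" by (simp add: L_def)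
  then have "L ! 0 \<le> sqrt \<mu>" using i len by (metis le0 sorted_nth_mono)
  moreover have "singular_value n A = L ! 0"
    using A n len by (simp add: singular_value_def singular_values_def Let_def G_def[symmetric] L_def[symmetric] rev_nth)
  ultimately have sv: "singular_value n A \<le> sqrt \<mu>" by simp
  have "singular_value n A * vnorm x \<le> sqrt \<mu> * vnorm x" using sv by (intro mult_right_mono) auto
  also have "\<dots> = sqrt (\<mu> * (vnorm x)\<^sup>2)" by (simp add: real_sqrt_mult)
  also have "\<dots> \<le> sqrt ((vnorm (mat_adjoint A *\<^sub>v x))\<^sup>2)"
    using low[OF x] in_G[OF x x] by (simp add: vnorm_power2)
  finally show ?thesis by simp
qed

text \<open>All complex roots are eigenvalues of a Hermitian matrix and therefore real; a real
  polynomial with only real complex roots splits into linear factors over the reals.\<close>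

lemma size_proots_symmetric_real:
  fixes G :: "real mat"
  assumes G: "G \<in> carrier_mat n n" and sym: "\<And>i j. i < n \<Longrightarrow> j < n \<Longrightarrow> G $$ (i, j) = G $$ (j, i)"
  shows "size (proots (char_poly G)) = n"
proof -
  interpret cr: map_poly_comm_ring_hom complex_of_real ..
  let ?p = "char_poly G"
  define C where "C = map_mat complex_of_real G"
  have C: "C \<in> carrier_mat n n" using G by (simp add: C_def)
  have adj: "mat_adjoint C = C"
  proof (rule eq_matI)
    fix i j assume "i < dim_row C" "j < dim_col C"
    then have ij: "i < n" "j < n" using C by auto
    then show "mat_adjoint C $$ (i, j) = C $$ (i, j)"
      unfolding mat_adjoint_index[OF C ij] using G sym[OF ij] by (simp add: C_def)
  qed (use C mat_adjoint_carrier[OF C] in auto)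
  have real_root: "Im z = 0" if z: "poly (map_poly complex_of_real ?p) z = 0" for z
  proof -
    have "poly (char_poly C) z = 0" using z by (simp add: C_def of_real_hom.char_poly_hom[OF G])
    then obtain v where v: "v \<in> carrier_vec n" "v \<noteq> 0\<^sub>v n" "C *\<^sub>v v = z \<cdot>\<^sub>v v"
      using eigenvalue_root_char_poly[OF C] C by (auto simp: eigenvalue_def eigenvector_def)
    \<comment> \<open>As \<open>vinner\<close> is a real part, testing against \<open>\<i>\<close>
      times \<open>v\<close> extracts the imaginary part of the eigenvalue, with opposite signs on
      the two sides of the adjoint identity.\<close>
    define u where "u = \<i> \<cdot>\<^sub>v v"
    have u: "u \<in> carrier_vec n" using v by (simp add: u_def)
    have Cu: "C *\<^sub>v u = \<i> \<cdot>\<^sub>v (z \<cdot>\<^sub>v v)" unfolding u_def v(3)[symmetric] by (rule mult_mat_vec[OF C v(1)])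
    have "vinner (C *\<^sub>v v) u = vinner v (C *\<^sub>v u)" using vinner_adjoint[OF C v(1) u] adj by simp
    moreover have "vinner (C *\<^sub>v v) u = Im z * vinner v v"
      using v(1) by (simp add: v(3) u_def vinner_def sum_distrib_left inner_complex_def algebra_simps)
    moreover have "vinner v (C *\<^sub>v u) = - Im z * vinner v v"
      unfolding vinner_def sum_distrib_left using v(1)
      by (intro sum.cong) (auto simp: Cu inner_complex_def algebra_simps)
    ultimately show ?thesis
      using vnorm_eq_0[OF v(1)] v(2) by (simp add: vnorm_power2[symmetric])
  qed
  have p0: "?p \<noteq> 0" and deg: "degree ?p = n" using degree_monic_char_poly[OF G] by auto
  \<comment> \<open>Induction on the degree, splitting off one real root at a time.\<close>
  have "size (proots p) = degree p"
    if "p \<noteq> 0" "\<And>z. poly (map_poly complex_of_real p) z = 0 \<Longrightarrow> Im z = 0" for p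
    using that
  proof (induction "degree p" arbitrary: p)
    case 0
    then show ?case using size_proots_le[of p] by simp
  next
    case (Suc d)
    have "degree (map_poly complex_of_real p) = Suc d" using Suc.hyps(2) by (simp add: degree_map_poly)
    then have "\<not> constant (poly (map_poly complex_of_real p))" by (simp add: constant_degree)
    then obtain z where z: "poly (map_poly complex_of_real p) z = 0"
      using fundamental_theorem_of_algebra by blast
    then have "z = complex_of_real (Re z)" using Suc.prems(2)[OF z] by (simp add: complex_eq_iff)
    then have "complex_of_real (poly p (Re z)) = 0"
      using z by (metis of_real_hom.poly_map_poly)
    then have "poly p (Re z) = 0" by simp
    then obtain q where q: "p = [:- Re z, 1:] * q" by (auto simp: poly_eq_0_iff_dvd)
    have q0: "q \<noteq> 0" using q Suc.prems(1) by auto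
    have "degree p = Suc (degree q)" using q q0 by (simp add: degree_mult_eq del: mult_pCons_left)
    moreover have "size (proots q) = degree q"
    proof (rule Suc.hyps(1))
      show "d = degree q" using Suc.hyps(2) \<open>degree p = Suc (degree q)\<close> by simp
      fix y assume "poly (map_poly complex_of_real q) y = 0"
      then have "poly (map_poly complex_of_real p) y = 0"
        unfolding q by (simp only: cr.hom_mult poly_mult mult_zero_right)
      then show "Im y = 0" by (rule Suc.prems(2))
    qed (rule q0)
    moreover have "proots p = proots [:- Re z, 1:] + proots q" unfolding q using q0 by (intro proots_mult) auto
    ultimately show ?case by simp
  qed
  from this[OF p0 real_root] deg show ?thesis by simp
qed

lemma size_proots_gram_real:
  fixes A :: "real mat"
  assumes A: "A \<in> carrier_mat n nc"
  shows "size (proots (char_poly (A * mat_adjoint A))) = n"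
proof (rule size_proots_symmetric_real)
  have A': "mat_adjoint A \<in> carrier_mat nc n" by (rule mat_adjoint_carrier[OF A])
  then show "A * mat_adjoint A \<in> carrier_mat n n" using A by simp
  fix i j assume "i < n" "j < n"
  then show "(A * mat_adjoint A) $$ (i, j) = (A * mat_adjoint A) $$ (j, i)"
    using A A' by (simp add: scalar_prod_def mat_adjoint_index[OF A] mult.commute)
qed

lemma size_proots_gram_complex:
  fixes A :: "complex mat"
  assumes A: "A \<in> carrier_mat n nc"
  shows "size (proots (char_poly (A * mat_adjoint A))) = n"
proof -
  have "A * mat_adjoint A \<in> carrier_mat n n" using A mat_adjoint_carrier[OF A] by simp
  then show ?thesis using degree_monic_char_poly[of "A * mat_adjoint A" n] by (simp add: size_proots_complex)
qed

section \<open>Perturbation of trimmed Sylvester matrices\<close>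

lemma vnorm_smult: "vnorm (a \<cdot>\<^sub>v v) = norm (a :: 'a::real_normed_field) * vnorm v"
proof -
  have "vnorm (a \<cdot>\<^sub>v v) = L2_set (\<lambda>i. norm a * norm (v $ i)) {..<dim_vec v}"
    unfolding vnorm_def by (intro L2_set_cong) (auto simp: norm_mult)
  then show ?thesis by (simp add: vnorm_def L2_set_right_distrib)
qed

lemma spectral_norm_altdef:
  fixes A :: "'a::real_normed_field mat"
  assumes A: "A \<in> carrier_mat n nc"
  shows "spectral_norm A = (SUP v\<in>{v \<in> carrier_vec nc. vnorm v \<le> 1}. vnorm (A *\<^sub>v v))"
proof -
  have *: "{v \<in> carrier_vec (dim_col A). L2_set (\<lambda>j. norm (v $ j)) {..<dim_col A} \<le> 1} =
      {v \<in> carrier_vec nc. vnorm v \<le> 1}"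
    using A by (auto simp: vnorm_def)
  show ?thesis unfolding spectral_norm_def * by (simp add: vnorm_def)
qed

text \<open>Boundedness makes the supremum in the spectral norm meaningful; the entrywise bound is
  used for smallness in part (a).\<close>

lemma spectral_norm_le_sum:
  fixes A :: "'a::real_normed_field mat"
  assumes A: "A \<in> carrier_mat n nc"
  shows "spectral_norm A \<le> (\<Sum>i<n. \<Sum>j<nc. norm (A $$ (i, j)))"
    and "bdd_above ((\<lambda>v. vnorm (A *\<^sub>v v)) ` {v \<in> carrier_vec nc. vnorm v \<le> 1})"
proof -
  let ?F = "\<Sum>i<n. \<Sum>j<nc. norm (A $$ (i, j))"
  have le: "vnorm (A *\<^sub>v v) \<le> ?F" if "v \<in> carrier_vec nc" "vnorm v \<le> 1" for v
  proof -
    have "?F * vnorm v \<le> ?F * 1" using that(2) by (intro mult_left_mono) (auto intro!: sum_nonneg)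
    then show ?thesis using vnorm_mult_vec_le[OF A that(1)] by simp
  qed
  then show "bdd_above ((\<lambda>v. vnorm (A *\<^sub>v v)) ` {v \<in> carrier_vec nc. vnorm v \<le> 1})"
    by (intro bdd_aboveI2[where M = ?F]) auto
  have "vnorm (0\<^sub>v nc :: 'a vec) \<le> 1" using vnorm_eq_0[of "0\<^sub>v nc :: 'a vec" nc] by simp
  then have "0\<^sub>v nc \<in> {v \<in> carrier_vec nc. vnorm (v :: 'a vec) \<le> 1}" by simp
  then have "{v \<in> carrier_vec nc. vnorm v \<le> 1} \<noteq> ({} :: 'a vec set)" by blast
  then show "spectral_norm A \<le> ?F"
    unfolding spectral_norm_altdef[OF A] using le by (intro cSUP_least) auto
qed

lemma vnorm_le_spectral_norm:
  fixes A :: "'a::real_normed_field mat"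
  assumes A: "A \<in> carrier_mat n nc" and v: "v \<in> carrier_vec nc"
  shows "vnorm (A *\<^sub>v v) \<le> spectral_norm A * vnorm v"
proof (cases "vnorm v = 0")
  case True
  then show ?thesis using vnorm_mult_vec_le[OF A v] by simp
next
  case False
  let ?c = "of_real (1 / vnorm v) :: 'a"
  have u: "?c \<cdot>\<^sub>v v \<in> {v \<in> carrier_vec nc. vnorm v \<le> 1}"
    using v False by (simp add: vnorm_smult norm_divide)
  have "vnorm (A *\<^sub>v (?c \<cdot>\<^sub>v v)) \<le> spectral_norm A"
    unfolding spectral_norm_altdef[OF A] by (rule cSUP_upper[OF u spectral_norm_le_sum(2)[OF A]])
  also have "A *\<^sub>v (?c \<cdot>\<^sub>v v) = ?c \<cdot>\<^sub>v (A *\<^sub>v v)" by (rule mult_mat_vec[OF A v])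
  finally show ?thesis using False vnorm_nonneg[of v]
    by (simp add: vnorm_smult norm_divide field_simps)
qed

lemma spectral_norm_nonneg:
  fixes A :: "'a::real_normed_field mat"
  assumes A: "A \<in> carrier_mat n nc"
  shows "0 \<le> spectral_norm A"
proof -
  have "vnorm (0\<^sub>v nc :: 'a vec) \<le> 1" using vnorm_eq_0[of "0\<^sub>v nc :: 'a vec" nc] by simp
  then have u: "(0\<^sub>v nc :: 'a vec) \<in> {v \<in> carrier_vec nc. vnorm v \<le> 1}" by simp
  have "vnorm (A *\<^sub>v 0\<^sub>v nc) \<le> spectral_norm A"
    unfolding spectral_norm_altdef[OF A] by (rule cSUP_upper[OF u spectral_norm_le_sum(2)[OF A]])
  then show ?thesis using vnorm_nonneg order_trans by blast
qed

lemma L2_set_sum_le: "finite C \<Longrightarrow> L2_set (\<lambda>x. \<Sum>c\<in>C. f c x) S \<le> (\<Sum>c\<in>C. L2_set (f c) S)"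
proof (induction C rule: finite_induct)
  case (insert c C)
  then show ?case
    using order_trans[OF L2_set_triangle_ineq[of "f c" "\<lambda>x. \<Sum>c\<in>C. f c x" S]] by simp
qed (simp add: L2_set_def)

lemma vnorm_trimmed_sylvester_mult_vec:
  fixes M :: "'a::real_normed_field poly mat"
  assumes M: "M \<in> poly_mat_space ds n" and ds: "ds \<noteq> []"
  shows "vnorm (trimmed_sylvester ds k M *\<^sub>v v) =
    L2_set (\<lambda>(i, t). norm ((trimmed_sylvester ds k M *\<^sub>v v) $ trim_index ds k i t))
      (SIGMA i:{..<length ds}. {..<k + ds ! i})"
proof -
  let ?S = "SIGMA i:{..<length ds}. {..<k + ds ! i}"
  define y where "y = trimmed_sylvester ds k M *\<^sub>v v"
  have "dim_vec y = k * length ds + sum_list ds"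
    using trimmed_sylvester_carrier[OF M ds, of k] by (simp add: y_def)
  moreover have "(\<Sum>r<k * length ds + sum_list ds. (norm (y $ r))\<^sup>2) =
      (\<Sum>(i, t)\<in>?S. (norm (y $ trim_index ds k i t))\<^sup>2)"
    unfolding sum_trim_index[OF ds] by (rule sum.Sigma) auto
  ultimately show ?thesis
    unfolding y_def[symmetric] by (simp add: vnorm_def L2_set_def case_prod_beta)
qed

text \<open>Each of the \<open>k\<close> block columns of \<open>T\<^sub>k\<close> is a copy of \<open>T\<^sub>1\<close> padded by zero rows.\<close>

lemma vnorm_trimmed_sylvester_le:
  fixes M :: "'a::real_normed_field poly mat"
  assumes M: "M \<in> poly_mat_space ds n" and ds: "ds \<noteq> []"
    and v: "v \<in> carrier_vec (k * (length ds + n))"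
  shows "vnorm (trimmed_sylvester ds k M *\<^sub>v v) \<le>
    sqrt (real k) * spectral_norm (trimmed_sylvester ds 1 M) * vnorm v"
proof -
  let ?q = "length ds + n" and ?S = "SIGMA i:{..<length ds}. {..<k + ds ! i}"
  let ?s = "spectral_norm (trimmed_sylvester ds 1 M)"
  have T1: "trimmed_sylvester ds 1 M \<in> carrier_mat (length ds + sum_list ds) ?q"
    using trimmed_sylvester_carrier[OF M ds, of 1] by simp
  define u where "u c = vec ?q (\<lambda>j. v $ (c * ?q + j))" for c
  have u: "u c \<in> carrier_vec ?q" for c by (simp add: u_def)
  \<comment> \<open>\<open>Y c\<close> collects the absolute values of the contribution of block
    column \<open>c\<close>; its nonzero rows are those of \<open>T_1\<close> applied to block
    \<open>c\<close> of \<open>v\<close>.\<close>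
  define Y where "Y c = (\<lambda>(i, t). norm (\<Sum>j<?q. (if c \<le> t then coeff (M $$ (i, j)) (t - c) else 0) * u c $ j))" for c
  have Y: "L2_set (Y c) ?S = vnorm (trimmed_sylvester ds 1 M *\<^sub>v u c)" if c: "c < k" for c
  proof -
    have inner: "(\<Sum>t<k + ds ! i. (Y c (i, t))\<^sup>2) =
        (\<Sum>t<1 + ds ! i. (norm ((trimmed_sylvester ds 1 M *\<^sub>v u c) $ trim_index ds 1 i t))\<^sup>2)"
      if i: "i < length ds" for i
    proof -
      have "(\<Sum>t<k + ds ! i. (Y c (i, t))\<^sup>2) = (\<Sum>t\<in>{c..<c + (1 + ds ! i)}. (Y c (i, t))\<^sup>2)"
      proof (rule sum.mono_neutral_right)
        show "\<forall>t\<in>{..<k + ds ! i} - {c..<c + (1 + ds ! i)}. (Y c (i, t))\<^sup>2 = 0"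
        proof
          fix t assume "t \<in> {..<k + ds ! i} - {c..<c + (1 + ds ! i)}"
          then have t: "t < c \<or> ds ! i < t - c" by auto
          have "(if c \<le> t then coeff (M $$ (i, j)) (t - c) else 0) = 0" if "j < ?q" for j
          proof -
            have "degree (M $$ (i, j)) \<le> ds ! i" using M i that by (auto simp: poly_mat_space_def)
            then show ?thesis using t by (auto intro!: coeff_eq_0)
          qed
          then show "(Y c (i, t))\<^sup>2 = 0" by (simp add: Y_def)
        qed
      qed (use c in auto)
      also have "\<dots> = (\<Sum>t<1 + ds ! i. (Y c (i, c + t))\<^sup>2)"
        using sum.shift_bounds_nat_ivl[of "\<lambda>t. (Y c (i, t))\<^sup>2" 0 c "1 + ds ! i"]
        by (simp add: atLeast0LessThan add.commute)
      also have "\<dots> = (\<Sum>t<1 + ds ! i. (norm ((trimmed_sylvester ds 1 M *\<^sub>v u c) $ trim_index ds 1 i t))\<^sup>2)"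
        using trimmed_sylvester_mult_vec_index[OF M ds i, of _ 1 "u c"] u[of c]
        by (intro sum.cong refl) (simp add: Y_def)
      finally show ?thesis .
    qed
    have "(\<Sum>i<length ds. \<Sum>t<k + ds ! i. (Y c (i, t))\<^sup>2) = (\<Sum>i<length ds. \<Sum>t<1 + ds ! i.
        (norm ((trimmed_sylvester ds 1 M *\<^sub>v u c) $ trim_index ds 1 i t))\<^sup>2)"
      by (rule sum.cong[OF refl], rule inner) simp
    then have "L2_set (Y c) ?S = L2_set (\<lambda>(i, t). norm ((trimmed_sylvester ds 1 M *\<^sub>v u c) $ trim_index ds 1 i t))
        (SIGMA i:{..<length ds}. {..<1 + ds ! i})"
      unfolding L2_set_def by (simp add: sum.Sigma case_prod_beta del: sum.lessThan_Suc)
    then show ?thesis by (simp add: vnorm_trimmed_sylvester_mult_vec[OF M ds])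
  qed
  have "vnorm (trimmed_sylvester ds k M *\<^sub>v v) \<le> L2_set (\<lambda>x. \<Sum>c<k. Y c x) ?S"
    unfolding vnorm_trimmed_sylvester_mult_vec[OF M ds]
  proof (intro L2_set_mono)
    fix x assume "x \<in> ?S"
    then obtain i t where x: "x = (i, t)" "i < length ds" "t < k + ds ! i" by auto
    have "norm ((trimmed_sylvester ds k M *\<^sub>v v) $ trim_index ds k i t) \<le> (\<Sum>c<k. Y c (i, t))"
      unfolding trimmed_sylvester_mult_vec_index[OF M ds x(2,3) v]
      by (rule order_trans[OF norm_sum]) (simp add: Y_def u_def)
    then show "(case x of (i, t) \<Rightarrow> norm ((trimmed_sylvester ds k M *\<^sub>v v) $ trim_index ds k i t)) \<le> (\<Sum>c<k. Y c x)"
      by (simp add: x)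
  qed (auto split: prod.splits)
  also have "\<dots> \<le> (\<Sum>c<k. L2_set (Y c) ?S)" by (rule L2_set_sum_le) simp
  also have "\<dots> \<le> (\<Sum>c<k. ?s * vnorm (u c))"
    using Y vnorm_le_spectral_norm[OF T1 u] by (intro sum_mono) simp
  \<comment> \<open>Cauchy-Schwarz against the constant sequence 1 bounds the sum of the
    \<open>k\<close> block norms. This is the origin of \<open>sqrt k\<close> in the
    theorem.\<close>
  also have "\<dots> = ?s * (\<Sum>c<k. \<bar>1\<bar> * \<bar>vnorm (u c)\<bar>)" by (simp add: sum_distrib_left)
  also have "\<dots> \<le> ?s * (L2_set (\<lambda>c. 1) {..<k} * L2_set (\<lambda>c. vnorm (u c)) {..<k})"
    by (intro mult_left_mono L2_set_mult_ineq spectral_norm_nonneg[OF T1])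
  also have "L2_set (\<lambda>c. 1) {..<k} = sqrt (real k)" by (simp add: L2_set_def)
  also have "L2_set (\<lambda>c. vnorm (u c)) {..<k} = vnorm v"
    using v by (simp add: vnorm_def L2_set_def sum_nonneg u_def sum_blocks)
  finally show ?thesis by (simp add: mult_ac)
qed

section \<open>Stability of full row rank\<close>

lemma poly_mat_space_diff:
  fixes M M' :: "'a::ab_group_add poly mat"
  assumes "M \<in> poly_mat_space ds n" "M' \<in> poly_mat_space ds n"
  shows "M - M' \<in> poly_mat_space ds n"
proof -
  have "M - M' \<in> carrier_mat (length ds) (length ds + n)"
    using assms by (auto simp: poly_mat_space_def intro: minus_carrier_mat)
  then show ?thesis using assms
    by (auto simp: poly_mat_space_def intro!: degree_diff_le)
qed

lemma trimmed_sylvester_diff: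
  fixes M :: "'a::comm_ring_1 poly mat"
  assumes M: "M \<in> poly_mat_space ds n" and M': "M' \<in> poly_mat_space ds n" and ds: "ds \<noteq> []"
  shows "trimmed_sylvester ds k M - trimmed_sylvester ds k M' = trimmed_sylvester ds k (M - M')"
proof (rule eq_matI)
  let ?q = "length ds + n"
  note D = poly_mat_space_diff[OF M M']
  note car = trimmed_sylvester_carrier[OF M ds, of k] trimmed_sylvester_carrier[OF M' ds, of k]
    trimmed_sylvester_carrier[OF D ds, of k]
  fix r h assume "r < dim_row (trimmed_sylvester ds k (M - M'))" "h < dim_col (trimmed_sylvester ds k (M - M'))"
  then have r: "r < k * length ds + sum_list ds" and h: "h < k * ?q" using car by auto
  obtain i t where it: "i < length ds" "t < k + ds ! i" "r = trim_index ds k i t"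
    using trim_index_surj[OF ds r] by blast
  have cj: "h div ?q < k" "h mod ?q < ?q" using h ds by (auto simp: less_mult_imp_div_less)
  have hh: "h = h div ?q * ?q + h mod ?q" by (rule div_mult_mod_eq[symmetric])
  have "(M - M') $$ (i, h mod ?q) = M $$ (i, h mod ?q) - M' $$ (i, h mod ?q)"
    using M' it(1) cj(2) by (auto simp: poly_mat_space_def)
  then have "trimmed_sylvester ds k (M - M') $$ (trim_index ds k i t, h div ?q * ?q + h mod ?q) =
      trimmed_sylvester ds k M $$ (trim_index ds k i t, h div ?q * ?q + h mod ?q) -
      trimmed_sylvester ds k M' $$ (trim_index ds k i t, h div ?q * ?q + h mod ?q)"
    unfolding trimmed_sylvester_index[OF M ds it(1,2) cj] trimmed_sylvester_index[OF M' ds it(1,2) cj]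
      trimmed_sylvester_index[OF D ds it(1,2) cj] by simp
  then show "(trimmed_sylvester ds k M - trimmed_sylvester ds k M') $$ (r, h) =
      trimmed_sylvester ds k (M - M') $$ (r, h)"
    unfolding it(3)[symmetric] hh[symmetric] using car r h by simp
qed (use trimmed_sylvester_carrier[OF M ds, of k] trimmed_sylvester_carrier[OF M' ds, of k]
    trimmed_sylvester_carrier[OF poly_mat_space_diff[OF M M'] ds, of k] in auto)

lemma conjugate_sum: "conjugate (\<Sum>i\<in>A. f i) = (\<Sum>i\<in>A. conjugate (f i :: 'a::conjugatable_field))"
  by (induction A rule: infinite_finite_induct) (simp_all add: conjugate_dist_add)

text \<open>Rank is tested with the transpose, singular values with the adjoint; conjugating the
  vector passes from one to the other.\<close>

lemma mat_adjoint_mult_conjugate: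
  fixes A :: "'a::conjugatable_field mat"
  assumes A: "A \<in> carrier_mat n nc" and x: "x \<in> carrier_vec n"
  shows "mat_adjoint A *\<^sub>v map_vec conjugate x = map_vec conjugate (A\<^sup>T *\<^sub>v x)"
proof (rule eq_vecI)
  fix j assume "j < dim_vec (map_vec conjugate (A\<^sup>T *\<^sub>v x))"
  then have j: "j < nc" using A by simp
  then show "(mat_adjoint A *\<^sub>v map_vec conjugate x) $ j = map_vec conjugate (A\<^sup>T *\<^sub>v x) $ j"
    using A x mat_adjoint_carrier[OF A]
    by (simp add: scalar_prod_def atLeast0LessThan mat_adjoint_index[OF A] conjugate_sum conjugate_dist_mul)
qed (use A mat_adjoint_carrier[OF A] in auto)

text \<open>On the conjugate \<open>y\<close> of a left kernel vector of \<open>T_k(M')\<close>, the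
  adjoints of \<open>T_k(M)\<close> and of the difference \<open>T_k(M) - T_k(M')\<close> agree. The
  first expands \<open>y\<close> by at least the smallest singular value and the second by less,
  unless \<open>y = 0\<close>.\<close>

lemma perturbed_trimmed_full_rank:
  fixes M M' :: "'a::inner_conjugatable_field poly mat"
  assumes split: "\<And>(A :: 'a mat) n nc. A \<in> carrier_mat n nc \<Longrightarrow>
      size (proots (char_poly (A * mat_adjoint A))) = n"
    and M: "M \<in> poly_mat_space ds n" and M': "M' \<in> poly_mat_space ds n" and ds: "ds \<noteq> []"
    and k: "1 \<le> k"
    and rank: "mat_rank (trimmed_sylvester ds k M) = k * length ds + sum_list ds"
    and close: "spectral_norm (trimmed_sylvester ds 1 M - trimmed_sylvester ds 1 M') <
      singular_value (k * length ds + sum_list ds) (trimmed_sylvester ds k M) / sqrt (real k)"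
  shows "mat_rank (trimmed_sylvester ds k M') = k * length ds + sum_list ds"
proof -
  let ?q = "length ds + n" and ?r = "k * length ds + sum_list ds"
  let ?A = "trimmed_sylvester ds k M" and ?A' = "trimmed_sylvester ds k M'"
  let ?E = "trimmed_sylvester ds k (M - M')"
  let ?s = "spectral_norm (trimmed_sylvester ds 1 (M - M'))"
  note D = poly_mat_space_diff[OF M M']
  have A: "?A \<in> carrier_mat ?r (k * ?q)" and A': "?A' \<in> carrier_mat ?r (k * ?q)"
    and E: "?E \<in> carrier_mat ?r (k * ?q)"
    using trimmed_sylvester_carrier[OF M ds] trimmed_sylvester_carrier[OF M' ds]
      trimmed_sylvester_carrier[OF D ds] by blast+
  have r: "0 < ?r" using ds k by simp
  \<comment> \<open>Full row rank forces at least as many columns as rows, so the singular values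
    come from the Gram matrix \<open>A A^*\<close>.\<close>
  have rq: "?r \<le> k * ?q" using vec_space.rank_le_nc[OF A] rank A by simp
  have sq: "0 < sqrt (real k)" using k by simp
  have less: "sqrt (real k) * ?s < singular_value ?r ?A"
    using close sq unfolding trimmed_sylvester_diff[OF M M' ds] by (simp add: field_simps)
  have "x = 0\<^sub>v ?r" if x: "x \<in> carrier_vec ?r" and 0: "?A'\<^sup>T *\<^sub>v x = 0\<^sub>v (k * ?q)" for x
  proof -
    define y where "y = map_vec conjugate x"
    have y: "y \<in> carrier_vec ?r" using x by (simp add: y_def)
    define z where "z = mat_adjoint ?E *\<^sub>v y"
    have z: "z \<in> carrier_vec (k * ?q)" using mat_adjoint_carrier[OF E] y by (simp add: z_def)
    have "?E = ?A - ?A'" by (rule trimmed_sylvester_diff[OF M M' ds, symmetric])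
    then have "?E\<^sup>T *\<^sub>v x = ?A\<^sup>T *\<^sub>v x - ?A'\<^sup>T *\<^sub>v x"
      using A A' x by (simp add: transpose_minus[OF A A'] minus_mult_distrib_mat_vec[of _ "k * ?q" ?r])
    also have "\<dots> = ?A\<^sup>T *\<^sub>v x" using A x 0 by simp
    finally have zA: "z = mat_adjoint ?A *\<^sub>v y"
      unfolding z_def y_def mat_adjoint_mult_conjugate[OF E x] mat_adjoint_mult_conjugate[OF A x] by simp
    \<comment> \<open>The norm estimate is available for \<open>E\<close> and not for its adjoint;
      pairing \<open>E z\<close> with \<open>y\<close> transfers it.\<close>
    have "vnorm z * vnorm z = vinner (?E *\<^sub>v z) y"
      using vinner_adjoint[OF E z y] by (simp add: z_def[symmetric] vnorm_power2[symmetric] power2_eq_square)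
    also have "\<dots> \<le> vnorm (?E *\<^sub>v z) * vnorm y" using E z y by (intro vinner_le[of _ ?r]) auto
    also have "\<dots> \<le> (sqrt (real k) * ?s * vnorm z) * vnorm y"
      by (intro mult_right_mono vnorm_trimmed_sylvester_le[OF D ds z]) simp
    finally have "vnorm z * vnorm z \<le> (sqrt (real k) * ?s * vnorm y) * vnorm z" by (simp add: mult_ac)
    moreover have "0 \<le> ?s"
      using trimmed_sylvester_carrier[OF D ds, of 1] by (rule spectral_norm_nonneg)
    ultimately have zy: "vnorm z \<le> sqrt (real k) * ?s * vnorm y"
      by (cases "vnorm z = 0") (simp_all add: less_le)
    have "singular_value ?r ?A * vnorm y \<le> vnorm z"
      unfolding zA by (rule singular_value_mult_vnorm_le[OF A r rq split[OF A] y])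
    then have "(singular_value ?r ?A - sqrt (real k) * ?s) * vnorm y \<le> 0" using zy by (simp add: algebra_simps)
    then have "vnorm y \<le> 0" using less by (simp add: mult_le_0_iff)
    then have "vnorm y = 0" using vnorm_nonneg[of y] by linarith
    then have "y = 0\<^sub>v ?r" using vnorm_eq_0[OF y] by simp
    then have "conjugate (x $ i) = 0" if "i < ?r" for i
      using that x unfolding y_def by (metis carrier_vecD index_map_vec(1) index_zero_vec(1))
    then show ?thesis using x by (intro eq_vecI) auto
  qed
  then show ?thesis using mat_rank_eq_dim_row_iff[OF A'] A' by simp
qed

section \<open>Moving a rank deficiency away from infinity\<close>

lemma tendsto_coeff_linear_power:
  "((\<lambda>\<delta>. coeff ([:1, of_real \<delta>:] ^ e :: 'a::real_normed_field poly) s) \<longlongrightarrow> coeff 1 s) (at_right 0)"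
proof (induction e arbitrary: s)
  case 0
  show ?case by simp
next
  case (Suc e)
  have step: "coeff ([:1, of_real \<delta>:] ^ Suc e :: 'a poly) s = coeff ([:1, of_real \<delta>:] ^ e) s +
      of_real \<delta> * (case s of 0 \<Rightarrow> 0 | Suc r \<Rightarrow> coeff ([:1, of_real \<delta>:] ^ e) r)" for \<delta>
    by (cases s) (simp_all add: mult_pCons_left)
  have "((\<lambda>\<delta>. case s of 0 \<Rightarrow> 0 | Suc r \<Rightarrow> coeff ([:1, of_real \<delta>:] ^ e :: 'a poly) r) \<longlongrightarrow>
      (case s of 0 \<Rightarrow> 0 | Suc r \<Rightarrow> coeff 1 r)) (at_right 0)"
    by (cases s) (simp_all only: nat.case Suc.IH tendsto_const)
  moreover have "((\<lambda>\<delta>. of_real \<delta> :: 'a) \<longlongrightarrow> 0) (at_right 0)"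
    using tendsto_of_real[OF tendsto_ident_at, of 0 "{0<..}"] by simp
  ultimately have "((\<lambda>\<delta>. coeff ([:1, of_real \<delta>:] ^ e :: 'a poly) s +
      of_real \<delta> * (case s of 0 \<Rightarrow> 0 | Suc r \<Rightarrow> coeff ([:1, of_real \<delta>:] ^ e :: 'a poly) r)) \<longlongrightarrow>
      coeff 1 s + 0 * (case s of 0 \<Rightarrow> 0 | Suc r \<Rightarrow> coeff 1 r)) (at_right 0)"
    by (intro tendsto_add tendsto_mult Suc.IH)
  then show ?case unfolding step by simp
qed

text \<open>
  Row \<open>i\<close>, homogenised as a form of degree \<open>d\<^sub>i\<close> in \<open>(\<lambda>, \<mu>)\<close>, is evaluated at \<open>\<mu> = 1 + \<delta>\<lambda>\<close>. This moves the
  rank deficiency at \<open>\<lambda> = \<infinity>\<close>, that is, of the leading row-wise coefficient matrix, to \<open>\<lambda> = -1/\<delta>\<close>.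
\<close>

definition shift_infinity :: "nat list \<Rightarrow> real \<Rightarrow> 'a::real_normed_field poly mat \<Rightarrow> 'a poly mat" where
  "shift_infinity ds \<delta> M = mat (dim_row M) (dim_col M) (\<lambda>(i, j).
     \<Sum>l\<le>ds ! i. monom (coeff (M $$ (i, j)) l) l * [:1, of_real \<delta>:] ^ (ds ! i - l))"

lemma shift_infinity_index:
  assumes "M \<in> poly_mat_space ds n" "i < length ds" "j < length ds + n"
  shows "shift_infinity ds \<delta> M $$ (i, j) =
    (\<Sum>l\<le>ds ! i. monom (coeff (M $$ (i, j)) l) l * [:1, of_real \<delta>:] ^ (ds ! i - l))"
  using assms by (auto simp: poly_mat_space_def shift_infinity_def)

lemma shift_infinity_in_poly_mat_space:
  assumes M: "M \<in> poly_mat_space ds n"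
  shows "shift_infinity ds \<delta> M \<in> poly_mat_space ds n"
proof -
  have "degree (\<Sum>l\<le>ds ! i. monom (coeff p l) l * [:1, of_real \<delta>:] ^ (ds ! i - l)) \<le> ds ! i"
    for i and p :: "'a poly"
  proof (rule degree_sum_le)
    fix l assume l: "l \<in> {..ds ! i}"
    have "degree ([:1, of_real \<delta> :: 'a:] ^ (ds ! i - l)) \<le> degree [:1, of_real \<delta> :: 'a:] * (ds ! i - l)"
      by (rule degree_power_le)
    also have "\<dots> \<le> 1 * (ds ! i - l)" by (intro mult_right_mono) auto
    finally have "degree (monom (coeff p l) l) + degree ([:1, of_real \<delta> :: 'a:] ^ (ds ! i - l)) \<le> l + (ds ! i - l)"
      using degree_monom_le[of "coeff p l" l] by simp
    then show "degree (monom (coeff p l) l * [:1, of_real \<delta>:] ^ (ds ! i - l)) \<le> ds ! i"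
      using degree_mult_le[of "monom (coeff p l) l" "[:1, of_real \<delta>:] ^ (ds ! i - l)"] l by simp
  qed simp
  then have "degree (shift_infinity ds \<delta> M $$ (i, j)) \<le> ds ! i"
    if "i < length ds" "j < length ds + n" for i j
    using that by (simp add: shift_infinity_index[OF M])
  moreover have "shift_infinity ds \<delta> M \<in> carrier_mat (length ds) (length ds + n)"
    using M by (auto simp: poly_mat_space_def shift_infinity_def)
  ultimately show ?thesis by (simp add: poly_mat_space_def)
qed

text \<open>At -1/\<delta> the factor 1 + \<delta>\<lambda> vanishes, so only the term
  \<open>l = ds ! i\<close>, where its exponent is 0, survives.\<close>

lemma poly_shift_infinity:
  fixes M :: "'a::real_normed_field poly mat"
  assumes M: "M \<in> poly_mat_space ds n" and ij: "i < length ds" "j < length ds + n" and \<delta>: "\<delta> \<noteq> 0"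
  shows "poly (shift_infinity ds \<delta> M $$ (i, j)) (of_real (- 1 / \<delta>)) =
    coeff (M $$ (i, j)) (ds ! i) * of_real (- 1 / \<delta>) ^ (ds ! i)"
proof -
  let ?z = "of_real (- 1 / \<delta>) :: 'a"
  have z: "1 + ?z * of_real \<delta> = 0" using \<delta> by (simp flip: of_real_mult)
  have "poly (shift_infinity ds \<delta> M $$ (i, j)) ?z =
      (\<Sum>l\<le>ds ! i. coeff (M $$ (i, j)) l * ?z ^ l * (1 + ?z * of_real \<delta>) ^ (ds ! i - l))"
    unfolding shift_infinity_index[OF M ij] by (simp add: poly_sum poly_monom)
  also have "\<dots> = (\<Sum>l\<le>ds ! i. if l = ds ! i then coeff (M $$ (i, j)) l * ?z ^ l else 0)"
    unfolding z by (intro sum.cong refl) (auto simp: power_0_left)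
  finally show ?thesis by simp
qed

lemma tendsto_coeff_shift_infinity:
  fixes M :: "'a::real_normed_field poly mat"
  assumes M: "M \<in> poly_mat_space ds n" and ij: "i < length ds" "j < length ds + n"
  shows "((\<lambda>\<delta>. coeff (shift_infinity ds \<delta> M $$ (i, j)) t) \<longlongrightarrow> coeff (M $$ (i, j)) t) (at_right 0)"
proof -
  have deg: "degree (M $$ (i, j)) \<le> ds ! i" using M ij by (simp add: poly_mat_space_def)
  have eq: "coeff (shift_infinity ds \<delta> M $$ (i, j)) t = (\<Sum>l\<le>ds ! i.
      coeff (M $$ (i, j)) l * (if l \<le> t then coeff ([:1, of_real \<delta>:] ^ (ds ! i - l)) (t - l) else 0))" for \<delta>
    unfolding shift_infinity_index[OF M ij] coeff_sum
    by (intro sum.cong refl) (simp add: coeff_monom_mult)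
  have "((\<lambda>\<delta>. coeff (shift_infinity ds \<delta> M $$ (i, j)) t) \<longlongrightarrow> (\<Sum>l\<le>ds ! i.
      coeff (M $$ (i, j)) l * (if l \<le> t then coeff 1 (t - l) else 0))) (at_right 0)"
    unfolding eq
  proof (intro tendsto_sum tendsto_mult tendsto_const)
    fix l
    show "((\<lambda>\<delta>. if l \<le> t then coeff ([:1, of_real \<delta>:] ^ (ds ! i - l) :: 'a poly) (t - l) else 0) \<longlongrightarrow>
        (if l \<le> t then coeff 1 (t - l) else 0)) (at_right 0)"
      by (cases "l \<le> t") (simp_all only: if_True if_False tendsto_coeff_linear_power tendsto_const)
  qed
  also have "(\<Sum>l\<le>ds ! i. coeff (M $$ (i, j)) l * (if l \<le> t then coeff 1 (t - l) else 0)) =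
      (\<Sum>l\<le>ds ! i. if l = t then coeff (M $$ (i, j)) l else 0)"
    by (intro sum.cong refl) auto
  also have "\<dots> = coeff (M $$ (i, j)) t" using deg by (simp add: coeff_eq_0)
  finally show ?thesis .
qed

text \<open>As \<delta> tends to 0 from the right, the coefficients of \<open>shift_infinity\<close>
  tend to those of \<open>M\<close>; the entrywise sum \<open>F\<close> converts this into smallness
  in spectral norm.\<close>

lemma rank_deficient_imp_near_non_minimal:
  fixes M :: "'a::real_normed_field poly mat"
  assumes M: "M \<in> poly_mat_space ds n" and ds: "ds \<noteq> []"
    and rank: "mat_rank (leading_row_coeff_mat ds M) \<noteq> length ds" and \<epsilon>: "0 < \<epsilon>"
  shows "\<exists>M' \<in> poly_mat_space ds n. \<not> minimal_basis M' \<and>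
    spectral_norm (trimmed_sylvester ds 1 M - trimmed_sylvester ds 1 M') < \<epsilon>"
proof -
  let ?m = "length ds" and ?q = "length ds + n"
  let ?N = "\<lambda>\<delta>. shift_infinity ds \<delta> M"
  define F where "F \<delta> = (\<Sum>i<?m. \<Sum>t<1 + ds ! i. \<Sum>j<?q. norm (coeff (M $$ (i, j)) t - coeff (?N \<delta> $$ (i, j)) t))" for \<delta>
  have le: "spectral_norm (trimmed_sylvester ds 1 M - trimmed_sylvester ds 1 (?N \<delta>)) \<le> F \<delta>" for \<delta>
  proof -
    have N: "?N \<delta> \<in> poly_mat_space ds n" by (rule shift_infinity_in_poly_mat_space[OF M])
    note D = poly_mat_space_diff[OF M N]
    let ?T = "trimmed_sylvester ds 1 (M - ?N \<delta>)"
    have "spectral_norm ?T \<le> (\<Sum>r<1 * ?m + sum_list ds. \<Sum>h<1 * ?q. norm (?T $$ (r, h)))"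
      by (rule spectral_norm_le_sum(1)[OF trimmed_sylvester_carrier[OF D ds]])
    also have "\<dots> = (\<Sum>i<?m. \<Sum>t<1 + ds ! i. \<Sum>j<?q. norm (?T $$ (trim_index ds 1 i t, 0 * ?q + j)))"
      unfolding sum_trim_index[OF ds] sum_blocks by simp
    also have "\<dots> = F \<delta>"
      unfolding F_def
    proof (intro sum.cong refl)
      fix i t j assume "i \<in> {..<?m}" "t \<in> {..<1 + ds ! i}" "j \<in> {..<?q}"
      then have it: "i < ?m" "t < 1 + ds ! i" "j < ?q" by auto
      have "(M - ?N \<delta>) $$ (i, j) = M $$ (i, j) - ?N \<delta> $$ (i, j)"
        using N it by (auto simp: poly_mat_space_def)
      moreover have "?T $$ (trim_index ds 1 i t, 0 * ?q + j) =
          (if 0 \<le> t then coeff ((M - ?N \<delta>) $$ (i, j)) (t - 0) else 0)"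
        by (rule trimmed_sylvester_index[OF D ds it(1,2) _ it(3)]) simp
      ultimately show "norm (?T $$ (trim_index ds 1 i t, 0 * ?q + j)) =
          norm (coeff (M $$ (i, j)) t - coeff (?N \<delta> $$ (i, j)) t)"
        by simp
    qed
    finally show ?thesis by (simp add: trimmed_sylvester_diff[OF M N ds])
  qed
  have "(F \<longlongrightarrow> (\<Sum>i<?m. \<Sum>t<1 + ds ! i. \<Sum>j<?q. norm (coeff (M $$ (i, j)) t - coeff (M $$ (i, j)) t))) (at_right 0)"
    unfolding F_def
    by (intro tendsto_sum tendsto_norm tendsto_diff tendsto_const tendsto_coeff_shift_infinity[OF M]) auto
  then have "(F \<longlongrightarrow> 0) (at_right 0)" by simp
  then have "eventually (\<lambda>\<delta>. F \<delta> < \<epsilon>) (at_right 0)" using \<epsilon> by (rule order_tendstoD)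
  moreover have "eventually (\<lambda>\<delta>::real. 0 < \<delta>) (at_right 0)" by (rule eventually_at_right_less)
  ultimately have "eventually (\<lambda>\<delta>. F \<delta> < \<epsilon> \<and> 0 < \<delta>) (at_right 0)" by (rule eventually_conj)
  then obtain \<delta> where \<delta>: "F \<delta> < \<epsilon>" "0 < \<delta>"
    using eventually_happens'[OF trivial_limit_at_right_real] by blast
  have N: "?N \<delta> \<in> poly_mat_space ds n" by (rule shift_infinity_in_poly_mat_space[OF M])
  have "\<not> minimal_basis (?N \<delta>)"
  proof
    assume mb: "minimal_basis (?N \<delta>)"
    obtain w i where w: "\<And>j. j < ?q \<Longrightarrow> (\<Sum>i<?m. w i * coeff (M $$ (i, j)) (ds ! i)) = 0"
      and i: "i < ?m" "w i \<noteq> 0"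
      using rank unfolding leading_row_coeff_mat_full_rank_iff[OF M] lin_indep_family_def by blast
    define z where "z = (of_real (- 1 / \<delta>) :: 'a)"
    have z: "z \<noteq> 0" using \<delta>(2) by (simp add: z_def)
    \<comment> \<open>At \<open>z\<close> row \<open>i\<close> equals the leading row scaled by
      \<open>z ^ (ds ! i)\<close>. Dividing \<open>w i\<close> by this power gives a constant
      combination vanishing at \<open>z\<close>, so saturation would make \<lambda> - z divide a
      nonzero constant.\<close>
    have "[:- z, 1:] dvd [:w i / z ^ (ds ! i):]"
    proof (rule minimal_basis_saturated[OF mb, of _ "\<lambda>i. [:w i / z ^ (ds ! i):]"])
      fix j assume "j < dim_col (?N \<delta>)"
      then have j: "j < ?q" using N by (auto simp: poly_mat_space_def)
      have "poly (\<Sum>i<?m. [:w i / z ^ (ds ! i):] * ?N \<delta> $$ (i, j)) z = (\<Sum>i<?m. w i * coeff (M $$ (i, j)) (ds ! i))"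
        unfolding poly_sum poly_mult
        using poly_shift_infinity[OF M _ j, of _ \<delta>] \<delta>(2) z
        by (intro sum.cong refl) (simp add: z_def)
      then have "poly (\<Sum>i<?m. [:w i / z ^ (ds ! i):] * ?N \<delta> $$ (i, j)) z = 0" by (simp add: w[OF j])
      moreover have "dim_row (?N \<delta>) = ?m" using N by (auto simp: poly_mat_space_def)
      ultimately show "[:- z, 1:] dvd (\<Sum>i<dim_row (?N \<delta>). [:w i / z ^ (ds ! i):] * ?N \<delta> $$ (i, j))"
        by (simp only: poly_eq_0_iff_dvd)
    qed (use N i in \<open>auto simp: poly_mat_space_def\<close>)
    then have "poly [:w i / z ^ (ds ! i):] z = 0" by (simp only: poly_eq_0_iff_dvd)
    then show False using i(2) z by simp
  qed
  moreover have "spectral_norm (trimmed_sylvester ds 1 M - trimmed_sylvester ds 1 (?N \<delta>)) < \<epsilon>"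
    using le[of \<delta>] \<delta>(1) by linarith
  ultimately show ?thesis using N by blast
qed

section \<open>Part (b) and the two base fields\<close>

lemma robust_minimal_basis:
  fixes M :: "'a::inner_conjugatable_field poly mat"
  assumes split: "\<And>(A :: 'a mat) n nc. A \<in> carrier_mat n nc \<Longrightarrow>
      size (proots (char_poly (A * mat_adjoint A))) = n"
    and M: "M \<in> poly_mat_space ds n" and ds: "ds \<noteq> []" and n: "0 < n"
    and mb: "minimal_basis M" and rank: "mat_rank (leading_row_coeff_mat ds M) = length ds"
  shows "\<exists>k\<ge>1. mat_rank (trimmed_sylvester ds k M) = k * length ds + sum_list ds \<and>
    (\<forall>M' \<in> poly_mat_space ds n.
      spectral_norm (trimmed_sylvester ds 1 M - trimmed_sylvester ds 1 M')
        < singular_value (k * length ds + sum_list ds) (trimmed_sylvester ds k M) / sqrt (real k) \<longrightarrow>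
      minimal_basis M' \<and> mat_rank (leading_row_coeff_mat ds M') = length ds)"
proof -
  obtain k where k: "1 \<le> k" "mat_rank (trimmed_sylvester ds k M) = k * length ds + sum_list ds"
    using minimal_basis_imp_trimmed_full_rank[OF M ds mb rank] by blast
  have "minimal_basis M' \<and> mat_rank (leading_row_coeff_mat ds M') = length ds"
    if M': "M' \<in> poly_mat_space ds n"
      and close: "spectral_norm (trimmed_sylvester ds 1 M - trimmed_sylvester ds 1 M') <
        singular_value (k * length ds + sum_list ds) (trimmed_sylvester ds k M) / sqrt (real k)" for M'
    by (rule trimmed_full_rank_imp_minimal_basis[OF M' ds n k(1)])
      (rule perturbed_trimmed_full_rank[OF split M M' ds k close])
  with k show ?thesis by blast
qed

theorem theorem7p2:
  fixes m n :: nat and ds :: "nat list"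
  assumes "m > 0" and "n > 0" and "length ds = m" and "Max (set ds) > 0"
  shows
    "(\<forall>M :: real poly mat. M \<in> poly_mat_space ds n \<and> minimal_basis M \<longrightarrow>
        (mat_rank (leading_row_coeff_mat ds M) < m \<longrightarrow>
          (\<forall>\<epsilon> > 0. \<exists>M' \<in> poly_mat_space ds n. \<not> minimal_basis M' \<and>
             spectral_norm (trimmed_sylvester ds 1 M - trimmed_sylvester ds 1 M') < \<epsilon>)) \<and>
        (mat_rank (leading_row_coeff_mat ds M) = m \<longrightarrow>
          (\<exists>k \<ge> 1. mat_rank (trimmed_sylvester ds k M) = k * m + sum_list ds \<and>
             (\<forall>M' \<in> poly_mat_space ds n.
                spectral_norm (trimmed_sylvester ds 1 M - trimmed_sylvester ds 1 M')
                  < singular_value (k * m + sum_list ds) (trimmed_sylvester ds k M) / sqrt (real k) \<longrightarrow>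
                minimal_basis M' \<and> mat_rank (leading_row_coeff_mat ds M') = m))))
     \<and>
     (\<forall>M :: complex poly mat. M \<in> poly_mat_space ds n \<and> minimal_basis M \<longrightarrow>
        (mat_rank (leading_row_coeff_mat ds M) < m \<longrightarrow>
          (\<forall>\<epsilon> > 0. \<exists>M' \<in> poly_mat_space ds n. \<not> minimal_basis M' \<and>
             spectral_norm (trimmed_sylvester ds 1 M - trimmed_sylvester ds 1 M') < \<epsilon>)) \<and>
        (mat_rank (leading_row_coeff_mat ds M) = m \<longrightarrow>
          (\<exists>k \<ge> 1. mat_rank (trimmed_sylvester ds k M) = k * m + sum_list ds \<and>
             (\<forall>M' \<in> poly_mat_space ds n.
                spectral_norm (trimmed_sylvester ds 1 M - trimmed_sylvester ds 1 M')
                  < singular_value (k * m + sum_list ds) (trimmed_sylvester ds k M) / sqrt (real k) \<longrightarrow>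
                minimal_basis M' \<and> mat_rank (leading_row_coeff_mat ds M') = m))))"
proof -
  have ds: "ds \<noteq> []" using assms(1,3) by auto
  note near = rank_deficient_imp_near_non_minimal[OF _ ds]
  show ?thesis
    unfolding assms(3)[symmetric]
  proof (intro conjI allI impI; (elim conjE)?)
    fix M :: "real poly mat" and \<epsilon> :: real
    assume "M \<in> poly_mat_space ds n" "mat_rank (leading_row_coeff_mat ds M) < length ds" "\<epsilon> > 0"
    then show "\<exists>M' \<in> poly_mat_space ds n. \<not> minimal_basis M' \<and>
        spectral_norm (trimmed_sylvester ds 1 M - trimmed_sylvester ds 1 M') < \<epsilon>"
      by (intro near) auto
  next
    fix M :: "complex poly mat" and \<epsilon> :: real
    assume "M \<in> poly_mat_space ds n" "mat_rank (leading_row_coeff_mat ds M) < length ds" "\<epsilon> > 0"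
    then show "\<exists>M' \<in> poly_mat_space ds n. \<not> minimal_basis M' \<and>
        spectral_norm (trimmed_sylvester ds 1 M - trimmed_sylvester ds 1 M') < \<epsilon>"
      by (intro near) auto
  \<comment> \<open>The fields differ only in why the characteristic polynomial of the Gram matrix
    splits: symmetry over the reals, algebraic closedness over the complex numbers.\<close>
  qed (rule robust_minimal_basis[OF size_proots_gram_real _ ds assms(2)]
      robust_minimal_basis[OF size_proots_gram_complex _ ds assms(2)]; assumption)+
qed

end
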